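(* Let $\mathbf{T}=(T_t\colon t\ge 0)$ be a subordinator with the Laplace exponent $\phi$. Suppose that for some $0<\alpha\le\beta<1$ the functions $$(0,\infty)\ni x\mapsto x^{-\alpha}\phi(x)\qquad\text{and}\qquad (0,\infty)\ni x\mapsto x^{-\beta}\phi(x)$$ are almost increasing and almost decreasing on $(0,\infty)$, respectively. Assume also that the Lévy measure $\nu(\mathrm{d}x)$ has an almost monotone density $\nu(x)$. Then, for every $t>0$, the probability distribution of $T_t$ has a density $p(t,\cdot)$. Moreover, for all $t\in(0,\infty)$ and $x>0$, $$p(t,x)\approx\begin{cases}\big(t(-\phi''(w))\big)^{-1/2}\exp\big\{-t\big(\phi(w)-w\phi'(w)\big)\big\}, & \text{if } 0<x\phi^{-1}(1/t)\le 1,\\[2pt] t x^{-1}\phi(1/x), & \text{if } 1<x\phi^{-1}(1/t),\end{cases}$$ where $w=(\phi')^{-1}(x/t)$.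
   Context: A subordinator is a one-dimensional Lévy process $\mathbf{T}=(T_t\colon t\ge 0)$ with $T_0=0$ and nondecreasing paths. Its Laplace exponent $\phi\colon[0,\infty)\to[0,\infty)$ is defined by $\mathbb{E}\,e^{-\lambda T_t}=e^{-t\phi(\lambda)}$, and $\phi(\lambda)=b\lambda+\int_{(0,\infty)}(1-e^{-\lambda s})\,\nu(\mathrm{d}s)$, where $b\ge 0$ and $\nu$ (the Lévy measure) satisfies $\int_{(0,\infty)}\min\{1,s\}\,\nu(\mathrm{d}s)<\infty$. It is assumed that $\phi''\not\equiv 0$. $p(t,\cdot)$ denotes the continuous version of the density. A function $f\ge 0$ is almost increasing on $(x_0,\infty)$ if there is $c\in(0,1]$ with $cf(x)\le f(y)$ for all $y\ge x>x_0$; it is almost decreasing on $(x_0,\infty)$ if there is $C\ge 1$ with $Cf(x)\ge f(y)$ for all $y\ge x>x_0$. Almost monotone means almost increasing or almost decreasing (on $(0,\infty)$). $\phi^{-1}$ and $(\phi')^{-1}$ are the inverse functions of the strictly increasing function $\phi$ and the strictly decreasing function $\phi'$. The notation $F\approx G$ on a set means that there is a constant $C\ge 1$ with $C^{-1}F\le G\le CF$ everywhere on that set (here uniformly in $t$ and $x$). *)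

theory Defs
  imports "HOL-Probability.Probability"
begin

text \<open>Only times \<open>t \<ge> 0\<close> are relevant; \<open>X t\<close> for \<open>t < 0\<close> is arbitrary.\<close>

locale levy_process = prob_space M for M :: "'a measure" +
  fixes X :: "real \<Rightarrow> 'a \<Rightarrow> real"
  assumes rv: "t \<ge> 0 \<Longrightarrow> random_variable borel (X t)"
    and start: "AE \<omega> in M. X 0 \<omega> = 0"
    and indep_increments:
      "0 \<le> \<tau> 0 \<Longrightarrow> (\<And>i::nat. i < n \<Longrightarrow> \<tau> i \<le> \<tau> (Suc i)) \<Longrightarrow>
        indep_vars (\<lambda>_. borel) (\<lambda>i \<omega>. X (\<tau> (Suc i)) \<omega> - X (\<tau> i) \<omega>) {..<n}"
    and stationary_increments:
      "s \<ge> 0 \<Longrightarrow> h \<ge> 0 \<Longrightarrow>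
        distr M borel (\<lambda>\<omega>. X (s + h) \<omega> - X s \<omega>) = distr M borel (X h)"
    and stochastically_continuous:
      "t \<ge> 0 \<Longrightarrow> \<epsilon> > 0 \<Longrightarrow>
        ((\<lambda>s. prob {\<omega> \<in> space M. \<bar>X s \<omega> - X t \<omega>\<bar> > \<epsilon>}) \<longlongrightarrow> 0) (at t within {0..})"
    and cadlag_paths:
      "AE \<omega> in M. (\<forall>t\<ge>0. continuous (at_right t) (\<lambda>s. X s \<omega>)) \<and>
        (\<forall>t>0. \<exists>l. ((\<lambda>s. X s \<omega>) \<longlongrightarrow> l) (at_left t))"

locale subordinator = levy_process M T for M :: "'a measure" and T +
  assumes nondecreasing_paths: "AE \<omega> in M. mono_on {0..} (\<lambda>t. T t \<omega>)"

definition laplace_exponent ::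
  "'a measure \<Rightarrow> (real \<Rightarrow> 'a \<Rightarrow> real) \<Rightarrow> (real \<Rightarrow> real) \<Rightarrow> bool" where
  "laplace_exponent M T \<phi> \<longleftrightarrow>
    (\<forall>t\<ge>0. \<forall>u\<ge>0. (LINT \<omega>|M. exp (- u * T t \<omega>)) = exp (- t * \<phi> u))"

text \<open>A measure on \<open>(0, \<infinity>)\<close> is represented as a Borel measure on the real line
  that does not charge \<open>(-\<infinity>, 0]\<close>.\<close>

definition levy_measure :: "real measure \<Rightarrow> bool" where
  "levy_measure N \<longleftrightarrow> sets N = sets borel \<and> emeasure N {..0} = 0 \<and>
    (\<integral>\<^sup>+ s \<in> {0<..}. ennreal (min 1 s) \<partial>N) < \<infinity>"

definition levy_khintchine :: "(real \<Rightarrow> real) \<Rightarrow> real \<Rightarrow> real measure \<Rightarrow> bool" where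
  "levy_khintchine \<phi> b N \<longleftrightarrow> b \<ge> 0 \<and> levy_measure N \<and>
    (\<forall>u\<ge>0. \<phi> u = b * u + (LINT s:{0<..}|N. 1 - exp (- u * s)))"

definition almost_increasing :: "real \<Rightarrow> (real \<Rightarrow> real) \<Rightarrow> bool" where
  "almost_increasing x0 f \<longleftrightarrow> (\<forall>x>x0. f x \<ge> 0) \<and>
    (\<exists>c. 0 < c \<and> c \<le> 1 \<and> (\<forall>x y. x0 < x \<and> x \<le> y \<longrightarrow> c * f x \<le> f y))"

definition almost_decreasing :: "real \<Rightarrow> (real \<Rightarrow> real) \<Rightarrow> bool" where
  "almost_decreasing x0 f \<longleftrightarrow> (\<forall>x>x0. f x \<ge> 0) \<and>
    (\<exists>C\<ge>1. \<forall>x y. x0 < x \<and> x \<le> y \<longrightarrow> C * f x \<ge> f y)"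

definition almost_monotone :: "(real \<Rightarrow> real) \<Rightarrow> bool" where
  "almost_monotone f \<longleftrightarrow> almost_increasing 0 f \<or> almost_decreasing 0 f"

text \<open>The values of \<open>\<nu>\<close> outside \<open>(0, \<infinity>)\<close> are irrelevant.\<close>

definition has_levy_density :: "real measure \<Rightarrow> (real \<Rightarrow> real) \<Rightarrow> bool" where
  "has_levy_density N \<nu> \<longleftrightarrow> set_borel_measurable borel {0<..} \<nu> \<and> (\<forall>x>0. \<nu> x \<ge> 0) \<and>
    N = density lborel (\<lambda>x. ennreal (indicator {0<..} x * \<nu> x))"

text \<open>\<open>\<phi>\<close> is considered on \<open>[0, \<infinity>)\<close> and its derivative on \<open>(0, \<infinity>)\<close>. Both inverses are
  total functions, but meaningful only on the respective ranges. If \<open>\<phi>\<close> is a nonzero Laplace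
  exponent with \<open>x powr -\<alpha> * \<phi> x\<close> almost increasing and \<open>x powr -\<beta> * \<phi> x\<close> almost
  decreasing, \<open>0 < \<alpha> \<le> \<beta> < 1\<close>, these ranges are \<open>[0, \<infinity>)\<close> and \<open>(0, \<infinity>)\<close>.\<close>

definition phi_inv :: "(real \<Rightarrow> real) \<Rightarrow> real \<Rightarrow> real" where
  "phi_inv \<phi> = the_inv_into {0..} \<phi>"

definition dphi_inv :: "(real \<Rightarrow> real) \<Rightarrow> real \<Rightarrow> real" where
  "dphi_inv \<phi> = the_inv_into {0<..} (deriv \<phi>)"

definition density_profile :: "(real \<Rightarrow> real) \<Rightarrow> real \<Rightarrow> real \<Rightarrow> real" where
  "density_profile \<phi> t x =
    (if 0 < x * phi_inv \<phi> (1 / t) \<and> x * phi_inv \<phi> (1 / t) \<le> 1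
     then let w = dphi_inv \<phi> (x / t) in
       (t * (- deriv (deriv \<phi>) w)) powr (- 1 / 2) * exp (- t * (\<phi> w - w * deriv \<phi> w))
     else t / x * \<phi> (1 / x))"

end

theory Submission imports Defs begin

text \<open>
  Only the laws \<open>\<mu>\<close> of the single variables \<open>T t\<close> matter: \<open>\<mu>\<close> lives on \<open>[0, \<infinity>)\<close> and has Laplace
  transform \<open>exp (- t \<phi>)\<close>.  The upper scaling of \<open>\<phi>\<close> forces the drift to vanish, and an almost
  increasing Levy density would not be integrable at infinity, so \<open>\<nu>\<close> is almost decreasing.
  Together with both scalings this gives \<open>\<nu> x \<approx> \<phi> (1 / x) / x\<close> (\<open>nu_upper\<close>, \<open>nu_lower\<close>) and
  \<open>w\<^sup>n J n w \<approx> \<phi> w\<close> for the moments \<open>J n w = \<integral> s\<^sup>n exp (- w s) \<nu> s ds\<close>, that is, for the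
  derivatives of \<open>\<phi>\<close> up to sign.

  Two mechanisms then determine the density.

  Exponential tilting.  The law with density proportional to \<open>exp (- w x)\<close> with respect to \<open>\<mu>\<close>
  has characteristic function \<open>exp (t \<integral> (exp (i \<xi> s) - 1) exp (- w s) \<nu> s ds)\<close>
  (\<open>char_tilted\<close>), whose modulus is at most \<open>min 1 (D w\<^sup>2 / (k \<xi>\<^sup>2))\<close>, where \<open>k = t \<phi> w\<close>, uniformly
  as long as \<open>k\<close> stays away from \<open>0\<close> (\<open>exp_damping_le\<close>).  Fourier inversion yields a continuous
  density \<open>f\<close> of the tilted law with \<open>f \<le> C w / sqrt k\<close>, and \<open>p x = exp (w x - t \<phi> w) f x\<close> is a
  continuous density of \<open>\<mu>\<close>.  If \<open>w\<close> is the saddle point, \<open>x = t \<phi>' w\<close>, then \<open>x\<close> is the mean of the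
  tilted law, the linear term of the phase cancels, and \<open>f x \<ge> c w / sqrt k\<close> for large \<open>k\<close>
  (\<open>law_density_ge_at_mean\<close>).  Here \<open>w / sqrt k \<approx> (t (- \<phi>'' w)) powr (- 1 / 2)\<close>.

  Size biasing.  Differentiating the Laplace transform shows that \<open>x \<mu>(dx)\<close> is the convolution
  of \<open>t s \<nu> s ds\<close> with \<open>\<mu>\<close> (\<open>size_bias\<close>, \<open>density_size_bias\<close>).  Hence
  \<open>p x \<ge> c (t / x) \<phi> (1 / x) \<mu> [0, x)\<close>, and \<open>\<mu> [0, x)\<close> is bounded below while \<open>t \<phi> (1 / x)\<close> is
  bounded above (\<open>small_ball\<close>, \<open>law_density_ge_jump\<close>).  Conversely \<open>K x = x p x\<close> satisfies
  \<open>K x \<le> C t \<phi> (1 / x) (1 + S)\<close> if \<open>K \<le> S\<close> on \<open>[0, x]\<close>.  This is a contraction where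
  \<open>t \<phi> (1 / x)\<close> is small; where it is not, tilting with \<open>w = 1 / x\<close> bounds \<open>K\<close>.  So \<open>K\<close> is bounded,
  and one more application gives \<open>p x \<le> C (t / x) \<phi> (1 / x)\<close> (\<open>law_density_le_jump\<close>).

  The condition \<open>x \<phi>\<inverse> (1 / t) \<le> 1\<close> means \<open>t \<phi> (1 / x) \<ge> 1\<close>, and it keeps \<open>k\<close> away from \<open>0\<close> at the
  saddle point \<open>w\<close> (\<open>saddle_regime\<close>).  For large \<open>k\<close> the tilting bounds match the profile; for \<open>k\<close> in
  a bounded range the density and the profile are both comparable with \<open>1 / x\<close>.  In the
  complementary range the size-bias bounds apply.  The constants depend on \<open>\<phi>\<close> and \<open>\<nu>\<close>, not on
  \<open>t\<close> and \<open>x\<close> (\<open>law_density_comparable\<close>).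
\<close>

section \<open>Differentiation under the integral and Laplace transforms\<close>

lemma has_vector_derivative_iff_quotient:
  fixes f :: "real \<Rightarrow> 'b::real_normed_vector"
  shows "(f has_vector_derivative D) (at x) \<longleftrightarrow>
    ((\<lambda>y. inverse (y - x) *\<^sub>R (f y - f x)) \<longlongrightarrow> D) (at x)"
proof -
  have eq: "norm (f y - f x - (y - x) *\<^sub>R D) / norm (y - x)
      = norm (inverse (y - x) *\<^sub>R (f y - f x) - D)" if "y \<noteq> x" for y
  proof -
    have "inverse (y - x) *\<^sub>R (f y - f x) - D = inverse (y - x) *\<^sub>R (f y - f x - (y - x) *\<^sub>R D)"
      using that by (simp add: scaleR_diff_right)
    then show ?thesis
      by (simp add: divide_inverse mult.commute)
  qed
  have "(f has_vector_derivative D) (at x) \<longleftrightarrow>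
    ((\<lambda>y. norm (f y - f x - (y - x) *\<^sub>R D) / norm (y - x)) \<longlongrightarrow> 0) (at x)"
    by (simp add: has_vector_derivative_def has_derivative_iff_norm bounded_linear_scaleR_left)
  also have "\<dots> \<longleftrightarrow> ((\<lambda>y. norm (inverse (y - x) *\<^sub>R (f y - f x) - D)) \<longlongrightarrow> 0) (at x)"
    by (intro filterlim_cong) (auto simp: eventually_at_filter intro!: always_eventually eq[simplified])
  also have "\<dots> \<longleftrightarrow> ((\<lambda>y. inverse (y - x) *\<^sub>R (f y - f x)) \<longlongrightarrow> D) (at x)"
    by (simp add: tendsto_norm_zero_iff Lim_null[symmetric])
  finally show ?thesis .
qed

lemma has_vector_derivative_lebesgue_integral:
  fixes f :: "real \<Rightarrow> 'a \<Rightarrow> 'b::{banach, second_countable_topology}"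
  assumes e: "e > 0"
    and int: "\<And>x. \<bar>x - x0\<bar> < e \<Longrightarrow> integrable M (f x)"
    and der: "\<And>x s. \<bar>x - x0\<bar> < e \<Longrightarrow> s \<in> space M \<Longrightarrow>
      ((\<lambda>x. f x s) has_vector_derivative f' x s) (at x)"
    and bound: "AE s in M. \<forall>x. \<bar>x - x0\<bar> < e \<longrightarrow> norm (f' x s) \<le> g s"
    and g: "integrable M g"
    and meas: "f' x0 \<in> borel_measurable M"
  shows "((\<lambda>x. LINT s|M. f x s) has_vector_derivative (LINT s|M. f' x0 s)) (at x0)"
  unfolding has_vector_derivative_iff_quotient tendsto_at_iff_sequentially comp_def
proof (intro allI impI)
  fix X :: "nat \<Rightarrow> real" assume X: "\<forall>i. X i \<in> UNIV - {x0}" "X \<longlonglongrightarrow> x0"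
  have "eventually (\<lambda>n. \<bar>X n - x0\<bar> < e) sequentially"
    using X(2) e by (auto dest: tendstoD simp: dist_real_def)
  then obtain n0 where n0: "\<And>n. n \<ge> n0 \<Longrightarrow> \<bar>X n - x0\<bar> < e"
    by (auto simp: eventually_sequentially)
  define Y where "Y n = X (n + n0)" for n
  have Y: "Y \<longlonglongrightarrow> x0" "\<And>n. Y n \<noteq> x0" "\<And>n. \<bar>Y n - x0\<bar> < e"
    using X n0 unfolding Y_def by (auto intro: LIMSEQ_ignore_initial_segment)
  have "(\<lambda>n. LINT s|M. inverse (Y n - x0) *\<^sub>R (f (Y n) s - f x0 s)) \<longlonglongrightarrow> (LINT s|M. f' x0 s)"
  proof (rule integral_dominated_convergence[where w=g])
    show "f' x0 \<in> borel_measurable M" "integrable M g" by fact+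
    show "(\<lambda>s. inverse (Y n - x0) *\<^sub>R (f (Y n) s - f x0 s)) \<in> borel_measurable M" for n
      using int[of "Y n"] int[of x0] Y(3) e by (auto dest!: borel_measurable_integrable)
    show "AE s in M. (\<lambda>n. inverse (Y n - x0) *\<^sub>R (f (Y n) s - f x0 s)) \<longlonglongrightarrow> f' x0 s"
    proof (rule AE_I2)
      fix s assume s: "s \<in> space M"
      have "((\<lambda>y. inverse (y - x0) *\<^sub>R (f y s - f x0 s)) \<longlongrightarrow> f' x0 s) (at x0)"
        using der[of x0 s] e s by (simp add: has_vector_derivative_iff_quotient)
      then show "(\<lambda>n. inverse (Y n - x0) *\<^sub>R (f (Y n) s - f x0 s)) \<longlonglongrightarrow> f' x0 s"
        unfolding tendsto_at_iff_sequentially comp_def using Y by auto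
    qed
    show "AE s in M. norm (inverse (Y n - x0) *\<^sub>R (f (Y n) s - f x0 s)) \<le> g s" for n
      using bound AE_space
    proof eventually_elim
      case (elim s)
      define S where "S = {x. \<bar>x - x0\<bar> < e}"
      have "S = ball x0 e" by (auto simp: S_def dist_real_def)
      then have S: "convex S" by simp
      have "norm (f (Y n) s - f x0 s) \<le> g s * norm (Y n - x0)"
      proof (rule differentiable_bound[OF S, where f'="\<lambda>x h. h *\<^sub>R f' x s"])
        show "((\<lambda>a. f a s) has_derivative (\<lambda>h. h *\<^sub>R f' x s)) (at x within S)" if "x \<in> S" for x
          using der[of x s] that elim(2)
          by (auto simp: S_def has_vector_derivative_def intro: has_derivative_at_withinI)
        show "onorm (\<lambda>h. h *\<^sub>R f' x s) \<le> g s" if "x \<in> S" for x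
          using elim that by (auto simp: S_def onorm_scaleR_left onorm_id)
      qed (use Y(3)[of n] e in \<open>auto simp: S_def\<close>)
      then have "norm (f (Y n) s - f x0 s) / \<bar>Y n - x0\<bar> \<le> g s"
        using Y(2)[of n] by (simp add: pos_divide_le_eq)
      then show ?case
        by (simp add: divide_inverse mult.commute)
    qed
  qed
  also have "(\<lambda>n. LINT s|M. inverse (Y n - x0) *\<^sub>R (f (Y n) s - f x0 s))
     = (\<lambda>n. inverse (Y n - x0) *\<^sub>R ((LINT s|M. f (Y n) s) - (LINT s|M. f x0 s)))"
    using int[of "Y _"] int[of x0] Y(3) e by (intro ext) simp
  finally show "(\<lambda>n. inverse (X n - x0) *\<^sub>R ((LINT s|M. f (X n) s) - (LINT s|M. f x0 s)))
      \<longlonglongrightarrow> (LINT s|M. f' x0 s)"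
    unfolding Y_def by (rule LIMSEQ_offset)
qed

lemma norm_iexp [simp]: "norm (iexp x) = 1"
  using norm_exp_i_times by blast

text \<open>A finite measure on the half-line is determined by its Laplace transform at the
  integers.  The image under \<open>x \<mapsto> exp (- x)\<close> lives on \<open>[0, 1]\<close>, so its characteristic
  function is the power series of its moments, which are the given values.\<close>

lemma finite_measure_eqI_laplace:
  fixes m1 m2 :: "real measure"
  assumes fin: "finite_measure m1" "finite_measure m2"
    and sets: "sets m1 = sets borel" "sets m2 = sets borel"
    and pos: "AE x in m1. 0 \<le> x" "AE x in m2. 0 \<le> x"
    and eq: "\<And>n::nat. (LINT x|m1. exp (- (real n * x))) = (LINT x|m2. exp (- (real n * x)))"
  shows "m1 = m2"
proof -
  have space: "space m1 = UNIV" "space m2 = UNIV"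
    using sets by (metis sets_eq_imp_space_eq space_borel)+
  define Z where "Z = measure m1 UNIV"
  have Z2: "measure m2 UNIV = Z"
    using eq[of 0] by (simp add: Z_def space)
  show ?thesis
  proof (cases "Z = 0")
    case True
    have null: "emeasure m A = 0" if "finite_measure m" "measure m UNIV = 0" "space m = UNIV" for m A
    proof -
      have "emeasure m A \<le> emeasure m (space m)" by (rule emeasure_space)
      also have "\<dots> = 0" using that by (simp add: finite_measure.emeasure_eq_measure)
      finally show ?thesis by simp
    qed
    have "emeasure m1 A = 0" "emeasure m2 A = 0" for A
      using True Z2 by (auto intro: null[OF fin(1) _ space(1)] null[OF fin(2) _ space(2)] simp: Z_def)
    then show ?thesis
      using sets by (intro measure_eqI) auto
  next
    case False
    then have Zpos: "Z > 0" unfolding Z_def using measure_nonneg less_eq_real_def by metis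
    \<comment> \<open>The normalised image of \<open>m\<close> under \<open>x \<mapsto> exp (- x)\<close>; it determines \<open>m\<close> because
    \<open>ln\<close> inverts the map.\<close>
    define N where "N m = distr (density m (\<lambda>_. ennreal (1 / Z))) borel (\<lambda>x::real. exp (- x))" for m
    have main: "real_distribution (N m) \<and>
        (\<forall>t. (\<lambda>k. (\<i> * t) ^ k / fact k * complex_of_real ((LINT x|m. exp (- (real k * x))) / Z))
          sums char (N m) t) \<and>
        (\<forall>A\<in>Sigma_Algebra.sets borel. emeasure m A = ennreal Z * emeasure (N m) {u. u > 0 \<and> - ln u \<in> A})"
      if fm: "finite_measure m" and sm[measurable_cong]: "Sigma_Algebra.sets m = Sigma_Algebra.sets borel"
        and pm: "AE x in m. 0 \<le> x"
        and Zm: "measure m UNIV = Z" for m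
    proof (intro conjI allI ballI)
      interpret finite_measure m by fact
      have sp: "space m = UNIV" using sm by (metis sets_eq_imp_space_eq space_borel)
      have em: "emeasure m UNIV = ennreal Z" using Zm by (simp add: emeasure_eq_measure)
      show rd: "real_distribution (N m)"
      proof -
        have "emeasure (N m) (space (N m)) = 1"
          using Zpos em
          by (simp add: N_def emeasure_distr emeasure_density sp nn_integral_cmult
              ennreal_mult''[symmetric])
        then show ?thesis
          by (intro real_distribution.intro real_distribution_axioms.intro prob_spaceI)
            (auto simp: N_def)
      qed
      show "(\<lambda>k. (\<i> * t) ^ k / fact k * complex_of_real ((LINT x|m. exp (- (real k * x))) / Z))
          sums char (N m) t" for t
      proof -
        let ?f = "\<lambda>k x. (\<i> * t * complex_of_real (exp (- x))) ^ k /\<^sub>R fact k"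
        have nf: "AE x in m. norm (?f k x) \<le> \<bar>t\<bar> ^ k / fact k" for k
          using pm
        proof eventually_elim
          case (elim x)
          have "exp (- x) ^ k \<le> 1" using elim by (intro power_le_one) auto
          then have "\<bar>t\<bar> ^ k * exp (- x) ^ k \<le> \<bar>t\<bar> ^ k * 1"
            by (intro mult_left_mono) auto
          then show ?case
            by (simp add: norm_mult norm_power power_mult_distrib norm_divide divide_simps)
        qed
        have inte: "integrable m (?f k)" for k
          using nf by (intro integrable_const_bound[where B="\<bar>t\<bar> ^ k / fact k"]) auto
        have summ: "summable (\<lambda>k. \<bar>t\<bar> ^ k / fact k)"
          using summable_exp_generic[of "\<bar>t\<bar>"] by (simp add: divide_inverse mult.commute)
        have "(\<lambda>k. LINT x|m. ?f k x) sums (LINT x|m. (\<Sum>k. ?f k x))"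
        proof (rule sums_integral)
          show "integrable m (?f k)" for k by (rule inte)
          show "AE x in m. summable (\<lambda>k. norm (?f k x))"
            using summable_norm_exp by (intro AE_I2)
          show "summable (\<lambda>k. LINT x|m. norm (?f k x))"
          proof (rule summable_comparison_test'[OF summable_mult[OF summ, of Z]])
            fix k
            have "norm (LINT x|m. norm (?f k x)) \<le> (LINT x|m. \<bar>t\<bar> ^ k / fact k)"
            proof -
              have "(LINT x|m. norm (?f k x)) \<le> (LINT x|m. \<bar>t\<bar> ^ k / fact k)"
                by (intro integral_mono_AE integrable_norm inte nf) auto
              then show ?thesis
                by (simp only: real_norm_def abs_of_nonneg Bochner_Integration.integral_nonneg norm_ge_zero)
            qed
            also have "\<dots> = Z * (\<bar>t\<bar> ^ k / fact k)" using Zm by (simp add: sp)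
            finally show "norm (LINT x|m. norm (?f k x)) \<le> Z * (\<bar>t\<bar> ^ k / fact k)" .
          qed
        qed
        also have "(LINT x|m. (\<Sum>k. ?f k x)) = (LINT x|m. iexp (t * exp (- x)))"
          by (intro Bochner_Integration.integral_cong) (auto simp: exp_def mult.assoc)
        finally have "(\<lambda>k. (LINT x|m. ?f k x) / complex_of_real Z) sums ((LINT x|m. iexp (t * exp (- x))) / complex_of_real Z)"
          by (rule sums_divide)
        also have "(LINT x|m. iexp (t * exp (- x))) / complex_of_real Z = char (N m) t"
        proof -
          have "char (N m) t = (LINT x|density m (\<lambda>_. ennreal (1 / Z)). iexp (t * exp (- x)))"
            unfolding char_def N_def by (subst integral_distr) auto
          also have "\<dots> = (LINT x|m. (1 / Z) *\<^sub>R iexp (t * exp (- x)))"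
            using Zpos by (subst integral_density) auto
          finally show ?thesis by (simp add: scaleR_conv_of_real)
        qed
        also have "(\<lambda>k. (LINT x|m. ?f k x) / complex_of_real Z)
          = (\<lambda>k. (\<i> * t) ^ k / fact k * complex_of_real ((LINT x|m. exp (- (real k * x))) / Z))"
        proof
          fix k
          have "(LINT x|m. ?f k x) = (LINT x|m. ((\<i> * t) ^ k / fact k) * complex_of_real (exp (- (real k * x))))"
            by (intro Bochner_Integration.integral_cong)
              (auto simp: power_mult_distrib scaleR_conv_of_real exp_of_nat_mult[symmetric] divide_inverse
                simp flip: of_real_power)
          also have "\<dots> = (\<i> * t) ^ k / fact k * complex_of_real (LINT x|m. exp (- (real k * x)))"
            by (simp add: integral_complex_of_real)
          finally show "(LINT x|m. ?f k x) / complex_of_real Z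
            = (\<i> * t) ^ k / fact k * complex_of_real ((LINT x|m. exp (- (real k * x))) / Z)"
            by simp
        qed
        finally show ?thesis .
      qed
      fix A :: "real set" assume A[measurable]: "A \<in> Sigma_Algebra.sets borel"
      have [measurable]: "{u::real. u > 0 \<and> - ln u \<in> A} \<in> Sigma_Algebra.sets borel"
        by measurable
      have "emeasure (N m) {u. u > 0 \<and> - ln u \<in> A} = ennreal (1 / Z) * emeasure m A"
        unfolding N_def by (subst emeasure_distr)
          (auto simp: emeasure_density sp vimage_def nn_integral_cmult_indicator sm)
      then show "emeasure m A = ennreal Z * emeasure (N m) {u. u > 0 \<and> - ln u \<in> A}"
        using Zpos by (simp add: mult.assoc[symmetric] ennreal_mult''[symmetric])
    qed
    note m1 = main[OF fin(1) sets(1) pos(1) Z_def[symmetric]]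
    note m2 = main[OF fin(2) sets(2) pos(2) Z2]
    have "N m1 = N m2"
    proof (rule Levy_uniqueness)
      show "char (N m1) = char (N m2)"
      proof
        fix t show "char (N m1) t = char (N m2) t"
          using m1 m2 sums_unique2 unfolding eq by blast
      qed
    qed (use m1 m2 in auto)
    then show ?thesis
      using m1 m2 sets by (intro measure_eqI) auto
  qed
qed

section \<open>Fourier inversion for integrable characteristic functions\<close>

lemma AE_nonzero_lborel: "AE t in lborel. t \<noteq> (0::real)"
  by (rule AE_I[of _ _ "{0}"]) auto

context real_distribution
begin

text \<open>The density given by Fourier inversion.  It is meaningful when the characteristic function
  is integrable; only the real part is kept, the imaginary part being zero in that case.\<close>

definition inversion_density :: "real \<Rightarrow> real" where
  "inversion_density x = Re (LINT t|lborel. iexp (- (t * x)) * char M t) / (2 * pi)"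

lemma integrable_iexp_char:
  assumes "integrable lborel (char M)"
  shows "integrable lborel (\<lambda>t. iexp (- (t * x)) * char M t)"
  by (rule Bochner_Integration.integrable_bound[OF assms]) (auto simp: norm_mult)

lemma continuous_inversion_density:
  assumes int: "integrable lborel (char M)"
  shows "continuous_on UNIV inversion_density"
proof -
  have "isCont (\<lambda>x. LINT t|lborel. iexp (- (t * x)) * char M t) x" for x
    unfolding continuous_at_sequentially comp_def
  proof safe
    fix X assume X: "X \<longlonglongrightarrow> x"
    show "(\<lambda>n. LINT t|lborel. iexp (- (t * X n)) * char M t) \<longlonglongrightarrow>
        (LINT t|lborel. iexp (- (t * x)) * char M t)"
      by (rule integral_dominated_convergence[where w="\<lambda>t. norm (char M t)"])
        (use int in \<open>auto intro!: tendsto_intros X simp: norm_mult\<close>)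
  qed
  then show ?thesis
    unfolding inversion_density_def[abs_def]
    by (intro continuous_intros continuous_at_imp_continuous_on ballI) auto
qed

lemma abs_inversion_density_le:
  assumes int: "integrable lborel (char M)"
  shows "\<bar>inversion_density x\<bar> \<le> (LINT t|lborel. norm (char M t)) / (2 * pi)"
proof -
  have "\<bar>Re (LINT t|lborel. iexp (- (t * x)) * char M t)\<bar>
      \<le> norm (LINT t|lborel. iexp (- (t * x)) * char M t)"
    by (rule abs_Re_le_cmod)
  also have "\<dots> \<le> (LINT t|lborel. norm (iexp (- (t * x)) * char M t))"
    by (rule integral_norm_bound)
  finally show ?thesis
    by (simp add: inversion_density_def norm_mult divide_right_mono)
qed

text \<open>The inversion theorem for intervals whose endpoints are not atoms.  The kernel is the integral
  of \<open>iexp (- (t * s))\<close> over the interval, so Fubini produces the inversion density.\<close>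

lemma measure_Ioc_eq_inversion:
  assumes int: "integrable lborel (char M)" and ab: "a \<le> b"
    and atoms: "measure M {a} = 0" "measure M {b} = 0"
  shows "measure M {a<..b} = (LINT x|lborel. indicator {a..b} x * inversion_density x)"
proof -
  define K where "K t = (iexp (- (t * a)) - iexp (- (t * b))) / (\<i> * complex_of_real t)" for t :: real
  have [measurable]: "K \<in> borel_measurable borel" unfolding K_def by measurable
  have K_int: "K t = (LINT s|lborel. indicator {a..b} s *\<^sub>R iexp (- (t * s)))" if "t \<noteq> 0" for t
  proof -
    have "(LINT s|lborel. indicator {a..b} s *\<^sub>R iexp (- (t * s)))
       = \<i> * iexp (- (t * b)) / t - \<i> * iexp (- (t * a)) / t"
    proof (rule integral_FTC_Icc[OF ab])
      fix s
      have "((\<lambda>s. \<i> * exp (\<i> * complex_of_real (- (t * s))) / t) has_vector_derivative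
          \<i> * (\<i> * complex_of_real (- t) * iexp (- (t * s))) / t) (at s within {a..b})"
        by (auto intro!: derivative_eq_intros field_vector_diff_chain_within[THEN has_vector_derivative_eq_rhs, unfolded comp_def]
          simp: has_vector_derivative_complex_iff Re_exp Im_exp)
      then show "((\<lambda>s. \<i> * iexp (- (t * s)) / t) has_vector_derivative iexp (- (t * s))) (at s within {a..b})"
        using that by (simp add: mult.assoc[symmetric])
    qed (auto intro!: continuous_intros)
    also have "\<dots> = K t"
      using that by (simp add: K_def field_simps)
    finally show ?thesis ..
  qed
  have K_le: "norm (K t) \<le> b - a" if "t \<noteq> 0" for t
    using Levy_Inversion_aux2[of "-b" "-a" t] ab that by (simp add: K_def)
  have K_char: "integrable lborel (\<lambda>t. K t * char M t)"
  proof (rule Bochner_Integration.integrable_bound)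
    show "integrable lborel (\<lambda>t. (b - a) * norm (char M t))"
      using int by auto
    show "AE t in lborel. norm (K t * char M t) \<le> norm ((b - a) * norm (char M t))"
      using AE_nonzero_lborel
      by eventually_elim (use ab K_le in \<open>auto simp: norm_mult intro!: mult_right_mono\<close>)
  qed auto
  have "(\<lambda>n. 1 / (2 * pi) * (LINT t|lborel. indicator {- real n<..<real n} t *\<^sub>R (K t * char M t)))
      \<longlonglongrightarrow> complex_of_real (1 / (2 * pi)) * (LINT t|lborel. K t * char M t)"
  proof (intro tendsto_intros, rule integral_dominated_convergence[where w="\<lambda>t. norm (K t * char M t)"])
    show "AE t in lborel. (\<lambda>n. indicator {- real n<..<real n} t *\<^sub>R (K t * char M t)) \<longlonglongrightarrow> K t * char M t"
    proof (rule AE_I2)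
      fix t :: real
      obtain n0 :: nat where n0: "\<bar>t\<bar> < real n0" using reals_Archimedean2 by blast
      have "eventually (\<lambda>n. K t * char M t = indicator {- real n<..<real n} t *\<^sub>R (K t * char M t)) sequentially"
        unfolding eventually_sequentially
        by (rule exI[of _ n0]) (use n0 in \<open>auto simp: indicator_def\<close>)
      then show "(\<lambda>n. indicator {- real n<..<real n} t *\<^sub>R (K t * char M t)) \<longlonglongrightarrow> K t * char M t"
        using tendsto_const tendsto_cong by fast
    qed
  qed (use K_char in \<open>auto simp: indicator_def\<close>)
  moreover have "(\<lambda>n. 1 / (2 * pi) * (LINT t|lborel. indicator {- real n<..<real n} t *\<^sub>R (K t * char M t)))
      \<longlonglongrightarrow> complex_of_real (measure M {a<..b})"
    using Levy_Inversion[OF ab atoms]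
    by (simp add: interval_lebesgue_integral_def set_lebesgue_integral_def K_def)
  ultimately have "complex_of_real (measure M {a<..b})
      = complex_of_real (1 / (2 * pi)) * (LINT t|lborel. K t * char M t)"
    using LIMSEQ_unique by blast
  also have "(LINT t|lborel. K t * char M t)
      = (LINT t|lborel. LINT s|lborel. indicator {a..b} s *\<^sub>R (iexp (- (t * s)) * char M t))"
    by (rule integral_cong_AE, measurable)
      (use AE_nonzero_lborel in \<open>eventually_elim, simp add: K_int flip: scaleR_left_distrib mult_scaleR_left\<close>)
  also have "\<dots> = (LINT s|lborel. LINT t|lborel. indicator {a..b} s *\<^sub>R (iexp (- (t * s)) * char M t))"
  proof (rule lborel_pair.Fubini_integral)
    show "integrable (lborel \<Otimes>\<^sub>M lborel) (\<lambda>(s, t). indicator {a..b} s *\<^sub>R (iexp (- (t * s)) * char M t))"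
    proof (rule lborel_pair.Fubini_integrable)
      have "(\<lambda>s. LINT t|lborel. norm (case (s, t) of (s, t) \<Rightarrow> indicator {a..b} s *\<^sub>R (iexp (- (t * s)) * char M t)))
         = (\<lambda>s. indicator {a..b} s *\<^sub>R (LINT t|lborel. norm (char M t)))"
        by (simp add: norm_mult fun_eq_iff)
      moreover have "integrable lborel (\<lambda>s. indicator {a..b} s *\<^sub>R (LINT t|lborel. norm (char M t)))"
        using ab by (intro integrable_scaleR_left) auto
      ultimately show "integrable lborel (\<lambda>s. LINT t|lborel. norm (case (s, t) of (s, t) \<Rightarrow> indicator {a..b} s *\<^sub>R (iexp (- (t * s)) * char M t)))"
        by simp
    qed (use integrable_iexp_char[OF int] in auto)
  qed
  also have "\<dots> = (LINT s|lborel. indicator {a..b} s *\<^sub>R (LINT t|lborel. iexp (- (t * s)) * char M t))"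
    by simp
  finally have eq: "complex_of_real (measure M {a<..b}) = complex_of_real (1 / (2 * pi)) *
    (LINT s|lborel. indicator {a..b} s *\<^sub>R (LINT t|lborel. iexp (- (t * s)) * char M t))" .
  have [measurable]: "(\<lambda>s. LINT t|lborel. iexp (- (t * s)) * char M t) \<in> borel_measurable borel"
    by measurable
  have "integrable lborel (\<lambda>s. indicator {a..b} s *\<^sub>R (LINT t|lborel. iexp (- (t * s)) * char M t))"
  proof (rule Bochner_Integration.integrable_bound)
    show "integrable lborel (\<lambda>s. indicator {a..b} s *\<^sub>R (LINT t|lborel. norm (char M t)))"
      using ab by (intro integrable_scaleR_left) auto
    show "AE s in lborel. norm (indicator {a..b} s *\<^sub>R (LINT t|lborel. iexp (- (t * s)) * char M t))
      \<le> norm (indicator {a..b} s *\<^sub>R (LINT t|lborel. norm (char M t)))"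
    proof (rule AE_I2)
      fix s
      have "norm (LINT t|lborel. iexp (- (t * s)) * char M t) \<le> (LINT t|lborel. norm (iexp (- (t * s)) * char M t))"
        by (rule integral_norm_bound)
      then show "norm (indicator {a..b} s *\<^sub>R (LINT t|lborel. iexp (- (t * s)) * char M t))
        \<le> norm (indicator {a..b} s *\<^sub>R (LINT t|lborel. norm (char M t)))"
        by (auto simp: norm_mult indicator_def)
    qed
  qed auto
  then have "Re (LINT s|lborel. indicator {a..b} s *\<^sub>R (LINT t|lborel. iexp (- (t * s)) * char M t))
    = (LINT s|lborel. Re (indicator {a..b} s *\<^sub>R (LINT t|lborel. iexp (- (t * s)) * char M t)))"
    by (rule integral_Re[symmetric])
  then have "measure M {a<..b} = (1 / (2 * pi)) *
    (LINT s|lborel. Re (indicator {a..b} s *\<^sub>R (LINT t|lborel. iexp (- (t * s)) * char M t)))"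
    using arg_cong[OF eq, of Re] by simp
  also have "\<dots> = (LINT s|lborel. indicator {a..b} s * inversion_density s)"
    by (subst integral_mult_right_zero[symmetric]) (simp add: inversion_density_def mult_ac)
  finally show ?thesis .
qed

lemma nonatomic_between:
  assumes "a < b"
  obtains c where "a < c" "c < b" "measure M {c} = 0"
  using open_minus_countable[OF countable_support, of "{a<..<b}"] assms by auto

lemma integrable_indicator_inversion:
  assumes "integrable lborel (char M)"
  shows "integrable lborel (\<lambda>x. indicator {a..b} x * inversion_density x)"
  using borel_integrable_compact[of "{a..b}" inversion_density]
    continuous_on_subset[OF continuous_inversion_density[OF assms]] by simp

lemma inversion_density_nonneg:
  assumes int: "integrable lborel (char M)"
  shows "0 \<le> inversion_density x"
proof (rule ccontr)
  assume neg: "\<not> 0 \<le> inversion_density x"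
  have "isCont inversion_density x"
    using continuous_inversion_density[OF int] by (simp add: continuous_on_eq_continuous_at)
  then have "\<exists>d>0. \<forall>y. \<bar>y - x\<bar> < d \<longrightarrow> \<bar>inversion_density y - inversion_density x\<bar> < - inversion_density x / 2"
    using neg unfolding continuous_at_eps_delta dist_real_def
    by (elim allE[of _ "- inversion_density x / 2"]) auto
  then obtain d where d: "d > 0" "\<And>y. \<bar>y - x\<bar> < d \<Longrightarrow> \<bar>inversion_density y - inversion_density x\<bar> < - inversion_density x / 2"
    by blast
  obtain a where a: "x - d < a" "a < x" "measure M {a} = 0" using nonatomic_between[of "x - d" x] d(1) by auto
  obtain b where b: "x < b" "b < x + d" "measure M {b} = 0" using nonatomic_between[of x "x + d"] d(1) by auto
  have "measure M {a<..b} = (LINT x|lborel. indicator {a..b} x * inversion_density x)"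
    using measure_Ioc_eq_inversion[OF int] a b by simp
  also have "\<dots> \<le> (LINT y|lborel. indicator {a..b} y * (inversion_density x / 2))"
  proof (rule integral_mono[OF integrable_indicator_inversion[OF int]])
    show "integrable lborel (\<lambda>y. indicat_real {a..b} y * (inversion_density x / 2))"
      using a b by (intro integrable_mult_left) auto
    fix y show "indicat_real {a..b} y * inversion_density y \<le> indicat_real {a..b} y * (inversion_density x / 2)"
    proof (cases "y \<in> {a..b}")
      case True
      then have "\<bar>y - x\<bar> < d" using a b by auto
      have "inversion_density y - inversion_density x < - inversion_density x / 2"
        using d(2)[OF \<open>\<bar>y - x\<bar> < d\<close>] by (simp only: abs_less_iff)
      with True show ?thesis by auto
    qed simp
  qed
  also have "\<dots> = (b - a) * (inversion_density x / 2)"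
    using a b by simp
  also have "\<dots> < 0" using a b neg by (auto intro: mult_pos_neg)
  finally show False by (simp add: not_less[symmetric])
qed

lemma no_atoms_of_integrable_char:
  assumes int: "integrable lborel (char M)"
  shows "measure M {x} = 0"
proof (rule ccontr)
  assume "measure M {x} \<noteq> 0"
  then have pos: "measure M {x} > 0" by (simp add: zero_less_measure_iff)
  define B where "B = (LINT t|lborel. norm (char M t)) / (2 * pi)"
  have B: "\<bar>inversion_density y\<bar> \<le> B" for y
    unfolding B_def by (rule abs_inversion_density_le[OF int])
  have "B \<ge> 0" using B[of 0] by simp
  define d where "d = measure M {x} / (2 * B + 1) / 2"
  have d: "d > 0" using pos \<open>B \<ge> 0\<close> by (simp add: d_def)
  \<comment> \<open>An atom lies in intervals with non-atomic endpoints whose measure is at most \<open>B\<close> times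
    their length.\<close>
  obtain a where a: "x - d < a" "a < x" "measure M {a} = 0" using nonatomic_between[of "x - d" x] d(1) by auto
  obtain b where b: "x < b" "b < x + d" "measure M {b} = 0" using nonatomic_between[of x "x + d"] d(1) by auto
  have "measure M {x} \<le> measure M {a<..b}"
    using a b by (intro finite_measure_mono) auto
  also have "\<dots> = (LINT x|lborel. indicator {a..b} x * inversion_density x)"
    using measure_Ioc_eq_inversion[OF int] a b by simp
  also have "\<dots> \<le> (LINT y|lborel. indicator {a..b} y * B)"
  proof (rule integral_mono[OF integrable_indicator_inversion[OF int]])
    show "integrable lborel (\<lambda>y. indicat_real {a..b} y * B)"
      using a b by (intro integrable_mult_left) auto
    fix y show "indicat_real {a..b} y * inversion_density y \<le> indicat_real {a..b} y * B"
      using B[of y] by (auto simp: indicator_def)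
  qed
  also have "\<dots> = (b - a) * B" using a b by simp
  also have "\<dots> \<le> 2 * d * B" using a b \<open>B \<ge> 0\<close> by (intro mult_right_mono) auto
  also have "\<dots> < measure M {x}"
  proof -
    have "2 * d * B = measure M {x} * (B / (2 * B + 1))"
      using \<open>B \<ge> 0\<close> add_nonneg_pos[of "2 * B" 1] by (simp add: d_def divide_simps)
    also have "\<dots> < measure M {x} * 1"
      using pos \<open>B \<ge> 0\<close> by (intro mult_strict_left_mono) auto
    finally show ?thesis by simp
  qed
  finally show False by simp
qed

lemma eq_density_inversion:
  assumes int: "integrable lborel (char M)"
  shows "M = density lborel inversion_density"
proof (rule measure_eqI_generator_eq[where \<Omega>=UNIV and E="range (\<lambda>(a, b). {a<..b::real})" and A="\<lambda>i. {- real i<..real i}"])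
  have [measurable]: "inversion_density \<in> borel_measurable borel"
    using continuous_inversion_density[OF int] by (rule borel_measurable_continuous_onI)
  fix X assume "X \<in> range (\<lambda>(a, b). {a<..b::real})"
  then obtain a b where X: "X = {a<..b}" by auto
  show "emeasure M X = emeasure (density lborel inversion_density) X"
  proof (cases "a \<le> b")
    case True
    have "emeasure M X = ennreal (LINT x|lborel. indicator {a..b} x * inversion_density x)"
      unfolding X emeasure_eq_measure
      by (simp add: measure_Ioc_eq_inversion[OF int True] no_atoms_of_integrable_char[OF int])
    also have "\<dots> = (\<integral>\<^sup>+x. ennreal (indicator {a..b} x * inversion_density x) \<partial>lborel)"
      by (rule nn_integral_eq_integral[symmetric])
        (auto intro!: integrable_indicator_inversion int mult_nonneg_nonneg inversion_density_nonneg)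
    also have "\<dots> = (\<integral>\<^sup>+x. ennreal (inversion_density x) * indicator {a<..b} x \<partial>lborel)"
      by (rule nn_integral_cong_AE, rule AE_I[of _ _ "{a}"]) (auto simp: indicator_def)
    also have "\<dots> = emeasure (density lborel inversion_density) X"
      by (simp add: emeasure_density X)
    finally show ?thesis .
  qed (simp add: X)
next
  show "(\<Union>i. {- real (i::nat)<..real i}) = UNIV"
    by (rule UN_Ioc_eq_UNIV)
qed (auto simp: emeasure_eq_measure borel_sigma_sets_Ioc Int_stable_def Int_Collect)

end

section \<open>Measures on the half-line\<close>

lemma power_exp_le_fact:
  fixes y :: real assumes "0 \<le> y"
  shows "y ^ n * exp (- y) \<le> fact n"
proof -
  have "(\<Sum>k\<in>{n}. y ^ k /\<^sub>R fact k) \<le> exp y"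
    unfolding exp_def using assms summable_exp_generic[of y]
    by (intro sum_le_suminf) auto
  then have "y ^ n \<le> fact n * exp y" by (simp add: field_simps)
  then show ?thesis by (simp add: exp_minus field_simps)
qed

lemma power_exp_le_fact_one_minus_exp:
  fixes y :: real assumes "0 \<le> y" "1 \<le> n"
  shows "y ^ n * exp (- y) \<le> fact n * (1 - exp (- y))"
proof -
  have "(\<Sum>k\<in>{0, n}. y ^ k /\<^sub>R fact k) \<le> exp y"
    unfolding exp_def using assms summable_exp_generic[of y]
    by (intro sum_le_suminf) auto
  then have "1 + y ^ n / fact n \<le> exp y" using assms by (simp add: field_simps)
  then have "y ^ n \<le> fact n * (exp y - 1)" by (simp add: field_simps)
  then have "y ^ n * exp (- y) \<le> fact n * (exp y - 1) * exp (- y)"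
    by (intro mult_right_mono) auto
  then show ?thesis by (simp add: exp_minus field_simps)
qed

lemma one_minus_exp_le_min:
  fixes s u :: real assumes "0 \<le> s" "0 \<le> u"
  shows "1 - exp (- (u * s)) \<le> (1 + u) * min 1 s"
proof -
  have "1 - exp (- (u * s)) \<le> u * s" using exp_ge_add_one_self[of "- (u * s)"] by simp
  moreover have "u * s \<le> (1 + u) * s" using assms by (simp add: algebra_simps)
  moreover have "1 - exp (- (u * s)) \<le> 1 + u" using assms exp_ge_zero[of "- (u * s)"] by linarith
  ultimately show ?thesis by (auto simp: min_def)
qed

text \<open>A measure on the half-line integrating \<open>min 1 s\<close>: Laplace functionals and their
  derivatives.  Both the Levy measure and every law on the half-line are of this kind.\<close>

locale halfline_measure =
  fixes m :: "real measure"
  assumes sets_m [measurable_cong, simp]: "sets m = sets borel"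
    and AE_nonneg: "AE s in m. 0 \<le> s"
    and integrable_min: "integrable m (\<lambda>s. min 1 s)"
begin

lemma integrable_le_min:
  fixes f :: "real \<Rightarrow> 'b::{banach, second_countable_topology}"
  assumes [measurable]: "f \<in> borel_measurable borel"
    and "\<And>s. 0 \<le> s \<Longrightarrow> norm (f s) \<le> K * min 1 s"
  shows "integrable m f"
proof (rule Bochner_Integration.integrable_bound)
  show "integrable m (\<lambda>s. K * min 1 s)" using integrable_min by simp
  show "AE s in m. norm (f s) \<le> norm (K * min 1 s)"
    using AE_nonneg by eventually_elim (use assms(2) in force)
qed simp

lemma integrable_one_minus_exp:
  assumes "0 \<le> u" shows "integrable m (\<lambda>s. 1 - exp (- (u * s)))"
  by (rule integrable_le_min[where K="1 + u"]) (use one_minus_exp_le_min assms in auto)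

lemma integrable_power_exp:
  assumes "0 < w" "1 \<le> n" shows "integrable m (\<lambda>s. s ^ n * exp (- (w * s)))"
proof (rule integrable_le_min[where K="1 + fact n / w ^ n"])
  fix s :: real assume s: "0 \<le> s"
  have "(w * s) ^ n * exp (- (w * s)) \<le> fact n"
    using s assms by (intro power_exp_le_fact) auto
  then have 1: "s ^ n * exp (- (w * s)) \<le> fact n / w ^ n"
    using assms by (simp add: power_mult_distrib field_simps)
  have 2: "s ^ n * exp (- (w * s)) \<le> s" if "s \<le> 1"
  proof -
    have "s ^ n * exp (- (w * s)) \<le> s ^ 1 * 1"
      using s that assms by (intro mult_mono power_decreasing) auto
    then show ?thesis by simp
  qed
  have F: "0 \<le> fact n / w ^ n" using assms by simp
  have "s ^ n * exp (- (w * s)) \<le> (1 + fact n / w ^ n) * min 1 s"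
  proof (cases "s \<le> 1")
    case True
    then have "s * 1 \<le> s * (1 + fact n / w ^ n)" using s F by (intro mult_left_mono) auto
    then show ?thesis using 2 True by (simp add: mult.commute min_def)
  qed (use 1 in auto)
  then show "norm (s ^ n * exp (- (w * s))) \<le> (1 + fact n / w ^ n) * min 1 s"
    using s by simp
qed simp

lemma has_derivative_one_minus_exp:
  assumes w: "0 < w"
  shows "((\<lambda>u. LINT s|m. 1 - exp (- (u * s))) has_real_derivative (LINT s|m. s * exp (- (w * s)))) (at w)"
  unfolding has_real_derivative_iff_has_vector_derivative
proof (rule has_vector_derivative_lebesgue_integral[where e="w/2" and g="\<lambda>s. s ^ 1 * exp (- ((w/2) * s))"
      and f'="\<lambda>w s. s * exp (- (w * s))"])
  show "AE s in m. \<forall>x. \<bar>x - w\<bar> < w/2 \<longrightarrow> norm (s * exp (- (x * s))) \<le> s ^ 1 * exp (- ((w/2) * s))"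
    using AE_nonneg
  proof eventually_elim
    case (elim s)
    have "s * exp (- (x * s)) \<le> s ^ 1 * exp (- ((w/2) * s))" if "\<bar>x - w\<bar> < w/2" for x
    proof -
      have "w/2 \<le> x" using that by linarith
      then have "w/2 * s \<le> x * s" using elim by (intro mult_right_mono)
      then show ?thesis using elim by (simp add: mult_left_mono)
    qed
    then show ?case using elim by simp
  qed
  show "integrable m (\<lambda>s. s ^ 1 * exp (- ((w/2) * s)))"
    using w by (intro integrable_power_exp) auto
  show "((\<lambda>x. 1 - exp (- (x * s))) has_vector_derivative s * exp (- (x * s))) (at x)" for x s
    unfolding has_real_derivative_iff_has_vector_derivative[symmetric]
    by (auto intro!: derivative_eq_intros)
  show "\<bar>x - w\<bar> < w/2 \<Longrightarrow> integrable m (\<lambda>s. 1 - exp (- (x * s)))" for x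
    using w by (intro integrable_one_minus_exp) linarith
qed (use w in auto)

lemma has_derivative_power_exp:
  assumes w: "0 < w" and n: "1 \<le> n"
  shows "((\<lambda>u. LINT s|m. s ^ n * exp (- (u * s))) has_real_derivative
    - (LINT s|m. s ^ Suc n * exp (- (w * s)))) (at w)"
  unfolding has_real_derivative_iff_has_vector_derivative integral_minus[symmetric]
proof (rule has_vector_derivative_lebesgue_integral[where e="w/2" and g="\<lambda>s. s ^ Suc n * exp (- ((w/2) * s))"
      and f'="\<lambda>w s. - (s ^ Suc n * exp (- (w * s)))"])
  show "AE s in m. \<forall>x. \<bar>x - w\<bar> < w/2 \<longrightarrow> norm (- (s ^ Suc n * exp (- (x * s)))) \<le> s ^ Suc n * exp (- ((w/2) * s))"
    using AE_nonneg
  proof eventually_elim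
    case (elim s)
    have "s ^ Suc n * exp (- (x * s)) \<le> s ^ Suc n * exp (- ((w/2) * s))" if "\<bar>x - w\<bar> < w/2" for x
    proof -
      have "w/2 \<le> x" using that by linarith
      then have "w/2 * s \<le> x * s" using elim by (intro mult_right_mono)
      then show ?thesis using elim by (intro mult_left_mono) auto
    qed
    then show ?case using elim by (simp add: abs_mult)
  qed
  show "integrable m (\<lambda>s. s ^ Suc n * exp (- ((w/2) * s)))"
    using w by (intro integrable_power_exp) auto
  show "((\<lambda>x. s ^ n * exp (- (x * s))) has_vector_derivative - (s ^ Suc n * exp (- (x * s)))) (at x)" for x s
    unfolding has_real_derivative_iff_has_vector_derivative[symmetric]
    by (auto intro!: derivative_eq_intros)
  show "\<bar>x - w\<bar> < w/2 \<Longrightarrow> integrable m (\<lambda>s. s ^ n * exp (- (x * s)))" for x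
    using w n by (intro integrable_power_exp) linarith+
qed (use w in auto)

end

section \<open>Laplace exponents with power-type scaling\<close>

text \<open>The analytic hypotheses on a driftless Laplace exponent \<open>\<phi>\<close> and its Levy density \<open>\<nu>\<close>, extended
  by \<open>0\<close> to \<open>(-\<infinity>, 0]\<close>: \<open>cl\<close> and \<open>cu\<close> are the constants of the lower and the upper scaling of \<open>\<phi>\<close>, and
  \<open>cm\<close> is the constant with which \<open>\<nu>\<close> is almost decreasing.\<close>

locale scaling_exponent =
  fixes \<phi> \<nu> :: "real \<Rightarrow> real" and \<alpha> \<beta> cl cu cm :: real
  assumes nu_measurable [measurable]: "\<nu> \<in> borel_measurable borel"
    and nu_nonneg: "0 \<le> \<nu> s"
    and nu_eq_0: "s \<le> 0 \<Longrightarrow> \<nu> s = 0"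
    and levy_integrable: "integrable (density lborel \<nu>) (\<lambda>s. min 1 s)"
    and phi_eq: "0 \<le> u \<Longrightarrow> \<phi> u = (LINT s|density lborel \<nu>. 1 - exp (- (u * s)))"
    and phi_pos: "0 < u \<Longrightarrow> 0 < \<phi> u"
    and exponents: "0 < \<alpha>" "0 < \<beta>" "\<beta> < 1"
    and constants: "0 < cl" "0 < cu" "0 < cm"
    and lower_scaling: "0 < x \<Longrightarrow> x \<le> y \<Longrightarrow> cl * (y / x) powr \<alpha> * \<phi> x \<le> \<phi> y"
    and upper_scaling: "0 < x \<Longrightarrow> x \<le> y \<Longrightarrow> \<phi> y \<le> cu * (y / x) powr \<beta> * \<phi> x"
    and nu_decreasing: "0 < x \<Longrightarrow> x \<le> y \<Longrightarrow> \<nu> y \<le> cm * \<nu> x"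
begin

text \<open>The Levy measure.\<close>

definition \<Lambda> :: "real measure" where "\<Lambda> = density lborel \<nu>"

text \<open>For \<open>n \<ge> 1\<close> and \<open>w > 0\<close> this is the \<open>n\<close>-th derivative of \<open>\<phi>\<close> at \<open>w\<close>, up to the sign
  \<open>(- 1) ^ (n + 1)\<close>.\<close>

definition J :: "nat \<Rightarrow> real \<Rightarrow> real" where
  "J n w = (LINT s|\<Lambda>. s ^ n * exp (- (w * s)))"

sublocale halfline_measure \<Lambda>
proof
  show "AE s in \<Lambda>. 0 \<le> s"
    unfolding \<Lambda>_def by (subst AE_density, simp, intro AE_I2 impI, rule ccontr) (simp add: nu_eq_0)
qed (use levy_integrable in \<open>auto simp: \<Lambda>_def\<close>)

lemma AE_pos: "AE s in \<Lambda>. 0 < s"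
  unfolding \<Lambda>_def by (subst AE_density, simp, intro AE_I2 impI, rule ccontr) (simp add: nu_eq_0)

lemma phi_eq': "0 \<le> u \<Longrightarrow> \<phi> u = (LINT s|\<Lambda>. 1 - exp (- (u * s)))"
  by (simp add: phi_eq \<Lambda>_def)

lemma phi_0 [simp]: "\<phi> 0 = 0" by (simp add: phi_eq')

lemma phi_mono: "0 \<le> x \<Longrightarrow> x \<le> y \<Longrightarrow> \<phi> x \<le> \<phi> y"
  unfolding phi_eq'[of x] phi_eq'[OF order_trans[of 0 x y]]
  by (intro integral_mono_AE integrable_one_minus_exp)
    (use AE_nonneg in \<open>auto intro: mult_right_mono\<close>)

lemma J_nonneg: "0 \<le> J n w"
  unfolding J_def by (intro integral_nonneg_AE) (use AE_nonneg in auto)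

lemma DERIV_phi: "0 < w \<Longrightarrow> (\<phi> has_real_derivative J 1 w) (at w)"
proof -
  assume w: "0 < w"
  have "\<forall>\<^sub>F u in nhds w. \<phi> u = (LINT s|\<Lambda>. 1 - exp (- (u * s)))"
    using eventually_nhds_in_open[of "{0<..}" w] w
    by (auto elim!: eventually_mono simp: phi_eq')
  then show ?thesis
    using has_derivative_one_minus_exp[OF w] w
    by (subst DERIV_cong_ev[OF refl _ refl]) (auto simp: J_def)
qed

lemma deriv_phi: "0 < w \<Longrightarrow> deriv \<phi> w = J 1 w"
  by (rule DERIV_imp_deriv) (rule DERIV_phi)

lemma DERIV_J: "0 < w \<Longrightarrow> 1 \<le> n \<Longrightarrow> (J n has_real_derivative - J (Suc n) w) (at w)"
  using has_derivative_power_exp[of w n] by (simp add: J_def[abs_def])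

lemma deriv_deriv_phi: "0 < w \<Longrightarrow> deriv (deriv \<phi>) w = - J 2 w"
proof -
  assume w: "0 < w"
  have "\<forall>\<^sub>F u in nhds w. deriv \<phi> u = J 1 u"
    using eventually_nhds_in_open[of "{0<..}" w] w
    by (auto elim!: eventually_mono simp: deriv_phi)
  then have "deriv (deriv \<phi>) w = deriv (J 1) w"
    by (rule deriv_cong_ev) simp
  also have "\<dots> = - J 2 w"
    using DERIV_J[OF w, of 1] by (intro DERIV_imp_deriv) (simp add: numeral_2_eq_2)
  finally show ?thesis .
qed

lemma J_le_phi:
  assumes w: "0 < w" and n: "1 \<le> n"
  shows "w ^ n * J n w \<le> fact n * \<phi> w"
proof -
  have "w ^ n * J n w = (LINT s|\<Lambda>. (w * s) ^ n * exp (- (w * s)))"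
    unfolding J_def by (simp add: power_mult_distrib mult.assoc)
  also have "\<dots> \<le> (LINT s|\<Lambda>. fact n * (1 - exp (- (w * s))))"
  proof (rule integral_mono_AE)
    show "integrable \<Lambda> (\<lambda>s. (w * s) ^ n * exp (- (w * s)))"
      using integrable_power_exp[OF w n] by (simp add: power_mult_distrib mult.assoc)
    show "integrable \<Lambda> (\<lambda>s. fact n * (1 - exp (- (w * s))))"
      using integrable_one_minus_exp[of w] w by simp
    show "AE s in \<Lambda>. (w * s) ^ n * exp (- (w * s)) \<le> fact n * (1 - exp (- (w * s)))"
      using AE_nonneg by eventually_elim
        (use w n in \<open>intro power_exp_le_fact_one_minus_exp, auto\<close>)
  qed
  also have "\<dots> = fact n * \<phi> w" using w by (simp add: phi_eq')
  finally show ?thesis .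
qed

lemma emeasure_Icc:
  assumes "0 < a"
  shows "emeasure \<Lambda> {a..b} < \<infinity>"
proof -
  have "integrable \<Lambda> (\<lambda>s. indicat_real {a..b} s)"
  proof (rule integrable_le_min[where K="1 + 1 / a"])
    fix s :: real assume "0 \<le> s"
    show "norm (indicat_real {a..b} s) \<le> (1 + 1 / a) * min 1 s"
    proof (cases "s \<in> {a..b}")
      case True
      then have "1 \<le> 1 / a * s" "0 \<le> s" using assms by (auto simp: field_simps)
      then have "1 \<le> (1 + 1 / a) * s" by (simp add: distrib_right)
      then show ?thesis using True assms by (auto simp: min_def)
    qed (use \<open>0 \<le> s\<close> assms in auto)
  qed simp
  then show ?thesis by (simp add: integrable_indicator_iff)
qed

lemma measure_Icc_le:
  assumes a: "0 < a" "a \<le> b" and le: "\<And>s. a \<le> s \<Longrightarrow> s \<le> b \<Longrightarrow> \<nu> s \<le> K"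
  shows "measure \<Lambda> {a..b} \<le> K * (b - a)"
proof -
  have K: "0 \<le> K" using le[of a] a nu_nonneg[of a] by simp
  have "emeasure \<Lambda> {a..b} = (\<integral>\<^sup>+s. ennreal (\<nu> s) * indicator {a..b} s \<partial>lborel)"
    by (simp add: \<Lambda>_def emeasure_density)
  also have "\<dots> \<le> (\<integral>\<^sup>+s. ennreal K * indicator {a..b} s \<partial>lborel)"
    by (intro nn_integral_mono) (use le in \<open>auto simp: indicator_def intro!: ennreal_leI\<close>)
  also have "\<dots> = ennreal (K * (b - a))"
    using a K by (simp add: nn_integral_cmult ennreal_mult)
  finally show ?thesis
    unfolding measure_def using K a by (simp add: enn2real_leI)
qed

lemma measure_Icc_ge:
  assumes a: "0 < a" "a \<le> b" and le: "\<And>s. a \<le> s \<Longrightarrow> s \<le> b \<Longrightarrow> K \<le> \<nu> s" and K: "0 \<le> K"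
  shows "K * (b - a) \<le> measure \<Lambda> {a..b}"
proof -
  have "ennreal (K * (b - a)) = (\<integral>\<^sup>+s. ennreal K * indicator {a..b} s \<partial>lborel)"
    using a K by (simp add: nn_integral_cmult ennreal_mult)
  also have "\<dots> \<le> (\<integral>\<^sup>+s. ennreal (\<nu> s) * indicator {a..b} s \<partial>lborel)"
    by (intro nn_integral_mono) (use le in \<open>auto simp: indicator_def intro!: ennreal_leI\<close>)
  also have "\<dots> = emeasure \<Lambda> {a..b}"
    by (simp add: \<Lambda>_def emeasure_density)
  also have "\<dots> = ennreal (measure \<Lambda> {a..b})"
    using emeasure_Icc[OF a(1), of b] by (simp add: emeasure_eq_ennreal_measure)
  finally show ?thesis by simp
qed

lemma integral_ge_on_Icc:
  assumes f: "integrable \<Lambda> f" "\<And>s. 0 \<le> s \<Longrightarrow> 0 \<le> f s"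
    and K: "\<And>s. a \<le> s \<Longrightarrow> s \<le> b \<Longrightarrow> K \<le> f s" and a: "0 < a"
  shows "K * measure \<Lambda> {a..b} \<le> (LINT s|\<Lambda>. f s)"
proof -
  have "K * measure \<Lambda> {a..b} = (LINT s|\<Lambda>. K * indicat_real {a..b} s)" by simp
  also have "\<dots> \<le> (LINT s|\<Lambda>. f s)"
  proof (rule integral_mono_AE)
    show "integrable \<Lambda> (\<lambda>s. K * indicat_real {a..b} s)"
      using emeasure_Icc[OF a] by simp
    show "AE s in \<Lambda>. K * indicat_real {a..b} s \<le> f s"
      using AE_nonneg by eventually_elim (use f K in \<open>auto simp: indicator_def\<close>)
  qed fact
  finally show ?thesis .
qed

lemma nu_upper:
  assumes x: "0 < x"
  shows "\<nu> x \<le> 6 * cm * \<phi> (1 / x) / x"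
proof -
  have "\<nu> x / cm * (x - x / 2) \<le> measure \<Lambda> {x / 2..x}"
    using x constants nu_nonneg[of x] nu_decreasing[of _ x]
    by (intro measure_Icc_ge) (auto simp: field_simps)
  moreover have "1 / 3 * measure \<Lambda> {x / 2..x} \<le> (LINT s|\<Lambda>. 1 - exp (- (1 / x * s)))"
  proof (rule integral_ge_on_Icc)
    fix s assume s: "x / 2 \<le> s" "s \<le> x"
    have "exp (- (1 / x * s)) \<le> exp (- (1 / 2) :: real)"
      using s x by (simp add: field_simps)
    also have "\<dots> \<le> 2 / 3"
      using exp_ge_add_one_self[of "1 / 2 :: real"] by (simp add: exp_minus field_simps)
    finally show "1 / 3 \<le> 1 - exp (- (1 / x * s))" by simp
  qed (use x integrable_one_minus_exp[of "1 / x"] in auto)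
  ultimately have "\<nu> x / cm * (x / 2) \<le> 3 * \<phi> (1 / x)"
    using x by (simp add: phi_eq')
  then show ?thesis using x constants by (simp add: field_simps)
qed

text \<open>In \<open>\<phi> z\<close> the jumps below \<open>a / z\<close> and above \<open>A / z\<close> contribute at most half, by the upper
  scaling if \<open>a\<close> is small and by the lower scaling if \<open>A\<close> is large.  The remaining jumps carry the
  other half, and \<open>\<nu> (a / z)\<close> controls \<open>\<nu>\<close> on their range.\<close>

lemma nu_lower: "\<exists>c>0. \<forall>x>0. c * (\<phi> (1 / x) / x) \<le> \<nu> x"
proof -
  have "((\<lambda>a. exp 1 * cu * a powr (1 - \<beta>)) \<longlongrightarrow> exp 1 * cu * 0) (at_right 0)"
    using exponents by (intro tendsto_intros tendsto_zero_powrI[where b="1 - \<beta>"])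
      (auto simp: eventually_at_filter tendsto_ident_at)
  then have "\<forall>\<^sub>F a in at_right 0. exp 1 * cu * a powr (1 - \<beta>) < 1 / 4 \<and> a < 1 \<and> 0 < a"
    by (intro eventually_conj order_tendstoD eventually_at_right_less eventually_at_right_field[THEN iffD2])
      (auto intro: exI[of _ 1])
  then obtain a where a: "0 < a" "a < 1" "exp 1 * cu * a powr (1 - \<beta>) < 1 / 4"
    using eventually_happens'[OF trivial_limit_at_right_real] by blast
  define A where "A = max 1 ((8 / cl) powr (1 / \<alpha>))"
  have A: "1 \<le> A" by (simp add: A_def)
  have "8 / cl = ((8 / cl) powr (1 / \<alpha>)) powr \<alpha>"
    using constants exponents by (simp add: powr_powr)
  also have "\<dots> \<le> A powr \<alpha>" using exponents by (intro powr_mono2) (auto simp: A_def)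
  finally have A2: "8 \<le> cl * A powr \<alpha>" using constants by (simp add: field_simps)
  have Apos: "0 < A powr \<alpha>" using A by simp
  have key: "\<phi> z / 2 \<le> cm * \<nu> (a / z) * (A / z)" if l: "0 < z" for z
  proof -
    have aA: "a / z \<le> A / z" using a A l by (simp add: divide_right_mono)
    have "\<phi> z = (LINT s|\<Lambda>. 1 - exp (- (z * s)))" using l by (simp add: phi_eq')
    also have "\<dots> \<le> (LINT s|\<Lambda>. exp 1 * z * (s ^ 1 * exp (- (z / a * s))) + 2 * (1 - exp (- (z / A * s)))
        + indicat_real {a / z..A / z} s)" (is "_ \<le> (LINT s|\<Lambda>. ?f s + ?g s + ?h s)")
    proof (rule integral_mono_AE)
      have "integrable \<Lambda> ?f" "integrable \<Lambda> ?g"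
        using l a A by (intro integrable_mult_right integrable_power_exp integrable_one_minus_exp; simp)+
      moreover have "integrable \<Lambda> ?h"
        using emeasure_Icc[of "a / z" "A / z"] l a by simp
      ultimately show "integrable \<Lambda> (\<lambda>s. ?f s + ?g s + ?h s)" by simp
      show "AE s in \<Lambda>. 1 - exp (- (z * s)) \<le> ?f s + ?g s + ?h s"
        using AE_pos
      proof eventually_elim
        case (elim s)
        have nn: "0 \<le> ?f s" "0 \<le> ?g s" "0 \<le> ?h s" using elim l A by auto
        \<comment> \<open>Small jumps are charged to \<open>J 1 (z / a)\<close>, large ones to \<open>\<phi> (z / A)\<close>.\<close>
        consider "s < a / z" | "A / z < s" | "s \<in> {a / z..A / z}" by fastforce
        then show ?case
        proof cases
          case 1
          then have "z / a * s \<le> 1" using l a by (simp add: field_simps)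
          then have "1 \<le> exp (1 - z / a * s)" by simp
          then have "z * s * 1 \<le> z * s * exp (1 - z / a * s)"
            using l elim by (intro mult_left_mono) auto
          also have "\<dots> = ?f s" by (simp add: exp_diff exp_minus field_simps)
          finally show ?thesis
            using nn exp_ge_add_one_self[of "- (z * s)"] by linarith
        next
          case 2
          then have "1 \<le> z / A * s" using l A by (simp add: field_simps)
          then have "exp (- (z / A * s)) \<le> exp (- 1 :: real)" by simp
          also have "\<dots> \<le> 1 / 2" using exp_ge_add_one_self[of "1 :: real"] by (simp add: exp_minus field_simps)
          finally have "1 \<le> ?g s" by simp
          then show ?thesis using nn exp_ge_zero[of "- (z * s)"] by linarith
        next
          case 3
          then have "?h s = 1" by simp
          then show ?thesis using nn exp_ge_zero[of "- (z * s)"] by linarith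
        qed
      qed
    qed (use l integrable_one_minus_exp[of z] in auto)
    also have "\<dots> = exp 1 * z * J 1 (z / a) + 2 * \<phi> (z / A) + measure \<Lambda> {a / z..A / z}"
    proof -
      have "integrable \<Lambda> ?f" "integrable \<Lambda> ?g"
        using l a A by (intro integrable_mult_right integrable_power_exp integrable_one_minus_exp; simp)+
      moreover have "integrable \<Lambda> ?h"
        using emeasure_Icc[of "a / z" "A / z"] l a by simp
      moreover have "(LINT s|\<Lambda>. ?f s) = exp 1 * z * J 1 (z / a)"
        unfolding J_def by (rule integral_mult_right_zero)
      moreover have "(LINT s|\<Lambda>. ?g s) = 2 * \<phi> (z / A)"
        using l A by (subst phi_eq', simp) (rule integral_mult_right_zero)
      ultimately show ?thesis by (simp del: right_diff_distrib_numeral)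
    qed
    also have "exp 1 * z * J 1 (z / a) \<le> \<phi> z / 4"
    proof -
      have "z / a * J 1 (z / a) \<le> \<phi> (z / a)"
        using J_le_phi[of "z / a" 1] l a by simp
      also have "\<dots> \<le> cu * (1 / a) powr \<beta> * \<phi> z"
        using upper_scaling[of z "z / a"] l a by (simp add: field_simps)
      finally have "exp 1 * a * (z / a * J 1 (z / a)) \<le> exp 1 * a * (cu * (1 / a) powr \<beta> * \<phi> z)"
        using a by (intro mult_left_mono) auto
      also have "\<dots> = (exp 1 * cu * a powr (1 - \<beta>)) * \<phi> z"
        using a by (simp add: powr_divide powr_diff)
      also have "\<dots> \<le> (1 / 4) * \<phi> z"
        using a(3) phi_pos[OF l] by (intro mult_right_mono) auto
      finally show ?thesis using a by simp
    qed
    also have "2 * \<phi> (z / A) \<le> \<phi> z / 4"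
    proof -
      have "cl * A powr \<alpha> * \<phi> (z / A) \<le> \<phi> z"
        using lower_scaling[of "z / A" z] l A by (simp add: field_simps)
      moreover have "8 * \<phi> (z / A) \<le> cl * A powr \<alpha> * \<phi> (z / A)"
        using A2 phi_pos[of "z / A"] l A by (intro mult_right_mono) auto
      ultimately show ?thesis by simp
    qed
    also have "measure \<Lambda> {a / z..A / z} \<le> cm * \<nu> (a / z) * (A / z - a / z)"
      using l a A aA nu_decreasing[of "a / z"] by (intro measure_Icc_le) auto
    also have "\<dots> \<le> cm * \<nu> (a / z) * (A / z)"
      using l a constants nu_nonneg[of "a / z"] by (intro mult_left_mono) auto
    finally show ?thesis by linarith
  qed
  define c where "c = a * a powr \<beta> / (2 * cm * A * cu)"
  have "c * (\<phi> (1 / x) / x) \<le> \<nu> x" if x: "0 < x" for x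
  proof -
    have "\<phi> (1 / x) \<le> cu * (1 / a) powr \<beta> * \<phi> (a / x)"
      using upper_scaling[of "a / x" "1 / x"] x a by (simp add: field_simps)
    then have "\<phi> (1 / x) * a powr \<beta> / cu \<le> \<phi> (a / x)"
      using a constants by (simp add: powr_divide field_simps)
    also have "\<dots> \<le> 2 * (cm * \<nu> x * (A * x / a))"
      using key[of "a / x"] x a by (simp add: mult_ac)
    finally show ?thesis
      using a A constants x by (simp add: c_def field_simps)
  qed
  moreover have "0 < c" using a A constants by (simp add: c_def)
  ultimately show ?thesis by blast
qed

text \<open>Jumps of size about \<open>1 / r\<close> occur at rate at least of order \<open>\<phi> r\<close>; the lower bounds for \<open>J n\<close> and
  for the decay of the tilted characteristic functions come from these jumps.\<close>

lemma measure_dyadic_ge: "\<exists>c>0. \<forall>r>0. c * \<phi> r \<le> measure \<Lambda> {1 / (2 * r)..1 / r}"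
proof -
  obtain c where c: "c > 0" "\<And>x. x > 0 \<Longrightarrow> c * (\<phi> (1 / x) / x) \<le> \<nu> x"
    using nu_lower by blast
  have "c / (2 * cm) * \<phi> r \<le> measure \<Lambda> {1 / (2 * r)..1 / r}" if r: "0 < r" for r
  proof -
    have "c / cm * r * \<phi> r * (1 / r - 1 / (2 * r)) \<le> measure \<Lambda> {1 / (2 * r)..1 / r}"
    proof (rule measure_Icc_ge)
      fix s assume s: "1 / (2 * r) \<le> s" "s \<le> 1 / r"
      have "0 < s" using s(1) r by (meson less_le_trans divide_pos_pos mult_pos_pos zero_less_numeral zero_less_one)
      have "c * (\<phi> r * r) \<le> cm * \<nu> s"
        using c(2)[of "1 / r"] nu_decreasing[of s "1 / r"] \<open>0 < s\<close> s r by simp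
      then show "c / cm * r * \<phi> r \<le> \<nu> s" using constants by (simp add: field_simps)
    qed (use r c constants phi_pos[OF r] in \<open>auto simp: field_simps\<close>)
    then show ?thesis using r by (simp add: field_simps)
  qed
  then show ?thesis using c constants by (intro exI[of _ "c / (2 * cm)"]) auto
qed

lemma J_ge_phi: "\<exists>c>0. \<forall>w>0. c * \<phi> w \<le> w ^ n * J n w" if n: "1 \<le> n"
proof -
  obtain c where c: "c > 0" "\<And>r. r > 0 \<Longrightarrow> c * \<phi> r \<le> measure \<Lambda> {1 / (2 * r)..1 / r}"
    using measure_dyadic_ge by blast
  have "exp (- 1) / 2 ^ n * c * \<phi> w \<le> w ^ n * J n w" if w: "0 < w" for w
  proof -
    have "(1 / (2 * w)) ^ n * exp (- 1) * measure \<Lambda> {1 / (2 * w)..1 / w} \<le> J n w"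
      unfolding J_def
    proof (rule integral_ge_on_Icc)
      fix s assume s: "1 / (2 * w) \<le> s" "s \<le> 1 / w"
      have "0 < 1 / (2 * w)" using w by simp
      then have "0 \<le> s" using s by linarith
      then show "(1 / (2 * w)) ^ n * exp (- 1) \<le> s ^ n * exp (- (w * s))"
        using s w \<open>0 \<le> s\<close> by (intro mult_mono power_mono zero_le_power) (auto simp: mult.commute pos_le_divide_eq)
    qed (use w n integrable_power_exp in auto)
    moreover have "(1 / (2 * w)) ^ n * exp (- 1) * (c * \<phi> w) \<le> (1 / (2 * w)) ^ n * exp (- 1) * measure \<Lambda> {1 / (2 * w)..1 / w}"
      using w c(2)[OF w] by (intro mult_left_mono) auto
    ultimately have "(1 / (2 * w)) ^ n * exp (- 1) * (c * \<phi> w) \<le> J n w" by linarith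
    then have "w ^ n * ((1 / (2 * w)) ^ n * exp (- 1) * (c * \<phi> w)) \<le> w ^ n * J n w"
      using w by (intro mult_left_mono) auto
    then show ?thesis using w by (simp add: power_divide power_mult_distrib)
  qed
  then show ?thesis using c by (intro exI[of _ "exp (- 1) / 2 ^ n * c"]) auto
qed

end

section \<open>The exponent on vertical lines\<close>

lemma one_minus_cos_le: "1 - cos (y::real) \<le> y\<^sup>2 / 2"
proof -
  have "cos y = 1 - 2 * (sin (y / 2))\<^sup>2" using cos_double_sin[of "y / 2"] by simp
  moreover have "(sin (y / 2))\<^sup>2 \<le> (y / 2)\<^sup>2"
    using abs_sin_x_le_abs_x[of "y / 2"] abs_le_square_iff by blast
  ultimately show ?thesis by (simp add: power_divide)
qed

lemma one_minus_cos_ge: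
  assumes "\<bar>y\<bar> \<le> 1" shows "y\<^sup>2 / 4 \<le> 1 - cos (y::real)"
proof -
  obtain t where *: "cos y = (\<Sum>m<4. cos_coeff m * y ^ m) + cos (t + 1 / 2 * real 4 * pi) / fact 4 * y ^ 4"
    using Maclaurin_cos_expansion[of y 4] by blast
  then have "cos y = 1 - y\<^sup>2 / 2 + cos (t + 2 * pi) / 24 * y ^ 4"
  proof -
    have "{..<4} = {0, 1, 2, 3 :: nat}" by auto
    with * show ?thesis by (simp add: cos_coeff_def fact_numeral)
  qed
  also have "\<dots> \<le> 1 - y\<^sup>2 / 2 + 1 / 24 * (y\<^sup>2 * 1)"
  proof -
    have "y\<^sup>2 * y\<^sup>2 \<le> y\<^sup>2 * 1"
      using assms by (intro mult_left_mono) (auto simp: abs_square_le_1)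
    then have "y ^ 4 \<le> y\<^sup>2" by (simp add: power4_eq_xxxx power2_eq_square mult.assoc)
    moreover have "cos (t + 2 * pi) / 24 * y ^ 4 \<le> 1 / 24 * y ^ 4"
      using cos_le_one[of "t + 2 * pi"] by (intro mult_right_mono divide_right_mono) auto
    ultimately show ?thesis by linarith
  qed
  finally show ?thesis using zero_le_power2[of y] by linarith
qed

lemma abs_sin_minus_le: "\<bar>sin y - y\<bar> \<le> \<bar>y :: real\<bar> ^ 3 / 6"
proof -
  have "\<bar>Im (iexp y - (\<Sum>k\<le>2. (\<i> * y) ^ k / fact k))\<bar> \<le> \<bar>y\<bar> ^ Suc 2 / fact (Suc 2)"
    by (rule order_trans[OF abs_Im_le_cmod iexp_approx1])
  then show ?thesis
    by (simp add: Im_exp numeral_eq_Suc power2_eq_square)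
qed

context scaling_exponent
begin

text \<open>Real part, with the opposite sign, of the logarithm of the characteristic function of the law
  tilted by \<open>exp (- w x)\<close>, per unit of time.\<close>

definition damping :: "real \<Rightarrow> real \<Rightarrow> real" where
  "damping w \<xi> = (LINT s|\<Lambda>. (1 - cos (\<xi> * s)) * exp (- (w * s)))"

text \<open>Imaginary part of the same logarithm, after subtracting the linear term that comes from the mean.\<close>

definition phase :: "real \<Rightarrow> real \<Rightarrow> real" where
  "phase w \<xi> = (LINT s|\<Lambda>. (sin (\<xi> * s) - \<xi> * s) * exp (- (w * s)))"

lemma integrable_damping:
  assumes w: "0 < w"
  shows "integrable \<Lambda> (\<lambda>s. (1 - cos (\<xi> * s)) * exp (- (w * s)))"
proof (rule Bochner_Integration.integrable_bound)
  show "integrable \<Lambda> (\<lambda>s. \<xi>\<^sup>2 / 2 * (s ^ 2 * exp (- (w * s))))"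
    using integrable_power_exp[of w 2] w by simp
  show "AE s in \<Lambda>. norm ((1 - cos (\<xi> * s)) * exp (- (w * s))) \<le> norm (\<xi>\<^sup>2 / 2 * (s ^ 2 * exp (- (w * s))))"
    using one_minus_cos_le[of "\<xi> * _"] by (intro AE_I2) (simp add: power_mult_distrib abs_mult)
qed simp

lemma damping_le:
  assumes w: "0 < w"
  shows "damping w \<xi> \<le> (\<xi> / w)\<^sup>2 * \<phi> w"
proof -
  have "damping w \<xi> \<le> (LINT s|\<Lambda>. \<xi>\<^sup>2 / 2 * (s ^ 2 * exp (- (w * s))))"
    unfolding damping_def
  proof (rule integral_mono[OF integrable_damping[OF w]])
    show "integrable \<Lambda> (\<lambda>s. \<xi>\<^sup>2 / 2 * (s ^ 2 * exp (- (w * s))))"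
      using integrable_power_exp[of w 2] w by simp
    fix s show "(1 - cos (\<xi> * s)) * exp (- (w * s)) \<le> \<xi>\<^sup>2 / 2 * (s ^ 2 * exp (- (w * s)))"
      using one_minus_cos_le[of "\<xi> * s"] by (simp add: power_mult_distrib)
  qed
  also have "\<dots> = \<xi>\<^sup>2 / 2 * J 2 w" by (simp add: J_def)
  also have "\<dots> \<le> \<xi>\<^sup>2 / 2 * (2 * \<phi> w / w\<^sup>2)"
    using J_le_phi[OF w, of 2] w by (intro mult_left_mono) (auto simp: field_simps)
  finally show ?thesis by (simp add: power_divide)
qed

lemma abs_phase_le:
  assumes w: "0 < w"
  shows "\<bar>phase w \<xi>\<bar> \<le> (\<bar>\<xi>\<bar> / w) ^ 3 * \<phi> w"
proof -
  have int: "integrable \<Lambda> (\<lambda>s. \<bar>\<xi>\<bar> ^ 3 / 6 * (s ^ 3 * exp (- (w * s))))"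
    using integrable_power_exp[of w 3] w by simp
  have le: "AE s in \<Lambda>. norm ((sin (\<xi> * s) - \<xi> * s) * exp (- (w * s))) \<le> \<bar>\<xi>\<bar> ^ 3 / 6 * (s ^ 3 * exp (- (w * s)))"
    using AE_nonneg
  proof eventually_elim
    case (elim s)
    have "\<bar>sin (\<xi> * s) - \<xi> * s\<bar> * exp (- (w * s)) \<le> \<bar>\<xi> * s\<bar> ^ 3 / 6 * exp (- (w * s))"
      by (intro mult_right_mono abs_sin_minus_le) auto
    then show ?case using elim by (simp add: abs_mult power_mult_distrib)
  qed
  have "norm (phase w \<xi>) \<le> (LINT s|\<Lambda>. norm ((sin (\<xi> * s) - \<xi> * s) * exp (- (w * s))))"
    unfolding phase_def by (rule integral_norm_bound)
  also have "\<dots> \<le> (LINT s|\<Lambda>. \<bar>\<xi>\<bar> ^ 3 / 6 * (s ^ 3 * exp (- (w * s))))"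
  proof (rule integral_mono_AE[OF _ int le])
    have "AE s in \<Lambda>. norm ((sin (\<xi> * s) - \<xi> * s) * exp (- (w * s))) \<le> norm (\<bar>\<xi>\<bar> ^ 3 / 6 * (s ^ 3 * exp (- (w * s))))"
      using le by eventually_elim (auto intro: order_trans abs_ge_self)
    then show "integrable \<Lambda> (\<lambda>s. norm ((sin (\<xi> * s) - \<xi> * s) * exp (- (w * s))))"
      by (intro integrable_norm Bochner_Integration.integrable_bound[OF int]) auto
  qed
  also have "\<dots> = \<bar>\<xi>\<bar> ^ 3 / 6 * J 3 w" by (simp add: J_def)
  also have "\<dots> \<le> \<bar>\<xi>\<bar> ^ 3 / 6 * (6 * \<phi> w / w ^ 3)"
    using J_le_phi[OF w, of 3] w by (intro mult_left_mono) (auto simp: field_simps fact_numeral)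
  finally show ?thesis by (simp add: power_divide)
qed

text \<open>Stated with a free \<open>r \<ge> max w \<bar>\<xi>\<bar>\<close>: the choice \<open>r = w\<close> gives quadratic growth for small
  \<open>\<xi>\<close>, the choice \<open>r = \<bar>\<xi>\<bar>\<close> growth of order \<open>\<phi> \<bar>\<xi>\<bar>\<close> for large \<open>\<xi>\<close>.\<close>

lemma damping_ge: "\<exists>c>0. \<forall>w>0. \<forall>\<xi> r. w \<le> r \<longrightarrow> \<bar>\<xi>\<bar> \<le> r \<longrightarrow> c * (\<xi> / r)\<^sup>2 * \<phi> r \<le> damping w \<xi>"
proof -
  obtain c where c: "c > 0" "\<And>r. r > 0 \<Longrightarrow> c * \<phi> r \<le> measure \<Lambda> {1 / (2 * r)..1 / r}"
    using measure_dyadic_ge by blast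
  have "(exp (- 1) / 16 * c) * (\<xi> / r)\<^sup>2 * \<phi> r \<le> damping w \<xi>"
    if w: "0 < w" and r: "w \<le> r" "\<bar>\<xi>\<bar> \<le> r" for w r \<xi>
  proof -
    have r0: "0 < r" using w r by simp
    have "((\<xi> / r)\<^sup>2 / 16 * exp (- 1)) * measure \<Lambda> {1 / (2 * r)..1 / r} \<le> damping w \<xi>"
      unfolding damping_def
    proof (rule integral_ge_on_Icc[OF integrable_damping[OF w]])
      fix s assume s: "1 / (2 * r) \<le> s" "s \<le> 1 / r"
      have "0 < 1 / (2 * r)" using r0 by simp
      then have s0: "0 \<le> s" using s by linarith
      have "\<bar>\<xi> * s\<bar> \<le> r * (1 / r)"
        unfolding abs_mult using r s s0 by (intro mult_mono) auto
      then have 1: "(\<xi> * s)\<^sup>2 / 4 \<le> 1 - cos (\<xi> * s)"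
        using r0 by (intro one_minus_cos_ge) simp
      have "(\<xi> / r)\<^sup>2 / 16 = (\<xi> * (1 / (2 * r)))\<^sup>2 / 4" by (simp add: power_divide power_mult_distrib)
      also have "\<dots> \<le> (\<xi> * s)\<^sup>2 / 4"
        unfolding power_mult_distrib using s r0 by (intro mult_left_mono power_mono divide_right_mono) auto
      finally have 2: "(\<xi> / r)\<^sup>2 / 16 \<le> 1 - cos (\<xi> * s)" using 1 by linarith
      have "w * s \<le> r * (1 / r)" using w r s s0 by (intro mult_mono) auto
      then have "exp (- 1) \<le> exp (- (w * s))" using r0 by simp
      with 2 show "(\<xi> / r)\<^sup>2 / 16 * exp (- 1) \<le> (1 - cos (\<xi> * s)) * exp (- (w * s))"
        by (intro mult_mono) auto
    qed (use r0 in auto)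
    moreover have "((\<xi> / r)\<^sup>2 / 16 * exp (- 1)) * (c * \<phi> r) \<le> ((\<xi> / r)\<^sup>2 / 16 * exp (- 1)) * measure \<Lambda> {1 / (2 * r)..1 / r}"
      using c(2)[OF r0] by (intro mult_left_mono) auto
    ultimately have "((\<xi> / r)\<^sup>2 / 16 * exp (- 1)) * (c * \<phi> r) \<le> damping w \<xi>" by (rule order_trans[rotated])
    then show ?thesis by (simp add: mult_ac)
  qed
  then show ?thesis using c(1) by (intro exI[of _ "exp (- 1) / 16 * c"]) auto
qed

lemma damping_nonneg: "0 \<le> damping w \<xi>"
  unfolding damping_def by (intro integral_nonneg_AE) auto

text \<open>The inverse square decay suffices for integrability and, after scaling \<open>\<xi>\<close> by
  \<open>w / sqrt (t * \<phi> w)\<close>, it is uniform in \<open>t\<close> and \<open>w\<close> as long as \<open>t * \<phi> w \<ge> \<kappa>\<close>.\<close>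

lemma exp_damping_le:
  assumes \<kappa>: "0 < \<kappa>"
  shows "\<exists>D>0. \<forall>t>0. \<forall>w>0. \<forall>\<xi>. \<kappa> \<le> t * \<phi> w \<longrightarrow> \<xi> \<noteq> 0 \<longrightarrow>
    exp (- (t * damping w \<xi>)) \<le> D / (t * \<phi> w * (\<xi> / w)\<^sup>2)"
proof -
  obtain c where c: "c > 0" "\<And>w r \<xi>. 0 < w \<Longrightarrow> w \<le> r \<Longrightarrow> \<bar>\<xi>\<bar> \<le> r \<Longrightarrow> c * (\<xi> / r)\<^sup>2 * \<phi> r \<le> damping w \<xi>"
    using damping_ge by blast
  \<comment> \<open>This power of \<open>u powr \<alpha>\<close>, with \<open>u = \<bar>\<xi>\<bar> / w > 1\<close>, dominates \<open>u\<^sup>2\<close>.\<close>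
  obtain m :: nat where m: "2 / \<alpha> \<le> real m" "1 \<le> m"
    using real_arch_simple[of "2 / \<alpha>"] by (metis max.bounded_iff of_nat_max max.cobounded1 max.cobounded2 order_trans of_nat_le_iff)
  have m\<alpha>: "2 \<le> \<alpha> * m" using m(1) exponents by (simp add: field_simps)
  have exp_le: "exp (- z) \<le> fact n / z ^ n" if "0 < z" for z :: real and n
    using power_exp_le_fact[of z n] that by (simp add: field_simps)
  define d where "d = c * cl"
  have d: "0 < d" using c constants by (simp add: d_def)
  define D where "D = 1 / c + fact m / (d ^ m * \<kappa> ^ (m - 1))"
  have D1: "1 / c \<le> D" and D2: "fact m / (d ^ m * \<kappa> ^ (m - 1)) \<le> D"
    using c d \<kappa> by (auto simp: D_def)
  have "exp (- (t * damping w \<xi>)) \<le> D / (t * \<phi> w * (\<xi> / w)\<^sup>2)"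
    if t: "0 < t" and w: "0 < w" and k: "\<kappa> \<le> t * \<phi> w" and \<xi>: "\<xi> \<noteq> 0" for t w \<xi>
  proof -
    define u where "u = \<bar>\<xi>\<bar> / w"
    have u: "0 < u" using \<xi> w by (simp add: u_def)
    have u2: "(\<xi> / w)\<^sup>2 = u\<^sup>2" by (simp add: u_def power_divide)
    define k where "k = t * \<phi> w"
    have k: "\<kappa> \<le> k" "0 < k" using k \<kappa> by (auto simp: k_def)
    have "exp (- (t * damping w \<xi>)) \<le> D / (k * u\<^sup>2)"
    proof (cases "u \<le> 1")
      case True
      then have "\<bar>\<xi>\<bar> \<le> w" using w by (simp add: u_def field_simps)
      from c(2)[OF w order_refl this] have "t * (c * u\<^sup>2 * \<phi> w) \<le> t * damping w \<xi>"
        using t u2 by (intro mult_left_mono) auto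
      then have "c * k * u\<^sup>2 \<le> t * damping w \<xi>" by (simp add: k_def mult_ac)
      then have "exp (- (t * damping w \<xi>)) \<le> exp (- (c * k * u\<^sup>2))" by simp
      also have "\<dots> \<le> 1 / (c * k * u\<^sup>2)" using exp_le[of "c * k * u\<^sup>2" 1] c k u by simp
      also have "\<dots> = 1 / c / (k * u\<^sup>2)" by simp
      also have "\<dots> \<le> D / (k * u\<^sup>2)" using D1 k u by (intro divide_right_mono) auto
      finally show ?thesis .
    next
      case False
      then have r: "w \<le> \<bar>\<xi>\<bar>" using w by (simp add: u_def field_simps)
      have "t * (c * (\<xi> / \<bar>\<xi>\<bar>)\<^sup>2 * \<phi> \<bar>\<xi>\<bar>) \<le> t * damping w \<xi>"
        using c(2)[OF w r] t by (intro mult_left_mono) auto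
      then have "t * c * \<phi> \<bar>\<xi>\<bar> \<le> t * damping w \<xi>"
        using \<xi> by (simp add: power_divide mult_ac)
      moreover have "t * c * (cl * u powr \<alpha> * \<phi> w) \<le> t * c * \<phi> \<bar>\<xi>\<bar>"
        using lower_scaling[OF w r] t c by (intro mult_left_mono) (auto simp: u_def)
      ultimately have "d * k * u powr \<alpha> \<le> t * damping w \<xi>" by (simp add: d_def k_def mult_ac)
      then have "exp (- (t * damping w \<xi>)) \<le> exp (- (d * k * u powr \<alpha>))" by simp
      also have "\<dots> \<le> fact m / (d * k * u powr \<alpha>) ^ m" using d k u by (intro exp_le) auto
      also have "\<dots> \<le> fact m / (d ^ m * (\<kappa> ^ (m - 1) * k) * u\<^sup>2)"
      proof (rule divide_left_mono)
        have "\<kappa> ^ (m - 1) * k \<le> k ^ (m - 1) * k"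
          using k \<kappa> by (intro mult_right_mono power_mono) auto
        also have "\<dots> = k ^ m" by (rule power_minus_mult) (use m in simp)
        finally have 1: "\<kappa> ^ (m - 1) * k \<le> k ^ m" .
        have "u\<^sup>2 = u powr 2" using u by (simp add: powr_numeral)
        also have "\<dots> \<le> u powr (\<alpha> * m)" using False m\<alpha> by (intro powr_mono) auto
        also have "\<dots> = (u powr \<alpha>) ^ m" using u by (simp add: powr_powr[symmetric] powr_realpow)
        finally have 2: "u\<^sup>2 \<le> (u powr \<alpha>) ^ m" .
        show "d ^ m * (\<kappa> ^ (m - 1) * k) * u\<^sup>2 \<le> (d * k * u powr \<alpha>) ^ m"
          unfolding power_mult_distrib using 1 2 d k \<kappa> by (intro mult_mono) auto
      qed (use d k \<kappa> u in auto)
      also have "\<dots> = fact m / (d ^ m * \<kappa> ^ (m - 1)) / (k * u\<^sup>2)" by simp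
      also have "\<dots> \<le> D / (k * u\<^sup>2)" using D2 k u by (intro divide_right_mono) auto
      finally show ?thesis .
    qed
    then show ?thesis by (simp add: u2 k_def)
  qed
  moreover have "0 < D" using c d \<kappa> by (simp add: D_def add_pos_nonneg)
  ultimately show ?thesis by blast
qed

text \<open>The logarithm of the characteristic function of the law tilted by \<open>exp (- w x)\<close>, per unit of time.\<close>

definition tilted_log_char :: "real \<Rightarrow> real \<Rightarrow> complex" where
  "tilted_log_char w \<xi> = (LINT s|\<Lambda>. (iexp (\<xi> * s) - 1) * exp (- (w * s)))"

lemma integrable_tilted_log_char:
  assumes w: "0 < w"
  shows "integrable \<Lambda> (\<lambda>s. (iexp (\<xi> * s) - 1) * complex_of_real (exp (- (w * s))))"
proof (rule Bochner_Integration.integrable_bound)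
  show "integrable \<Lambda> (\<lambda>s. \<bar>\<xi>\<bar> * (s ^ 1 * exp (- (w * s))))"
    using integrable_power_exp[of w 1] w by simp
  show "AE s in \<Lambda>. norm ((iexp (\<xi> * s) - 1) * complex_of_real (exp (- (w * s)))) \<le> norm (\<bar>\<xi>\<bar> * (s ^ 1 * exp (- (w * s))))"
    using iexp_approx1[of "\<xi> * _" 0] by (intro AE_I2) (simp add: norm_mult abs_mult)
qed simp

lemma tilted_log_char_eq:
  assumes w: "0 < w"
  shows "tilted_log_char w \<xi> = Complex (- damping w \<xi>) (phase w \<xi> + \<xi> * J 1 w)"
proof (rule complex_eqI)
  have int: "integrable \<Lambda> (\<lambda>s. (sin (\<xi> * s)) * exp (- (w * s)))"
    using integrable_Im[OF integrable_tilted_log_char[OF w, of \<xi>]] by (simp add: Im_exp)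
  have int1: "integrable \<Lambda> (\<lambda>s. \<xi> * (s ^ 1 * exp (- (w * s))))"
    using integrable_power_exp[of w 1] w by simp
  have "Re (tilted_log_char w \<xi>) = (LINT s|\<Lambda>. Re ((iexp (\<xi> * s) - 1) * exp (- (w * s))))"
    unfolding tilted_log_char_def by (rule integral_Re[symmetric, OF integrable_tilted_log_char[OF w]])
  also have "\<dots> = - damping w \<xi>"
    unfolding damping_def Bochner_Integration.integral_minus[symmetric]
    by (intro Bochner_Integration.integral_cong) (auto simp: Re_exp algebra_simps)
  finally show "Re (tilted_log_char w \<xi>) = Re (Complex (- damping w \<xi>) (phase w \<xi> + \<xi> * J 1 w))" by simp
  have "Im (tilted_log_char w \<xi>) = (LINT s|\<Lambda>. Im ((iexp (\<xi> * s) - 1) * exp (- (w * s))))"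
    unfolding tilted_log_char_def by (rule integral_Im[symmetric, OF integrable_tilted_log_char[OF w]])
  also have "\<dots> = (LINT s|\<Lambda>. sin (\<xi> * s) * exp (- (w * s)))"
    by (intro Bochner_Integration.integral_cong) (auto simp: Im_exp)
  also have "\<dots> = phase w \<xi> + \<xi> * J 1 w"
  proof -
    have "phase w \<xi> = (LINT s|\<Lambda>. sin (\<xi> * s) * exp (- (w * s)) - \<xi> * (s ^ 1 * exp (- (w * s))))"
      unfolding phase_def by (intro Bochner_Integration.integral_cong) (auto simp: algebra_simps)
    also have "\<dots> = (LINT s|\<Lambda>. sin (\<xi> * s) * exp (- (w * s))) - (LINT s|\<Lambda>. \<xi> * (s ^ 1 * exp (- (w * s))))"
      by (rule Bochner_Integration.integral_diff[OF int int1])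
    also have "(LINT s|\<Lambda>. \<xi> * (s ^ 1 * exp (- (w * s)))) = \<xi> * J 1 w"
      unfolding J_def by (rule integral_mult_right_zero)
    finally show ?thesis by simp
  qed
  finally show "Im (tilted_log_char w \<xi>) = Im (Complex (- damping w \<xi>) (phase w \<xi> + \<xi> * J 1 w))" by simp
qed

lemma tilted_log_char_0 [simp]: "tilted_log_char w 0 = 0"
  by (simp add: tilted_log_char_def)

lemma tilted_log_char_deriv:
  assumes w: "0 < w"
  shows "(tilted_log_char w has_vector_derivative
    \<i> * (LINT s|\<Lambda>. iexp (\<xi> * s) * complex_of_real (s * exp (- (w * s))))) (at \<xi>)"
  unfolding tilted_log_char_def[abs_def] integral_mult_right_zero[symmetric]
proof (rule has_vector_derivative_lebesgue_integral[where e=1 and g="\<lambda>s. s ^ 1 * exp (- (w * s))"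
    and f'="\<lambda>\<xi> s. \<i> * (iexp (\<xi> * s) * complex_of_real (s * exp (- (w * s))))"])
  show "((\<lambda>x. (iexp (x * s) - 1) * complex_of_real (exp (- (w * s)))) has_vector_derivative
      \<i> * (iexp (x * s) * complex_of_real (s * exp (- (w * s))))) (at x)" for x s
    by (auto intro!: derivative_eq_intros simp: has_vector_derivative_complex_iff Re_exp Im_exp)
  show "AE s in \<Lambda>. \<forall>x. \<bar>x - \<xi>\<bar> < 1 \<longrightarrow>
      norm (\<i> * (iexp (x * s) * complex_of_real (s * exp (- (w * s))))) \<le> s ^ 1 * exp (- (w * s))"
    using AE_nonneg by eventually_elim (simp add: norm_mult)
qed (use integrable_tilted_log_char[OF w] integrable_power_exp[of w 1] w in auto)

end

section \<open>Tilted laws and the size-bias identity\<close>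

lemma integral_convolution_mult:
  fixes f :: "real \<Rightarrow> 'b::{real_normed_field, banach, second_countable_topology}"
  assumes fin: "finite_measure A" "finite_measure B"
    and sets [measurable_cong]: "sets A = sets borel" "sets B = sets borel"
    and f [measurable]: "f \<in> borel_measurable borel"
    and mult: "\<And>x y. f (x + y) = f x * f y"
    and int: "integrable A f" "integrable B f"
  shows "(LINT z|(A \<star> B). f z) = (LINT x|A. f x) * (LINT y|B. f y)"
proof -
  interpret A: finite_measure A by fact
  interpret B: finite_measure B by fact
  interpret pair_sigma_finite A B ..
  have "(LINT z|(A \<star> B). f z) = (LINT z|(A \<Otimes>\<^sub>M B). (\<lambda>(x, y). f x * f y) z)"
    unfolding convolution_def by (subst integral_distr) (auto simp: mult intro!: Bochner_Integration.integral_cong)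
  also have "\<dots> = (LINT x|A. LINT y|B. f x * f y)"
  proof (subst integral_fst'[symmetric])
    show "integrable (A \<Otimes>\<^sub>M B) (\<lambda>(x, y). f x * f y)"
    proof (rule Fubini_integrable)
      show "integrable A (\<lambda>x. LINT y|B. norm (case (x, y) of (x, y) \<Rightarrow> f x * f y))"
        using int by (simp add: norm_mult)
    qed (use int in auto)
  qed simp
  also have "\<dots> = (LINT x|A. f x) * (LINT y|B. f y)" by simp
  finally show ?thesis .
qed

text \<open>A law on the half-line with Laplace transform \<open>exp (- t \<phi>)\<close>, such as that of a subordinator with
  exponent \<open>\<phi>\<close> at time \<open>t\<close>.\<close>

locale subordinator_law = scaling_exponent + prob_space \<mu> for \<mu> :: "real measure" +
  fixes t :: real
  assumes sets_mu [measurable_cong, simp]: "sets \<mu> = sets borel"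
    and AE_mu_nonneg: "AE x in \<mu>. 0 \<le> x"
    and t_pos: "0 < t"
    and laplace: "0 \<le> u \<Longrightarrow> (LINT x|\<mu>. exp (- (u * x))) = exp (- (t * \<phi> u))"
begin

sublocale law: halfline_measure \<mu>
proof
  show "integrable \<mu> (\<lambda>s. min 1 s)"
  proof (rule integrable_const_bound[where B=1])
    show "AE x in \<mu>. norm (min 1 x) \<le> 1"
      using AE_mu_nonneg by eventually_elim auto
  qed simp
qed (use AE_mu_nonneg in auto)

lemma space_mu [simp]: "space \<mu> = UNIV"
  using sets_mu by (metis sets_eq_imp_space_eq space_borel)

lemma integrable_exp_neg: "0 \<le> u \<Longrightarrow> integrable \<mu> (\<lambda>x. exp (- (u * x)))"
  by (rule integrable_const_bound[where B=1]) (use AE_mu_nonneg in auto)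

lemma law_first_moment:
  assumes u: "0 < u"
  shows "(LINT x|\<mu>. x * exp (- (u * x))) = t * J 1 u * exp (- (t * \<phi> u))"
proof -
  have "((\<lambda>u. LINT x|\<mu>. 1 - exp (- (u * x))) has_real_derivative (LINT x|\<mu>. x * exp (- (u * x)))) (at u)"
    by (rule law.has_derivative_one_minus_exp[OF u])
  moreover have "\<forall>\<^sub>F v in nhds u. (LINT x|\<mu>. 1 - exp (- (v * x))) = 1 - exp (- (t * \<phi> v))"
    using eventually_nhds_in_open[of "{0<..}" u] u
    by (auto elim!: eventually_mono simp: laplace integrable_exp_neg prob_space[unfolded space_mu])
  ultimately have 1: "((\<lambda>v. 1 - exp (- (t * \<phi> v))) has_real_derivative (LINT x|\<mu>. x * exp (- (u * x)))) (at u)"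
    by (subst (asm) DERIV_cong_ev[OF refl _ refl]) auto
  have "((\<lambda>v. 1 - exp (- (t * \<phi> v))) has_real_derivative t * J 1 u * exp (- (t * \<phi> u))) (at u)"
    by (auto intro!: derivative_eq_intros DERIV_phi u)
  with 1 show ?thesis by (rule DERIV_unique)
qed

text \<open>The Esscher transform of the law: the probability measure with density
  \<open>exp (t \<phi> w - w x)\<close>.\<close>

definition tilted :: "real \<Rightarrow> real measure" where
  "tilted w = density \<mu> (\<lambda>x. ennreal (exp (t * \<phi> w - w * x)))"

lemma sets_tilted [measurable_cong, simp]: "sets (tilted w) = sets borel"
  by (simp add: tilted_def)

lemma integral_tilted:
  fixes f :: "real \<Rightarrow> 'b::{banach, second_countable_topology}"
  assumes "f \<in> borel_measurable borel"
  shows "(LINT x|tilted w. f x) = (LINT x|\<mu>. exp (t * \<phi> w - w * x) *\<^sub>R f x)"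
  unfolding tilted_def by (rule integral_density) (use assms in auto)

lemma integrable_tilted_iff:
  fixes f :: "real \<Rightarrow> 'b::{banach, second_countable_topology}"
  assumes "f \<in> borel_measurable borel"
  shows "integrable (tilted w) f \<longleftrightarrow> integrable \<mu> (\<lambda>x. exp (t * \<phi> w - w * x) *\<^sub>R f x)"
  unfolding tilted_def by (rule integrable_density) (use assms in auto)

lemma exp_tilt: "exp (t * \<phi> w - w * x) = exp (t * \<phi> w) * exp (- (w * x))"
  by (simp add: exp_diff exp_minus divide_inverse)

lemma exp_tilt_mult: "exp (t * \<phi> w - w * x) * exp (- (v * x)) = exp (t * \<phi> w) * exp (- ((w + v) * x))"
  by (simp add: exp_add[symmetric] algebra_simps)

lemma real_distribution_tilted:
  assumes w: "0 < w" shows "real_distribution (tilted w)"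
proof -
  have "emeasure (tilted w) UNIV = (\<integral>\<^sup>+x. ennreal (exp (t * \<phi> w - w * x)) \<partial>\<mu>)"
    by (simp add: tilted_def emeasure_density)
  also have "\<dots> = ennreal (LINT x|\<mu>. exp (t * \<phi> w - w * x))"
    using w by (intro nn_integral_eq_integral) (auto simp: exp_tilt integrable_exp_neg)
  also have "\<dots> = 1"
    using w by (simp add: exp_tilt laplace integrable_exp_neg exp_minus_inverse)
  finally have "prob_space (tilted w)"
    by (intro prob_spaceI) (simp add: tilted_def)
  then show ?thesis
    by (intro real_distribution.intro real_distribution_axioms.intro) (auto simp: tilted_def)
qed

lemma AE_tilted_nonneg: "AE x in tilted w. 0 \<le> x"
  unfolding tilted_def using AE_mu_nonneg by (subst AE_density) auto

lemma integrable_tilted_id: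
  assumes w: "0 < w" shows "integrable (tilted w) (\<lambda>x. x)"
proof -
  have "integrable \<mu> (\<lambda>x. exp (t * \<phi> w) * (x ^ 1 * exp (- (w * x))))"
    using law.integrable_power_exp[OF w, of 1] by simp
  also have "(\<lambda>x. exp (t * \<phi> w) * (x ^ 1 * exp (- (w * x)))) = (\<lambda>x. exp (t * \<phi> w - w * x) *\<^sub>R x)"
    by (simp add: fun_eq_iff exp_tilt)
  finally show ?thesis by (subst integrable_tilted_iff) auto
qed

text \<open>The finite measure \<open>t s exp (- w s) \<nu> s ds\<close>.\<close>

definition tilted_jumps :: "real \<Rightarrow> real measure" where
  "tilted_jumps w = density \<Lambda> (\<lambda>s. ennreal (t * (s * exp (- (w * s)))))"

lemma sets_tilted_jumps [measurable_cong, simp]: "sets (tilted_jumps w) = sets borel"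
  by (simp add: tilted_jumps_def)

lemma space_tilted_jumps [simp]: "space (tilted_jumps w) = UNIV"
  using sets_tilted_jumps by (metis sets_eq_imp_space_eq space_borel)

lemma finite_tilted_jumps:
  assumes w: "0 < w" shows "finite_measure (tilted_jumps w)"
proof
  have "emeasure (tilted_jumps w) (space (tilted_jumps w)) = (\<integral>\<^sup>+s. ennreal (t * (s * exp (- (w * s)))) \<partial>\<Lambda>)"
    unfolding space_tilted_jumps by (simp add: tilted_jumps_def emeasure_density)
  also have "\<dots> = ennreal (LINT s|\<Lambda>. t * (s * exp (- (w * s))))"
    using integrable_power_exp[OF w, of 1] AE_nonneg t_pos by (intro nn_integral_eq_integral) auto
  finally show "emeasure (tilted_jumps w) (space (tilted_jumps w)) \<noteq> \<infinity>" by simp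
qed

lemma integral_tilted_jumps:
  fixes f :: "real \<Rightarrow> 'b::{banach, second_countable_topology}"
  assumes "f \<in> borel_measurable borel"
  shows "(LINT s|tilted_jumps w. f s) = (LINT s|\<Lambda>. (t * (s * exp (- (w * s)))) *\<^sub>R f s)"
  unfolding tilted_jumps_def
  by (rule integral_density) (use assms AE_nonneg t_pos in auto)

text \<open>The size-bias identity.  The Laplace transform \<open>exp (t \<phi> w - t \<phi> (w + u))\<close> of the tilted law has
  the derivative \<open>- t J 1 (w + u)\<close> times itself, and \<open>t J 1 (w + u)\<close> is the Laplace transform of
  \<open>tilted_jumps w\<close>.\<close>

lemma size_bias:
  assumes w: "0 < w"
  shows "density (tilted w) (\<lambda>x. ennreal x) = (tilted_jumps w \<star> tilted w)"
proof (rule finite_measure_eqI_laplace)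
  interpret T: real_distribution "tilted w" by (rule real_distribution_tilted[OF w])
  note fj = finite_tilted_jumps[OF w]
  show "finite_measure (tilted_jumps w \<star> tilted w)"
    by (rule convolution_finite[OF fj T.finite_measure_axioms]) auto
  show "finite_measure (density (tilted w) (\<lambda>x. ennreal x))"
  proof
    have "emeasure (density (tilted w) (\<lambda>x. ennreal x)) (space (density (tilted w) (\<lambda>x. ennreal x)))
      = (\<integral>\<^sup>+x. ennreal x \<partial>tilted w)" by (simp add: emeasure_density)
    also have "\<dots> = ennreal (LINT x|tilted w. x)"
      using integrable_tilted_id[OF w] AE_tilted_nonneg by (intro nn_integral_eq_integral) auto
    finally show "emeasure (density (tilted w) (\<lambda>x. ennreal x)) (space (density (tilted w) (\<lambda>x. ennreal x))) \<noteq> \<infinity>"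
      by simp
  qed
  show "sets (density (tilted w) (\<lambda>x. ennreal x)) = sets borel" by simp
  show "sets (tilted_jumps w \<star> tilted w) = sets borel" by simp
  show "AE x in density (tilted w) (\<lambda>x. ennreal x). 0 \<le> x"
    using AE_tilted_nonneg by (subst AE_density) auto
  show "AE x in (tilted_jumps w \<star> tilted w). 0 \<le> x"
  proof -
    interpret fj: finite_measure "tilted_jumps w" by (rule fj)
    interpret pair_sigma_finite "tilted_jumps w" "tilted w" ..
    have j: "AE x in tilted_jumps w. 0 \<le> x"
      unfolding tilted_jumps_def using AE_nonneg by (subst AE_density) auto
    have AE2: "AE x in tilted_jumps w. AE y in tilted w. 0 \<le> fst (x, y) + snd (x, y)"
      using j
    proof eventually_elim
      case (elim x)
      show ?case using AE_tilted_nonneg by eventually_elim (use elim in auto)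
    qed
    have "AE z in (tilted_jumps w \<Otimes>\<^sub>M tilted w). 0 \<le> fst z + snd z"
    proof (rule AE_pair_measure)
      show "{z \<in> space (tilted_jumps w \<Otimes>\<^sub>M tilted w). 0 \<le> fst z + snd z} \<in> sets (tilted_jumps w \<Otimes>\<^sub>M tilted w)"
        by measurable
    qed (use AE2 in simp)
    then show ?thesis
      unfolding convolution_def by (subst AE_distr_iff) (auto simp: case_prod_beta)
  qed
  fix n :: nat
  have "(LINT x|density (tilted w) (\<lambda>x. ennreal x). exp (- (real n * x))) = (LINT x|tilted w. x *\<^sub>R exp (- (real n * x)))"
    by (rule integral_density) (use AE_tilted_nonneg in auto)
  also have "\<dots> = (LINT x|\<mu>. exp (t * \<phi> w) * (x * exp (- ((w + n) * x))))"
  proof (subst integral_tilted)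
    show "(LINT x|\<mu>. exp (t * \<phi> w - w * x) *\<^sub>R x *\<^sub>R exp (- (real n * x))) = (LINT x|\<mu>. exp (t * \<phi> w) * (x * exp (- ((w + n) * x))))"
      by (intro Bochner_Integration.integral_cong) (simp_all add: exp_tilt_mult mult.left_commute[of _ "x" for x])
  qed simp
  also have "\<dots> = exp (t * \<phi> w) * (t * J 1 (w + n) * exp (- (t * \<phi> (w + n))))"
    using w by (simp add: law_first_moment)
  also have "\<dots> = (LINT x|tilted_jumps w. exp (- (real n * x))) * (LINT x|tilted w. exp (- (real n * x)))"
  proof -
    have "(LINT x|tilted_jumps w. exp (- (real n * x))) = (LINT s|\<Lambda>. t * (s ^ 1 * exp (- ((w + n) * s))))"
    proof (subst integral_tilted_jumps)
      have e: "exp (- (w * s)) * exp (- (real n * s)) = exp (- ((w + n) * s))" for s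
        by (simp add: exp_add[symmetric] algebra_simps)
      show "(LINT s|\<Lambda>. (t * (s * exp (- (w * s)))) *\<^sub>R exp (- (real n * s))) = (LINT s|\<Lambda>. t * (s ^ 1 * exp (- ((w + n) * s))))"
        by (simp add: mult.assoc e)
    qed simp
    also have "\<dots> = t * J 1 (w + n)" unfolding J_def by (rule integral_mult_right_zero)
    finally have 1: "(LINT x|tilted_jumps w. exp (- (real n * x))) = t * J 1 (w + n)" .
    have "(LINT x|tilted w. exp (- (real n * x))) = (LINT x|\<mu>. exp (t * \<phi> w) * exp (- ((w + n) * x)))"
      by (subst integral_tilted) (simp_all add: exp_tilt_mult)
    also have "\<dots> = exp (t * \<phi> w) * exp (- (t * \<phi> (w + n)))"
      using w by (simp add: laplace)
    finally have 2: "(LINT x|tilted w. exp (- (real n * x))) = exp (t * \<phi> w) * exp (- (t * \<phi> (w + n)))" .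
    show ?thesis unfolding 1 2 by simp
  qed
  also have "\<dots> = (LINT x|(tilted_jumps w \<star> tilted w). exp (- (real n * x)))"
  proof (rule integral_convolution_mult[symmetric])
    have le: "AE x in m. norm (exp (- (real n * x))) \<le> 1" if "AE x in m. 0 \<le> x" for m :: "real measure"
      using that by eventually_elim auto
    have j: "AE x in tilted_jumps w. 0 \<le> x"
      unfolding tilted_jumps_def using AE_nonneg by (subst AE_density) auto
    show "integrable (tilted_jumps w) (\<lambda>x. exp (- (real n * x)))"
      using finite_measure.integrable_const_bound[OF fj le[OF j]] by simp
    show "integrable (tilted w) (\<lambda>x. exp (- (real n * x)))"
      using T.integrable_const_bound[OF le[OF AE_tilted_nonneg]] by simp
  qed (use fj T.finite_measure_axioms in \<open>auto simp: algebra_simps exp_add[symmetric]\<close>)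
  finally show "(LINT x|density (tilted w) (\<lambda>x. ennreal x). exp (- (real n * x)))
    = (LINT x|(tilted_jumps w \<star> tilted w). exp (- (real n * x)))" .
qed

lemma char_tilted_deriv:
  assumes w: "0 < w"
  shows "(char (tilted w) has_vector_derivative
    t * (\<i> * (LINT s|\<Lambda>. iexp (\<xi> * s) * complex_of_real (s * exp (- (w * s))))) * char (tilted w) \<xi>) (at \<xi>)"
proof -
  interpret T: real_distribution "tilted w" by (rule real_distribution_tilted[OF w])
  note fj = finite_tilted_jumps[OF w]
  have "((\<lambda>\<xi>. LINT x|tilted w. iexp (\<xi> * x)) has_vector_derivative
      (LINT x|tilted w. \<i> * complex_of_real x * iexp (\<xi> * x))) (at \<xi>)"
  proof (rule has_vector_derivative_lebesgue_integral[where e=1 and g="\<lambda>x. x" and f'="\<lambda>\<xi> x. \<i> * complex_of_real x * iexp (\<xi> * x)"])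
    show "((\<lambda>\<xi>. iexp (\<xi> * x)) has_vector_derivative \<i> * complex_of_real x * iexp (\<xi> * x)) (at \<xi>)" for \<xi> x
      by (auto intro!: derivative_eq_intros simp: has_vector_derivative_complex_iff Re_exp Im_exp)
    show "AE x in tilted w. \<forall>y. \<bar>y - \<xi>\<bar> < 1 \<longrightarrow> norm (\<i> * complex_of_real x * iexp (y * x)) \<le> x"
      using AE_tilted_nonneg by eventually_elim (simp add: norm_mult)
    show "integrable (tilted w) (\<lambda>s. iexp (x * s))" for x
      by (rule T.integrable_iexp) auto
  qed (use integrable_tilted_id[OF w] in auto)
  also have "(LINT x|tilted w. \<i> * complex_of_real x * iexp (\<xi> * x)) = \<i> * (LINT x|tilted w. x *\<^sub>R iexp (\<xi> * x))"
    by (subst integral_mult_right_zero[symmetric]) (simp add: scaleR_conv_of_real mult.assoc)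
  also have "(LINT x|tilted w. x *\<^sub>R iexp (\<xi> * x)) = (LINT x|density (tilted w) (\<lambda>x. ennreal x). iexp (\<xi> * x))"
    by (rule integral_density[symmetric]) (use AE_tilted_nonneg in auto)
  also have "\<dots> = (LINT s|tilted_jumps w. iexp (\<xi> * s)) * (LINT x|tilted w. iexp (\<xi> * x))"
    unfolding size_bias[OF w]
  proof (rule integral_convolution_mult)
    show "complex_integrable (tilted_jumps w) (\<lambda>x. iexp (\<xi> * x))"
      by (rule finite_measure.integrable_const_bound[OF fj, where B=1]) auto
    show "complex_integrable (tilted w) (\<lambda>x. iexp (\<xi> * x))"
      by (rule T.integrable_iexp) auto
  qed (use fj T.finite_measure_axioms in \<open>auto simp: algebra_simps exp_add[symmetric]\<close>)
  also have "(LINT s|tilted_jumps w. iexp (\<xi> * s)) = t * (LINT s|\<Lambda>. iexp (\<xi> * s) * complex_of_real (s * exp (- (w * s))))"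
    by (subst integral_tilted_jumps, simp, subst integral_mult_right_zero[symmetric])
      (simp add: scaleR_conv_of_real mult_ac)
  finally show ?thesis
    by (simp add: char_def[abs_def] mult_ac)
qed

text \<open>By the size-bias identity the characteristic function solves a linear differential equation
  whose solution is the asserted exponential.\<close>

lemma char_tilted:
  assumes w: "0 < w"
  shows "char (tilted w) \<xi> = exp (t * tilted_log_char w \<xi>)"
proof -
  interpret T: real_distribution "tilted w" by (rule real_distribution_tilted[OF w])
  let ?G = "\<lambda>\<xi>. char (tilted w) \<xi> * exp (- (t * tilted_log_char w \<xi>))"
  have "(?G has_vector_derivative 0) (at \<xi> within UNIV)" for \<xi>
  proof -
    define K where "K = \<i> * (LINT s|\<Lambda>. iexp (\<xi> * s) * complex_of_real (s * exp (- (w * s))))"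
    have 1: "(char (tilted w) has_vector_derivative t * K * char (tilted w) \<xi>) (at \<xi>)"
      using char_tilted_deriv[OF w, of \<xi>] by (simp add: K_def)
    have "((\<lambda>\<xi>. - (complex_of_real t * tilted_log_char w \<xi>)) has_vector_derivative - (complex_of_real t * K)) (at \<xi>)"
      using tilted_log_char_deriv[OF w, of \<xi>]
      by (auto intro!: derivative_eq_intros simp: K_def)
    then have 2: "((exp \<circ> (\<lambda>\<xi>. - (complex_of_real t * tilted_log_char w \<xi>))) has_vector_derivative
        - (complex_of_real t * K) * exp (- (complex_of_real t * tilted_log_char w \<xi>))) (at \<xi>)"
      by (rule field_vector_diff_chain_at) (auto intro: DERIV_exp)
    show ?thesis
      using has_vector_derivative_mult[OF 1 2] by (simp add: comp_def algebra_simps)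
  qed
  then obtain c where c: "\<And>\<xi>. ?G \<xi> = c"
    using has_vector_derivative_zero_constant[of UNIV ?G] by auto
  have "c = 1" using c[of 0] T.char_zero by simp
  then have "char (tilted w) \<xi> * exp (- (t * tilted_log_char w \<xi>)) = 1" using c[of \<xi>] by simp
  then show ?thesis by (simp add: exp_minus field_simps)
qed

lemma norm_char_tilted:
  assumes "0 < w" shows "norm (char (tilted w) \<xi>) = exp (- (t * damping w \<xi>))"
  using assms by (simp add: char_tilted tilted_log_char_eq)

end

section \<open>Decay of the tilted characteristic function\<close>

lemma has_bochner_integral_inverse_square_tail:
  fixes R E :: real
  assumes R: "0 < R" and E: "0 \<le> E"
  shows "has_bochner_integral lborel (\<lambda>x. indicator {R..} \<bar>x\<bar> * (E / x\<^sup>2)) (2 * E / R)"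
proof -
  let ?h = "\<lambda>x. indicator {R..} x * (E / x\<^sup>2)"
  have nn: "(\<integral>\<^sup>+x. ennreal (?h x) \<partial>lborel) = ennreal (E / R)"
  proof -
    have "(\<integral>\<^sup>+x. ennreal (?h x) \<partial>lborel) = (\<integral>\<^sup>+x. ennreal (E / x\<^sup>2) * indicator {R..} x \<partial>lborel)"
      by (intro nn_integral_cong) (auto simp: indicator_def)
    also have "\<dots> = ennreal (0 - (- E / R))"
    proof (rule nn_integral_FTC_atLeast)
      show "DERIV (\<lambda>x. - E / x) x :> E / x\<^sup>2" if "R \<le> x" for x
        using that R by (auto intro!: derivative_eq_intros simp: power2_eq_square)
      show "((\<lambda>x. - E / x) \<longlongrightarrow> 0) at_top"
        by (intro tendsto_divide_0[OF tendsto_const] filterlim_at_top_imp_at_infinity filterlim_ident)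
    qed (use E in auto)
    finally show ?thesis by simp
  qed
  have 1: "has_bochner_integral lborel ?h (E / R)"
    by (rule has_bochner_integral_nn_integral) (use nn E R in auto)
  then have 2: "has_bochner_integral lborel (\<lambda>x. ?h (- x)) (E / R)"
    using lborel_has_bochner_integral_real_affine_iff[of "-1" ?h "E / R" 0] by simp
  have "has_bochner_integral lborel (\<lambda>x. ?h x + ?h (- x)) (E / R + E / R)"
    by (rule has_bochner_integral_add[OF 1 2])
  also have "(\<lambda>x. ?h x + ?h (- x)) = (\<lambda>x. indicator {R..} \<bar>x\<bar> * (E / x\<^sup>2))"
    using R by (auto simp: fun_eq_iff indicator_def abs_if)
  finally show ?thesis by simp
qed

lemma inverse_square_decay:
  fixes g :: "real \<Rightarrow> real"
  assumes [measurable]: "g \<in> borel_measurable borel"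
    and g: "\<And>x. 0 \<le> g x" "\<And>x. g x \<le> 1" "\<And>x. x \<noteq> 0 \<Longrightarrow> g x \<le> E / x\<^sup>2"
    and E: "0 \<le> E" and R: "0 < R"
  shows "integrable lborel g" and "(LINT x|lborel. g x) \<le> 2 * R + 2 * E / R"
    and "integrable lborel (\<lambda>x. indicator {R..} \<bar>x\<bar> * g x)"
    and "(LINT x|lborel. indicator {R..} \<bar>x\<bar> * g x) \<le> 2 * E / R"
proof -
  let ?t = "\<lambda>x. indicator {R..} \<bar>x\<bar> * (E / x\<^sup>2)"
  note tail = has_bochner_integral_inverse_square_tail[OF R E]
  have le: "indicator {R..} \<bar>x\<bar> * g x \<le> ?t x" for x
    using g(3)[of x] R by (auto simp: indicator_def)
  have tint: "integrable lborel ?t" using tail by (rule integrable.intros)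
  have nn: "0 \<le> indicator {R..} \<bar>x\<bar> * g x" for x using g(1)[of x] by simp
  show int1: "integrable lborel (\<lambda>x. indicator {R..} \<bar>x\<bar> * g x)"
  proof (rule Bochner_Integration.integrable_bound[OF tint])
    show "AE x in lborel. norm (indicator {R..} \<bar>x\<bar> * g x) \<le> norm (?t x)"
      by (intro AE_I2, simp only: real_norm_def abs_of_nonneg[OF nn]) (rule order_trans[OF le abs_ge_self])
  qed simp
  show "(LINT x|lborel. indicator {R..} \<bar>x\<bar> * g x) \<le> 2 * E / R"
    using integral_mono[OF int1 tint le] tail by (simp add: has_bochner_integral_iff)
  have le2: "g x \<le> indicator {- R..R} x + ?t x" for x
    using g(2)[of x] g(3)[of x] R E by (cases "\<bar>x\<bar> \<le> R") (auto simp: indicator_def abs_if split: if_splits)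
  have iint: "integrable lborel (indicator {- R..R} :: real \<Rightarrow> real)"
    by (simp add: integrable_indicator_iff emeasure_lborel_Icc_eq)
  have int2: "integrable lborel (\<lambda>x. indicator {- R..R} x + ?t x)"
    using iint tint by (rule Bochner_Integration.integrable_add)
  show int: "integrable lborel g"
  proof (rule Bochner_Integration.integrable_bound[OF int2])
    show "AE x in lborel. norm (g x) \<le> norm (indicator {- R..R} x + ?t x)"
      by (intro AE_I2, simp only: real_norm_def abs_of_nonneg[OF g(1)]) (rule order_trans[OF le2 abs_ge_self])
  qed simp
  have "(LINT x|lborel. g x) \<le> (LINT x|lborel. indicator {- R..R} x + ?t x)"
    by (rule integral_mono[OF int int2 le2])
  also have "\<dots> = 2 * R + 2 * E / R"
    using tail R iint tint by (simp add: has_bochner_integral_iff)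
  finally show "(LINT x|lborel. g x) \<le> 2 * R + 2 * E / R" .
qed

lemma AE_lborel_open_ex:
  fixes x :: real
  assumes ae: "AE y in lborel. P y" and U: "open U" "x \<in> U"
  shows "\<exists>y\<in>U. P y"
proof (rule ccontr)
  assume no: "\<not> (\<exists>y\<in>U. P y)"
  obtain N where N: "{y \<in> space lborel. \<not> P y} \<subseteq> N" "emeasure lborel N = 0" "N \<in> sets lborel"
    using ae by (rule AE_E)
  obtain e where e: "e > 0" "cball x e \<subseteq> U"
    using U by (auto simp: open_contains_cball)
  have "{x - e..x + e} \<subseteq> N"
    using e no N(1) by (auto simp: subset_eq dist_real_def abs_le_iff)
  then have "emeasure lborel {x - e..x + e} \<le> emeasure lborel N"
    using N(3) by (intro emeasure_mono) auto
  then show False using e N(2) by simp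
qed

lemma continuous_density_unique:
  fixes f g :: "real \<Rightarrow> real"
  assumes f: "continuous_on UNIV f" "\<And>x. 0 \<le> f x" and g: "continuous_on UNIV g" "\<And>x. 0 \<le> g x"
    and eq: "density lborel f = density lborel g"
  shows "f = g"
proof (rule ext, rule ccontr)
  fix x assume ne: "f x \<noteq> g x"
  have [measurable]: "f \<in> borel_measurable borel" "g \<in> borel_measurable borel"
    using f g by (auto intro: borel_measurable_continuous_onI)
  have "AE x in lborel. ennreal (f x) = ennreal (g x)"
    using eq by (intro sigma_finite_measure.density_unique[OF sigma_finite_lborel]) auto
  then have ae: "AE x in lborel. f x = g x" using f(2) g(2) by simp
  have "open {x. f x - g x \<noteq> 0}"
    using open_Collect_neq[of "\<lambda>x. f x - g x" "\<lambda>_. 0"] f g by (auto intro!: continuous_intros)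
  then show False
    using AE_lborel_open_ex[OF ae, of "{x. f x - g x \<noteq> 0}" x] ne by auto
qed

context scaling_exponent
begin

lemma sigma_finite_Lambda: "sigma_finite_measure \<Lambda>"
  unfolding \<Lambda>_def
  by (subst sigma_finite_measure.sigma_finite_iff_density_finite[OF sigma_finite_lborel]) auto

lemma damping_measurable [measurable]: "damping w \<in> borel_measurable borel"
proof -
  interpret sigma_finite_measure \<Lambda> by (rule sigma_finite_Lambda)
  show ?thesis unfolding damping_def by measurable
qed

lemma phase_measurable [measurable]: "phase w \<in> borel_measurable borel"
proof -
  interpret sigma_finite_measure \<Lambda> by (rule sigma_finite_Lambda)
  show ?thesis unfolding phase_def by measurable
qed

lemma inverse_sqrt_scale:
  fixes k w :: real assumes "0 < k" "0 < w" "0 < A"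
  shows "D * w\<^sup>2 / k / (A * (w / sqrt k)) = D / A * (w / sqrt k)"
proof -
  have "k = sqrt k * sqrt k" using assms by simp
  then show ?thesis using assms by (simp add: power2_eq_square field_simps)
qed

lemma damping_integral_le:
  assumes \<kappa>: "0 < \<kappa>"
  shows "\<exists>C>0. \<forall>t>0. \<forall>w>0. \<kappa> \<le> t * \<phi> w \<longrightarrow> integrable lborel (\<lambda>\<xi>. exp (- (t * damping w \<xi>))) \<and>
    (LINT \<xi>|lborel. exp (- (t * damping w \<xi>))) \<le> C * (w / sqrt (t * \<phi> w))"
proof -
  obtain D where D: "D > 0" and *: "\<And>t w \<xi>. 0 < t \<Longrightarrow> 0 < w \<Longrightarrow> \<kappa> \<le> t * \<phi> w \<Longrightarrow> \<xi> \<noteq> 0 \<Longrightarrow>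
      exp (- (t * damping w \<xi>)) \<le> D / (t * \<phi> w * (\<xi> / w)\<^sup>2)"
    using exp_damping_le[OF \<kappa>] by blast
  have "integrable lborel (\<lambda>\<xi>. exp (- (t * damping w \<xi>))) \<and>
    (LINT \<xi>|lborel. exp (- (t * damping w \<xi>))) \<le> (2 + 2 * D) * (w / sqrt (t * \<phi> w))"
    if t: "0 < t" and w: "0 < w" and k: "\<kappa> \<le> t * \<phi> w" for t w
  proof -
    define k where "k = t * \<phi> w"
    have k0: "0 < k" using k \<kappa> by (simp add: k_def)
    define R where "R = w / sqrt k"
    have R: "0 < R" using w k0 by (simp add: R_def)
    have "exp (- (t * damping w \<xi>)) \<le> D * w\<^sup>2 / k / \<xi>\<^sup>2" if "\<xi> \<noteq> 0" for \<xi>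
      using *[OF t w k that] by (simp add: k_def power_divide mult_ac)
    note dec = inverse_square_decay[of "\<lambda>\<xi>. exp (- (t * damping w \<xi>))" "D * w\<^sup>2 / k" R, OF _ _ _ this]
    have "2 * (D * w\<^sup>2 / k) / R = 2 * D * R"
      using inverse_sqrt_scale[OF k0 w, of 1 D] unfolding R_def by simp
    then show ?thesis
      using dec(1,2) t damping_nonneg[of w] D k0 R unfolding k_def[symmetric] R_def[symmetric]
      by (simp add: algebra_simps)
  qed
  then show ?thesis using D by (intro exI[of _ "2 + 2 * D"]) auto
qed

text \<open>The integral that gives the tilted density at its mean.  On \<open>\<bar>\<xi>\<bar> < R = A w / sqrt k\<close> with
  \<open>k = t * \<phi> w\<close> \<open>t * phase w \<xi>\<close> is at most \<open>A\<^sup>3 / sqrt k\<close> in modulus, so the integrand is nonnegative there for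
  \<open>k \<ge> A\<^sup>6\<close> and bounded below for \<open>\<bar>\<xi>\<bar> \<le> w / sqrt k\<close>; for large \<open>A\<close> the rest is negligible.\<close>

lemma damping_integral_cos_ge:
  "\<exists>c>0. \<exists>B>0. \<forall>t>0. \<forall>w>0. B \<le> t * \<phi> w \<longrightarrow>
    c * (w / sqrt (t * \<phi> w)) \<le> (LINT \<xi>|lborel. exp (- (t * damping w \<xi>)) * cos (t * phase w \<xi>))"
proof -
  obtain D where D: "D > 0" and *: "\<And>t w \<xi>. 0 < t \<Longrightarrow> 0 < w \<Longrightarrow> 1 \<le> t * \<phi> w \<Longrightarrow> \<xi> \<noteq> 0 \<Longrightarrow>
      exp (- (t * damping w \<xi>)) \<le> D / (t * \<phi> w * (\<xi> / w)\<^sup>2)"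
    using exp_damping_le[of 1] by auto
  \<comment> \<open>This choice makes the tail at most half of the main contribution, see the estimate of
    \<open>2 * D / A\<close> below.\<close>
  define A where "A = 4 * exp 1 * D + 1"
  have A: "1 < A" using D by (simp add: A_def)
  have "exp (- 1) / 2 * (w / sqrt (t * \<phi> w)) \<le> (LINT \<xi>|lborel. exp (- (t * damping w \<xi>)) * cos (t * phase w \<xi>))"
    if t: "0 < t" and w: "0 < w" and k: "A ^ 6 \<le> t * \<phi> w" for t w
  proof -
    define k where "k = t * \<phi> w"
    have k1: "1 \<le> k" using order_trans[OF one_le_power[of A 6] k] A by (simp add: k_def)
    define q where "q = w / sqrt k"
    have q: "0 < q" using w k1 by (simp add: q_def)
    have qw: "(q / w)\<^sup>2 * k = 1" using w k1 by (simp add: q_def power_divide)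
    have sk: "A ^ 3 \<le> sqrt k"
      using k A by (intro real_le_rsqrt) (simp add: k_def flip: power_mult)
    let ?e = "\<lambda>\<xi>. exp (- (t * damping w \<xi>))"
    define R where "R = A * q"
    have R: "0 < R" "q < R" using A q by (auto simp: R_def)
    have "?e \<xi> \<le> D * w\<^sup>2 / k / \<xi>\<^sup>2" if "\<xi> \<noteq> 0" for \<xi>
      using *[OF t w _ that] k1 by (simp add: k_def power_divide mult_ac)
    note dec = inverse_square_decay[of ?e "D * w\<^sup>2 / k" R, OF _ _ _ this]
    have E: "0 \<le> D * w\<^sup>2 / k" using D k1 by simp
    have e1: "?e \<xi> \<le> 1" for \<xi> using t damping_nonneg[of w \<xi>] by simp
    have int: "integrable lborel ?e" by (rule dec(1)) (use e1 E R in auto)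
    have tail: "(LINT \<xi>|lborel. indicator {R..} \<bar>\<xi>\<bar> * ?e \<xi>) \<le> 2 * D / A * q"
      and tint: "integrable lborel (\<lambda>\<xi>. indicator {R..} \<bar>\<xi>\<bar> * ?e \<xi>)"
    proof -
      have "2 * (D * w\<^sup>2 / k) / R = 2 * D / A * q"
        using inverse_sqrt_scale[of k w A D] k1 w A unfolding R_def q_def by simp
      then show "(LINT \<xi>|lborel. indicator {R..} \<bar>\<xi>\<bar> * ?e \<xi>) \<le> 2 * D / A * q"
        using dec(4) e1 E R by simp
      show "integrable lborel (\<lambda>\<xi>. indicator {R..} \<bar>\<xi>\<bar> * ?e \<xi>)"
        by (rule dec(3)) (use e1 E R in auto)
    qed
    have iint: "integrable lborel (\<lambda>\<xi>. exp (- 1) / 2 * indicat_real {- q..q} \<xi>)"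
      by (intro integrable_mult_right) (simp add: integrable_indicator_iff emeasure_lborel_Icc_eq)
    have pointwise: "exp (- 1) / 2 * indicat_real {- q..q} \<xi> - indicator {R..} \<bar>\<xi>\<bar> * ?e \<xi>
        \<le> ?e \<xi> * cos (t * phase w \<xi>)" for \<xi>
    proof (cases "R \<le> \<bar>\<xi>\<bar>")
      case True
      then have "\<xi> \<notin> {- q..q}" using R by auto
      moreover have "?e \<xi> * (- 1) \<le> ?e \<xi> * cos (t * phase w \<xi>)"
        by (intro mult_left_mono) auto
      ultimately show ?thesis using True by simp
    next
      case False
      have "\<bar>t * phase w \<xi>\<bar> = t * \<bar>phase w \<xi>\<bar>" using t by (simp add: abs_mult)
      also have "\<dots> \<le> t * ((\<bar>\<xi>\<bar> / w) ^ 3 * \<phi> w)"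
        using abs_phase_le[OF w] t by (intro mult_left_mono) auto
      also have "\<dots> \<le> (R / w) ^ 3 * k"
        using False w t phi_pos[OF w] by (auto simp: k_def mult_ac intro!: mult_left_mono power_mono divide_right_mono)
      also have "\<dots> = A ^ 3 * (q / w) * ((q / w)\<^sup>2 * k)"
        by (simp add: R_def power_mult_distrib power_divide power3_eq_cube power2_eq_square mult_ac)
      also have "\<dots> = A ^ 3 / sqrt k" unfolding qw using w by (simp add: q_def)
      also have "\<dots> \<le> 1" using sk k1 by (simp add: divide_le_eq_1)
      finally have ph: "\<bar>t * phase w \<xi>\<bar> \<le> 1" .
      then have "(t * phase w \<xi>)\<^sup>2 \<le> 1" by (simp add: abs_square_le_1)
      then have cos: "1 / 2 \<le> cos (t * phase w \<xi>)"
        using one_minus_cos_le[of "t * phase w \<xi>"] by simp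
      have "exp (- 1) / 2 * indicat_real {- q..q} \<xi> \<le> ?e \<xi> * (1 / 2)"
      proof (cases "\<xi> \<in> {- q..q}")
        case True
        then have "\<bar>\<xi>\<bar> \<le> q" by auto
        have "t * damping w \<xi> \<le> t * ((\<xi> / w)\<^sup>2 * \<phi> w)"
          using damping_le[OF w] t by (intro mult_left_mono) auto
        also have "\<dots> = (\<bar>\<xi>\<bar> / w)\<^sup>2 * k" by (simp add: k_def power_divide)
        also have "\<dots> \<le> (q / w)\<^sup>2 * k"
          using \<open>\<bar>\<xi>\<bar> \<le> q\<close> w k1 by (intro mult_right_mono power_mono divide_right_mono) auto
        finally show ?thesis using True qw by simp
      qed simp
      also have "\<dots> \<le> ?e \<xi> * cos (t * phase w \<xi>)" using cos by (intro mult_left_mono) auto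
      finally show ?thesis using False by simp
    qed
    have cint: "integrable lborel (\<lambda>\<xi>. ?e \<xi> * cos (t * phase w \<xi>))"
      by (rule Bochner_Integration.integrable_bound[OF int]) (auto simp: abs_mult mult_left_le)
    have "exp (- 1) / 2 * q \<le> exp (- 1) * q - 2 * D / A * q"
    proof -
      have "4 * exp 1 * D \<le> A" by (simp add: A_def)
      then have "2 * D / A \<le> exp (- 1) / 2" using A by (simp add: exp_minus field_simps)
      then have "2 * D / A * q \<le> exp (- 1) / 2 * q" using q by (intro mult_right_mono) auto
      then show ?thesis by linarith
    qed
    also have "\<dots> \<le> (LINT \<xi>|lborel. exp (- 1) / 2 * indicat_real {- q..q} \<xi>) - (LINT \<xi>|lborel. indicator {R..} \<bar>\<xi>\<bar> * ?e \<xi>)"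
      using tail q by simp
    also have "\<dots> = (LINT \<xi>|lborel. exp (- 1) / 2 * indicat_real {- q..q} \<xi> - indicator {R..} \<bar>\<xi>\<bar> * ?e \<xi>)"
      by (rule Bochner_Integration.integral_diff[symmetric, OF iint tint])
    also have "\<dots> \<le> (LINT \<xi>|lborel. ?e \<xi> * cos (t * phase w \<xi>))"
      by (intro integral_mono Bochner_Integration.integrable_diff iint tint cint pointwise)
    finally show ?thesis by (simp add: q_def k_def)
  qed
  moreover have "0 < A ^ 6" using A by simp
  moreover have "0 < exp (- 1) / (2::real)" by simp
  ultimately show ?thesis by blast
qed

end

section \<open>The transition density\<close>

context subordinator_law
begin

lemma integrable_exp_damping:
  assumes w: "0 < w" shows "integrable lborel (\<lambda>\<xi>. exp (- (t * damping w \<xi>)))"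
  using damping_integral_le[of "t * \<phi> w"] t_pos w phi_pos[OF w] by auto

lemma integrable_char_tilted:
  assumes w: "0 < w" shows "integrable lborel (char (tilted w))"
proof -
  interpret T: real_distribution "tilted w" by (rule real_distribution_tilted[OF w])
  show ?thesis
    by (rule Bochner_Integration.integrable_bound[OF integrable_exp_damping[OF w]])
      (auto simp: norm_char_tilted[OF w])
qed

abbreviation tilted_density :: "real \<Rightarrow> real \<Rightarrow> real" where
  "tilted_density w \<equiv> real_distribution.inversion_density (tilted w)"

lemma tilted_density_le:
  assumes w: "0 < w"
  shows "tilted_density w x \<le> (LINT \<xi>|lborel. exp (- (t * damping w \<xi>))) / (2 * pi)"
proof -
  interpret T: real_distribution "tilted w" by (rule real_distribution_tilted[OF w])
  show ?thesis
    using T.abs_inversion_density_le[OF integrable_char_tilted[OF w], of x]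
    by (simp add: norm_char_tilted[OF w])
qed

lemma tilted_density_at_mean:
  assumes w: "0 < w"
  shows "tilted_density w (t * J 1 w)
    = (LINT \<xi>|lborel. exp (- (t * damping w \<xi>)) * cos (t * phase w \<xi>)) / (2 * pi)"
proof -
  interpret T: real_distribution "tilted w" by (rule real_distribution_tilted[OF w])
  have "Re (LINT \<xi>|lborel. iexp (- (\<xi> * (t * J 1 w))) * char (tilted w) \<xi>)
      = (LINT \<xi>|lborel. Re (iexp (- (\<xi> * (t * J 1 w))) * char (tilted w) \<xi>))"
    by (rule integral_Re[symmetric]) (rule T.integrable_iexp_char[OF integrable_char_tilted[OF w]])
  also have "\<dots> = (LINT \<xi>|lborel. exp (- (t * damping w \<xi>)) * cos (t * phase w \<xi>))"
  proof (intro Bochner_Integration.integral_cong refl)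
    fix \<xi>
    have "iexp (- (\<xi> * (t * J 1 w))) * char (tilted w) \<xi>
      = exp (Complex (- (t * damping w \<xi>)) (t * phase w \<xi>))"
      unfolding char_tilted[OF w] tilted_log_char_eq[OF w] exp_add[symmetric]
      by (rule arg_cong[of _ _ exp]) (simp add: complex_eq_iff algebra_simps)
    then show "Re (iexp (- (\<xi> * (t * J 1 w))) * char (tilted w) \<xi>)
      = exp (- (t * damping w \<xi>)) * cos (t * phase w \<xi>)"
      by (simp add: Re_exp)
  qed
  finally show ?thesis by (simp add: T.inversion_density_def)
qed

text \<open>The density of the law, obtained by undoing the tilt with parameter \<open>1\<close>.  By continuity every
  other parameter gives the same function, see \<open>p_eq_tilted\<close>.\<close>

definition p :: "real \<Rightarrow> real" where
  "p x = exp (1 * x - t * \<phi> 1) * tilted_density 1 x"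

lemma mu_eq_density_of_tilted:
  assumes w: "0 < w"
  shows "\<mu> = density lborel (\<lambda>x. ennreal (exp (w * x - t * \<phi> w) * tilted_density w x))"
    and "continuous_on UNIV (\<lambda>x. exp (w * x - t * \<phi> w) * tilted_density w x)"
    and "0 \<le> exp (w * x - t * \<phi> w) * tilted_density w x"
proof -
  interpret T: real_distribution "tilted w" by (rule real_distribution_tilted[OF w])
  note int = integrable_char_tilted[OF w]
  show "continuous_on UNIV (\<lambda>x. exp (w * x - t * \<phi> w) * tilted_density w x)"
    by (intro continuous_intros T.continuous_inversion_density[OF int])
  show "0 \<le> exp (w * x - t * \<phi> w) * tilted_density w x"
    using T.inversion_density_nonneg[OF int] by simp
  have [measurable]: "tilted_density w \<in> borel_measurable borel"
    using T.continuous_inversion_density[OF int] by (rule borel_measurable_continuous_onI)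
  have "density (tilted w) (\<lambda>x. ennreal (exp (w * x - t * \<phi> w)))
      = density \<mu> (\<lambda>x. ennreal (exp (t * \<phi> w - w * x)) * ennreal (exp (w * x - t * \<phi> w)))"
    unfolding tilted_def by (rule density_density_eq) auto
  also have "(\<lambda>x. ennreal (exp (t * \<phi> w - w * x)) * ennreal (exp (w * x - t * \<phi> w))) = (\<lambda>_. 1)"
    by (auto simp: fun_eq_iff ennreal_mult[symmetric] exp_add[symmetric])
  also have "density \<mu> (\<lambda>_. 1) = \<mu>" by (rule density_1)
  finally have "\<mu> = density (tilted w) (\<lambda>x. ennreal (exp (w * x - t * \<phi> w)))" ..
  also have "\<dots> = density (density lborel (tilted_density w)) (\<lambda>x. ennreal (exp (w * x - t * \<phi> w)))"
    using T.eq_density_inversion[OF int] by simp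
  also have "\<dots> = density lborel (\<lambda>x. ennreal (tilted_density w x) * ennreal (exp (w * x - t * \<phi> w)))"
    by (rule density_density_eq) auto
  also have "(\<lambda>x. ennreal (tilted_density w x) * ennreal (exp (w * x - t * \<phi> w)))
      = (\<lambda>x. ennreal (exp (w * x - t * \<phi> w) * tilted_density w x))"
    by (simp add: fun_eq_iff ennreal_mult'' mult.commute)
  finally show "\<mu> = density lborel (\<lambda>x. ennreal (exp (w * x - t * \<phi> w) * tilted_density w x))" .
qed

lemma mu_eq_density: "\<mu> = density lborel p"
  and continuous_p: "continuous_on UNIV p"
  and p_nonneg: "0 \<le> p x"
  using mu_eq_density_of_tilted[of 1] by (simp_all add: p_def[abs_def])

lemma p_measurable [measurable]: "p \<in> borel_measurable borel"
  using continuous_p by (rule borel_measurable_continuous_onI)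

lemma p_eq_tilted:
  assumes w: "0 < w"
  shows "p x = exp (w * x - t * \<phi> w) * tilted_density w x"
proof -
  have "p = (\<lambda>x. exp (w * x - t * \<phi> w) * tilted_density w x)"
    by (rule continuous_density_unique)
      (use mu_eq_density_of_tilted[OF w] mu_eq_density continuous_p p_nonneg in auto)
  then show ?thesis by (rule fun_cong)
qed

lemma p_eq_0: "x \<le> 0 \<Longrightarrow> p x = 0"
proof -
  have "AE y in lborel. p y \<noteq> 0 \<longrightarrow> 0 \<le> y"
    using AE_mu_nonneg p_nonneg by (subst (asm) mu_eq_density, subst (asm) AE_density) (auto simp: less_le)
  then have ae: "AE y in lborel. p y \<noteq> 0 \<longrightarrow> 0 \<le> y" .
  have neg: "p x = 0" if x: "x < 0" for x
  proof (rule ccontr)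
    assume "p x \<noteq> 0"
    have "open ({y. p y \<noteq> 0} \<inter> {..<0})"
      using open_Collect_neq[of p "\<lambda>_. 0"] continuous_p by (auto intro!: continuous_intros)
    then show False
      using AE_lborel_open_ex[OF ae, of "{y. p y \<noteq> 0} \<inter> {..<0}" x] \<open>p x \<noteq> 0\<close> x by auto
  qed
  have "p 0 = 0"
  proof (rule tendsto_unique)
    show "(p \<longlongrightarrow> p 0) (at_left 0)"
      using continuous_p by (simp add: continuous_on_eq_continuous_at continuous_at_imp_continuous_at_within flip: continuous_within)
    have "\<forall>\<^sub>F y in at_left 0. p y = 0"
      by (auto simp: eventually_at_filter neg)
    then show "(p \<longlongrightarrow> 0) (at_left 0)"
      using tendsto_eventually by blast
  qed simp
  then show "x \<le> 0 \<Longrightarrow> p x = 0" using neg by (cases "x = 0") auto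
qed

text \<open>The size-bias identity in terms of densities; the tilts on both sides cancel.\<close>

lemma density_size_bias:
  "AE x in lborel. ennreal (x * p x) = (\<integral>\<^sup>+y. ennreal (t * ((x - y) * \<nu> (x - y))) * ennreal (p y) \<partial>lborel)"
proof -
  interpret T: real_distribution "tilted 1" by (rule real_distribution_tilted) simp
  define c where "c = exp (t * \<phi> 1)"
  have c: "0 < c" by (simp add: c_def)
  have td: "tilted_density 1 x = c * (exp (- x) * p x)" for x
    by (simp add: p_def c_def exp_diff exp_minus)
  have T: "tilted 1 = density lborel (\<lambda>x. ennreal (c * (exp (- x) * p x)))"
    using T.eq_density_inversion[OF integrable_char_tilted] by (simp add: td)
  define j where "j s = ennreal (t * (s * \<nu> s)) * ennreal (exp (- s))" for s
  have [measurable]: "j \<in> borel_measurable borel" unfolding j_def by measurable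
  have Jm: "tilted_jumps 1 = density lborel j"
    unfolding tilted_jumps_def \<Lambda>_def
    by (subst density_density_eq) (auto simp: j_def ennreal_mult'[symmetric] nu_nonneg mult_ac intro!: density_cong)
  have "density (tilted 1) (\<lambda>x. ennreal x) = (tilted_jumps 1 \<star> tilted 1)"
    by (rule size_bias) simp
  also have "\<dots> = density lborel (\<lambda>x. \<integral>\<^sup>+y. j (x - y) * ennreal (c * (exp (- y) * p y)) \<partial>lborel)"
    unfolding T Jm
    by (rule convolution_density)
      (use finite_tilted_jumps[of 1] T.finite_measure_axioms in \<open>auto simp: T Jm\<close>)
  also have "density (tilted 1) (\<lambda>x. ennreal x) = density lborel (\<lambda>x. ennreal (c * (exp (- x) * p x)) * ennreal x)"
    unfolding T by (rule density_density_eq) auto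
  finally have "AE x in lborel. ennreal (c * (exp (- x) * p x)) * ennreal x
      = (\<integral>\<^sup>+y. j (x - y) * ennreal (c * (exp (- y) * p y)) \<partial>lborel)"
    by (intro sigma_finite_measure.density_unique[OF sigma_finite_lborel]) auto
  then show ?thesis
  proof eventually_elim
    case (elim x)
    have "ennreal (c * exp (- x)) * ennreal (x * p x) = ennreal (c * (exp (- x) * p x)) * ennreal x"
    proof (cases "0 \<le> x")
      case True
      then show ?thesis using c p_nonneg[of x] by (simp add: ennreal_mult'[symmetric] mult_ac)
    qed (use p_eq_0[of x] in auto)
    also have "\<dots> = (\<integral>\<^sup>+y. j (x - y) * ennreal (c * (exp (- y) * p y)) \<partial>lborel)" by (rule elim)
    also have "\<dots> = (\<integral>\<^sup>+y. ennreal (c * exp (- x)) * (ennreal (t * ((x - y) * \<nu> (x - y))) * ennreal (p y)) \<partial>lborel)"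
    proof (intro nn_integral_cong)
      fix y
      have "j (x - y) * ennreal (c * (exp (- y) * p y))
        = ennreal (t * ((x - y) * \<nu> (x - y))) * ennreal (p y) * ennreal (c * (exp (- (x - y)) * exp (- y)))"
        using c p_nonneg[of y] by (simp add: j_def ennreal_mult mult_ac)
      also have "exp (- (x - y)) * exp (- y) = exp (- x)" by (simp add: exp_add[symmetric])
      finally show "j (x - y) * ennreal (c * (exp (- y) * p y))
        = ennreal (c * exp (- x)) * (ennreal (t * ((x - y) * \<nu> (x - y))) * ennreal (p y))"
        by (simp add: mult_ac)
    qed
    also have "\<dots> = ennreal (c * exp (- x)) * (\<integral>\<^sup>+y. ennreal (t * ((x - y) * \<nu> (x - y))) * ennreal (p y) \<partial>lborel)"
      by (rule nn_integral_cmult) measurable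
    finally show ?case
      using c by (subst (asm) ennreal_mult_cancel_left) auto
  qed
qed

end

section \<open>Bounds for the density\<close>

lemma AE_le_imp_le_closure:
  fixes f g :: "real \<Rightarrow> real"
  assumes f: "isCont f x" and g: "isCont g x"
    and ae: "AE z in lborel. z \<in> U \<longrightarrow> f z \<le> g z" and U: "open U" "x \<in> closure U"
  shows "f x \<le> g x"
proof -
  have "\<exists>z. \<bar>z - x\<bar> < 1 / real (Suc n) \<and> f z \<le> g z" for n
  proof -
    have "U \<inter> ball x (1 / real (Suc n)) \<noteq> {}"
    proof
      assume "U \<inter> ball x (1 / real (Suc n)) = {}"
      then have "closure U \<inter> ball x (1 / real (Suc n)) = {}"
        using open_Int_closure_eq_empty[of "ball x (1 / real (Suc n))" U] by (simp add: Int_commute)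
      moreover have "x \<in> ball x (1 / real (Suc n))" by simp
      ultimately show False using U(2) by blast
    qed
    then obtain y where "y \<in> U \<inter> ball x (1 / real (Suc n))" by blast
    with AE_lborel_open_ex[OF ae, of "U \<inter> ball x (1 / real (Suc n))" y] U(1)
    obtain z where "z \<in> U \<inter> ball x (1 / real (Suc n))" "f z \<le> g z" by blast
    then show ?thesis by (auto simp: dist_real_def abs_minus_commute)
  qed
  then obtain Z where Z: "\<And>n. \<bar>Z n - x\<bar> < 1 / real (Suc n)" "\<And>n. f (Z n) \<le> g (Z n)" by metis
  have "(\<lambda>n. Z n - x) \<longlonglongrightarrow> 0"
    by (rule tendsto_rabs_zero_cancel[OF tendsto_sandwich[OF _ _ tendsto_const LIMSEQ_inverse_real_of_nat]])
      (use Z(1) in \<open>auto intro!: always_eventually less_imp_le simp: inverse_eq_divide\<close>)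
  then have "Z \<longlonglongrightarrow> x" by (rule LIM_zero_cancel)
  then show ?thesis
    by (intro LIMSEQ_le[OF isCont_tendsto_compose[OF f] isCont_tendsto_compose[OF g]]) (auto intro: Z)
qed

context scaling_exponent
begin

text \<open>The bounds below hold with constants that are uniform in the time \<open>t\<close>, hence the explicit
  quantification over laws.\<close>

abbreviation is_law :: "real measure \<Rightarrow> real \<Rightarrow> bool" where
  "is_law \<mu> t \<equiv> subordinator_law \<phi> \<nu> \<alpha> \<beta> cl cu cm \<mu> t"

abbreviation law_density :: "real measure \<Rightarrow> real \<Rightarrow> real \<Rightarrow> real" where
  "law_density \<mu> t \<equiv> subordinator_law.p \<phi> \<mu> t"

lemma isCont_phi: "0 < u \<Longrightarrow> isCont \<phi> u"
  using DERIV_phi DERIV_isCont by blast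

lemma isCont_phi_inverse: "0 < x \<Longrightarrow> isCont (\<lambda>x. \<phi> (1 / x)) x"
  by (rule isCont_o2[where g=\<phi>]) (auto intro!: continuous_intros isCont_phi)

lemma law_density_le_tilt:
  assumes \<kappa>: "0 < \<kappa>"
  shows "\<exists>C>0. \<forall>\<mu> t w x. is_law \<mu> t \<longrightarrow> 0 < w \<longrightarrow> \<kappa> \<le> t * \<phi> w \<longrightarrow>
    law_density \<mu> t x \<le> C * (w / sqrt (t * \<phi> w) * exp (w * x - t * \<phi> w))"
proof -
  obtain C where C: "C > 0" "\<And>t w. 0 < t \<Longrightarrow> 0 < w \<Longrightarrow> \<kappa> \<le> t * \<phi> w \<Longrightarrow>
      (LINT \<xi>|lborel. exp (- (t * damping w \<xi>))) \<le> C * (w / sqrt (t * \<phi> w))"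
    using damping_integral_le[OF \<kappa>] by blast
  have "law_density \<mu> t x \<le> C * (w / sqrt (t * \<phi> w) * exp (w * x - t * \<phi> w))"
    if "is_law \<mu> t" and w: "0 < w" and k: "\<kappa> \<le> t * \<phi> w" for \<mu> t w x
  proof -
    interpret L: subordinator_law \<phi> \<nu> \<alpha> \<beta> cl cu cm \<mu> t by fact
    let ?I = "LINT \<xi>|lborel. exp (- (t * damping w \<xi>))"
    have I: "?I \<le> C * (w / sqrt (t * \<phi> w))" by (rule C(2)[OF L.t_pos w k])
    have "0 \<le> C * (w / sqrt (t * \<phi> w))" using C(1) w k \<kappa> by simp
    moreover have "?I / (2 * pi) \<le> C * (w / sqrt (t * \<phi> w)) / (2 * pi)" using I by (intro divide_right_mono) auto
    moreover have "C * (w / sqrt (t * \<phi> w)) / (2 * pi) \<le> C * (w / sqrt (t * \<phi> w)) / 1"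
      using calculation(1) pi_ge_two by (intro divide_left_mono) auto
    ultimately have "L.tilted_density w x \<le> C * (w / sqrt (t * \<phi> w))"
      using L.tilted_density_le[OF w, of x] by simp
    then have "exp (w * x - t * \<phi> w) * L.tilted_density w x \<le> exp (w * x - t * \<phi> w) * (C * (w / sqrt (t * \<phi> w)))"
      by (intro mult_left_mono) auto
    then show ?thesis unfolding L.p_eq_tilted[OF w] by (simp add: mult_ac)
  qed
  then show ?thesis using C(1) by blast
qed

lemma law_density_ge_at_mean:
  "\<exists>c>0. \<exists>B>0. \<forall>\<mu> t w. is_law \<mu> t \<longrightarrow> 0 < w \<longrightarrow> B \<le> t * \<phi> w \<longrightarrow>
    c * (w / sqrt (t * \<phi> w) * exp (w * (t * J 1 w) - t * \<phi> w)) \<le> law_density \<mu> t (t * J 1 w)"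
proof -
  obtain c B where c: "c > 0" "B > 0" "\<And>t w. 0 < t \<Longrightarrow> 0 < w \<Longrightarrow> B \<le> t * \<phi> w \<Longrightarrow>
      c * (w / sqrt (t * \<phi> w)) \<le> (LINT \<xi>|lborel. exp (- (t * damping w \<xi>)) * cos (t * phase w \<xi>))"
    using damping_integral_cos_ge by blast
  have "c / (2 * pi) * (w / sqrt (t * \<phi> w) * exp (w * (t * J 1 w) - t * \<phi> w)) \<le> law_density \<mu> t (t * J 1 w)"
    if "is_law \<mu> t" and w: "0 < w" and k: "B \<le> t * \<phi> w" for \<mu> t w
  proof -
    interpret L: subordinator_law \<phi> \<nu> \<alpha> \<beta> cl cu cm \<mu> t by fact
    have "c * (w / sqrt (t * \<phi> w)) / (2 * pi) \<le> L.tilted_density w (t * J 1 w)"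
      unfolding L.tilted_density_at_mean[OF w]
      using c(3)[OF L.t_pos w k] by (intro divide_right_mono) auto
    then have "exp (w * (t * J 1 w) - t * \<phi> w) * (c * (w / sqrt (t * \<phi> w)) / (2 * pi))
        \<le> exp (w * (t * J 1 w) - t * \<phi> w) * L.tilted_density w (t * J 1 w)"
      by (intro mult_left_mono) auto
    then show ?thesis unfolding L.p_eq_tilted[OF w] by (simp add: mult_ac)
  qed
  moreover have "0 < c / (2 * pi)" using c by simp
  ultimately show ?thesis using c(2) by blast
qed

text \<open>Splitting \<open>exp (- t \<phi> v) = \<integral> exp (- v y) \<mu>(dy)\<close> at \<open>x\<close> gives
  \<open>\<mu> {..<x} \<ge> exp (- t \<phi> v) - exp (- v x)\<close>.  For \<open>v = L / x\<close> the upper scaling with \<open>\<beta> < 1\<close> makes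
  \<open>t \<phi> v \<le> L - 1\<close> when \<open>L\<close> is large.\<close>

lemma small_ball:
  assumes B: "0 < B"
  shows "\<exists>c>0. \<forall>\<mu> t x. is_law \<mu> t \<longrightarrow> 0 < x \<longrightarrow> t * \<phi> (1 / x) \<le> B \<longrightarrow> c \<le> measure \<mu> {..<x}"
proof -
  define L where "L = max 2 ((2 * cu * B) powr (1 / (1 - \<beta>)))"
  have L: "2 \<le> L" by (simp add: L_def)
  have "2 * cu * B = ((2 * cu * B) powr (1 / (1 - \<beta>))) powr (1 - \<beta>)"
    using constants exponents B by (simp add: powr_powr)
  also have "\<dots> \<le> L powr (1 - \<beta>)"
    using exponents by (intro powr_mono2) (auto simp: L_def)
  finally have "2 * cu * B * L powr \<beta> \<le> L powr (1 - \<beta>) * L powr \<beta>" by (intro mult_right_mono) auto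
  also have "\<dots> = L" using L by (simp add: powr_add[symmetric])
  finally have L2: "cu * B * L powr \<beta> \<le> L - 1" using L by simp
  have "exp (- (L - 1)) - exp (- L) \<le> measure \<mu> {..<x}"
    if "is_law \<mu> t" and x: "0 < x" and k: "t * \<phi> (1 / x) \<le> B" for \<mu> t x
  proof -
    interpret M: subordinator_law \<phi> \<nu> \<alpha> \<beta> cl cu cm \<mu> t by fact
    have "t * \<phi> (L / x) \<le> t * (cu * L powr \<beta> * \<phi> (1 / x))"
      using upper_scaling[of "1 / x" "L / x"] x L M.t_pos by (intro mult_left_mono) (auto simp: field_simps)
    also have "\<dots> = cu * L powr \<beta> * (t * \<phi> (1 / x))" by simp
    also have "\<dots> \<le> cu * L powr \<beta> * B" using k constants by (intro mult_left_mono) auto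
    also have "\<dots> \<le> L - 1" using L2 by (simp add: mult_ac)
    finally have "exp (- (L - 1)) \<le> exp (- (t * \<phi> (L / x)))" by simp
    also have "\<dots> = (LINT y|\<mu>. exp (- (L / x * y)))" using L x by (intro M.laplace[symmetric]) auto
    also have "\<dots> \<le> (LINT y|\<mu>. indicator {..<x} y + exp (- L))"
    proof (rule integral_mono_AE)
      show "integrable \<mu> (\<lambda>y. exp (- (L / x * y)))" using L x by (intro M.integrable_exp_neg) auto
      show "integrable \<mu> (\<lambda>y. indicat_real {..<x} y + exp (- L))"
        by (intro Bochner_Integration.integrable_add) (auto simp: M.emeasure_eq_measure)
      show "AE y in \<mu>. exp (- (L / x * y)) \<le> indicat_real {..<x} y + exp (- L)"
        using M.AE_mu_nonneg
      proof eventually_elim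
        case (elim y)
        show ?case
        proof (cases "y < x")
          case True
          have "exp (- (L / x * y)) \<le> 1" using elim L x by simp
          then show ?thesis using True by (simp add: add_increasing2)
        next
          case False
          then have "L * x \<le> L * y" using L by (intro mult_left_mono) auto
          then have "L \<le> L / x * y" using x by (simp add: field_simps)
          then show ?thesis using False by simp
        qed
      qed
    qed
    also have "\<dots> = measure \<mu> {..<x} + exp (- L)"
      using M.prob_space by (subst Bochner_Integration.integral_add) (auto simp: M.emeasure_eq_measure)
    finally show ?thesis by simp
  qed
  moreover have "0 < exp (- (L - 1)) - exp (- L)" by simp
  ultimately show ?thesis by blast
qed

text \<open>The lower bound of one big jump: the rest of the mass stays below \<open>x\<close> with positive
  probability.\<close>

lemma law_density_ge_jump:
  assumes B: "0 < B"
  shows "\<exists>c>0. \<forall>\<mu> t x. is_law \<mu> t \<longrightarrow> 0 < x \<longrightarrow> t * \<phi> (1 / x) \<le> B \<longrightarrow>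
    c * (t / x * \<phi> (1 / x)) \<le> law_density \<mu> t x"
proof -
  obtain c where c: "c > 0" "\<And>\<mu> t x. is_law \<mu> t \<Longrightarrow> 0 < x \<Longrightarrow> t * \<phi> (1 / x) \<le> B \<Longrightarrow> c \<le> measure \<mu> {..<x}"
    using small_ball[OF B] by blast
  obtain d where d: "d > 0" "\<And>x. x > 0 \<Longrightarrow> d * (\<phi> (1 / x) / x) \<le> \<nu> x"
    using nu_lower by blast
  have "d * c * (t / x * \<phi> (1 / x)) \<le> law_density \<mu> t x"
    if law: "is_law \<mu> t" and x: "0 < x" and k: "t * \<phi> (1 / x) \<le> B" for \<mu> t x
  proof -
    interpret L: subordinator_law \<phi> \<nu> \<alpha> \<beta> cl cu cm \<mu> t by fact
    have "AE z in lborel. z \<in> {x<..} \<longrightarrow> d * c * (t / z * \<phi> (1 / z)) \<le> L.p z"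
      using L.density_size_bias
    proof eventually_elim
      case (elim z)
      show ?case
      proof
        assume "z \<in> {x<..}"
        then have z: "x < z" "0 < z" using x by auto
        have "t * \<phi> (1 / z) \<le> t * \<phi> (1 / x)"
          using z x L.t_pos by (intro mult_left_mono phi_mono) (auto simp: field_simps)
        then have m: "c \<le> measure \<mu> {..<z}" using c(2)[OF law z(2)] k by simp
        have pz: "0 \<le> \<phi> (1 / z)" using phi_pos[of "1 / z"] z by simp
        have "ennreal (t * (d * \<phi> (1 / z)) * c) \<le> ennreal (t * (d * \<phi> (1 / z))) * emeasure \<mu> {..<z}"
          using m c d pz L.t_pos by (simp add: L.emeasure_eq_measure ennreal_mult[symmetric] mult_left_mono)
        also have "emeasure \<mu> {..<z} = (\<integral>\<^sup>+y. ennreal (L.p y) * indicator {..<z} y \<partial>lborel)"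
          by (subst L.mu_eq_density) (simp add: emeasure_density)
        also have "ennreal (t * (d * \<phi> (1 / z))) * \<dots> = (\<integral>\<^sup>+y. ennreal (t * (d * \<phi> (1 / z))) * (ennreal (L.p y) * indicator {..<z} y) \<partial>lborel)"
          by (rule nn_integral_cmult[symmetric]) measurable
        also have "\<dots> \<le> (\<integral>\<^sup>+y. ennreal (t * ((z - y) * \<nu> (z - y))) * ennreal (L.p y) \<partial>lborel)"
        proof (rule nn_integral_mono)
          fix y
          show "ennreal (t * (d * \<phi> (1 / z))) * (ennreal (L.p y) * indicator {..<z} y)
            \<le> ennreal (t * ((z - y) * \<nu> (z - y))) * ennreal (L.p y)"
          proof (cases "0 < y \<and> y < z")
            case True
            have "\<phi> (1 / z) \<le> \<phi> (1 / (z - y))" using True by (intro phi_mono) (auto simp: field_simps)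
            then have "d * \<phi> (1 / z) \<le> d * \<phi> (1 / (z - y))" using d by simp
            also have "\<dots> \<le> (z - y) * \<nu> (z - y)" using d(2)[of "z - y"] True by (simp add: field_simps)
            finally have "ennreal (t * (d * \<phi> (1 / z))) \<le> ennreal (t * ((z - y) * \<nu> (z - y)))"
              using L.t_pos by (intro ennreal_leI mult_left_mono) auto
            then show ?thesis using True by (simp add: mult_right_mono)
          next
            case False
            then show ?thesis using L.p_eq_0[of y] by (auto simp: not_less)
          qed
        qed
        also have "\<dots> = ennreal (z * L.p z)" using elim by simp
        finally have "t * (d * \<phi> (1 / z)) * c \<le> z * L.p z"
          using z L.p_nonneg[of z] by simp
        then show "d * c * (t / z * \<phi> (1 / z)) \<le> L.p z"
          using z by (simp add: field_simps)
      qed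
    qed
    then show ?thesis
    proof (rule AE_le_imp_le_closure[rotated 2])
      show "isCont (\<lambda>x. d * c * (t / x * \<phi> (1 / x))) x"
        using x by (intro continuous_intros isCont_phi_inverse) auto
      show "isCont L.p x" using L.continuous_p by (simp add: continuous_on_eq_continuous_at)
    qed auto
  qed
  moreover have "0 < d * c" using c d by simp
  ultimately show ?thesis by blast
qed

text \<open>Upper constant in the size-bias recursion: \<open>6 \<ge> 2 exp 1\<close> serves the small jumps, the other
  term jumps of size between \<open>x / 2\<close> and \<open>x\<close>.\<close>

definition CU :: real where "CU = max 6 (6 * cm * (cu * 2 powr \<beta>))"

text \<open>In the size-bias identity the part of the law below \<open>x / 2\<close> needs a jump of size at least
  \<open>x / 2\<close>, whose density is at most of order \<open>\<phi> (1 / x) / x\<close>.  On \<open>(x / 2, x)\<close> the density is at most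
  \<open>2 S / x\<close>, and \<open>\<integral> s \<nu> s ds\<close> over the jumps below \<open>x / 2\<close> is at most \<open>exp 1 * J 1 (1 / x)\<close>.\<close>

lemma jump_recursion:
  assumes "is_law \<mu> t"
  shows "AE x in lborel. 0 < x \<longrightarrow> (\<forall>S\<ge>0. (\<forall>y\<in>{x / 2..x}. y * law_density \<mu> t y \<le> S) \<longrightarrow>
    x * law_density \<mu> t x \<le> t * \<phi> (1 / x) * (CU * (1 + S)))"
proof -
  interpret L: subordinator_law \<phi> \<nu> \<alpha> \<beta> cl cu cm \<mu> t by fact
  show ?thesis
    using L.density_size_bias
  proof eventually_elim
    case (elim x)
    show ?case
    proof (intro impI allI)
      fix S assume x: "0 < x" and S: "0 \<le> S" "\<forall>y\<in>{x / 2..x}. y * L.p y \<le> S"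
      have pz: "0 \<le> \<phi> (1 / x)" using phi_pos[of "1 / x"] x by simp
      define a where "a = t * (6 * cm * (cu * 2 powr \<beta>) * \<phi> (1 / x))"
      define b where "b = t * exp 1 * (2 * S / x)"
      have a: "0 \<le> a" using L.t_pos constants pz by (simp add: a_def)
      have b: "0 \<le> b" using L.t_pos S x by (simp add: b_def)
      define h where "h s = s ^ 1 * exp (- (1 / x * s)) * \<nu> s" for s
      have [measurable]: "h \<in> borel_measurable borel" unfolding h_def by measurable
      have h: "0 \<le> h s" for s
        unfolding h_def using nu_nonneg[of s] nu_eq_0[of s] by (cases "0 \<le> s") auto
      have "ennreal (x * L.p x) = (\<integral>\<^sup>+y. ennreal (t * ((x - y) * \<nu> (x - y))) * ennreal (L.p y) \<partial>lborel)" by (rule elim)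
      also have "\<dots> \<le> (\<integral>\<^sup>+y. ennreal a * ennreal (L.p y) + ennreal b * ennreal (h (x - y)) \<partial>lborel)"
      proof (rule nn_integral_mono)
        fix y
        consider "y \<le> 0" | "0 < y" "y \<le> x / 2" | "x / 2 < y" "y < x" | "x \<le> y" by linarith
        then show "ennreal (t * ((x - y) * \<nu> (x - y))) * ennreal (L.p y) \<le> ennreal a * ennreal (L.p y) + ennreal b * ennreal (h (x - y))"
        proof cases
          case 1 then show ?thesis by (simp add: L.p_eq_0)
        next
          case 2
          have "(x - y) * \<nu> (x - y) \<le> 6 * cm * \<phi> (1 / (x - y))"
            using nu_upper[of "x - y"] 2 by (simp add: field_simps)
          also have "\<dots> \<le> 6 * cm * \<phi> (2 / x)"
            using 2 x constants by (intro mult_left_mono phi_mono) (auto simp: field_simps)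
          also have "\<dots> \<le> 6 * cm * (cu * 2 powr \<beta> * \<phi> (1 / x))"
            using upper_scaling[of "1 / x" "2 / x"] x constants by (intro mult_left_mono) (auto simp: field_simps)
          finally have "t * ((x - y) * \<nu> (x - y)) \<le> a"
            unfolding a_def using L.t_pos by (intro mult_left_mono) auto
          then have "ennreal (t * ((x - y) * \<nu> (x - y))) * ennreal (L.p y) \<le> ennreal a * ennreal (L.p y)"
            by (intro mult_right_mono ennreal_leI) auto
          then show ?thesis by (rule order_trans) simp
        next
          case 3
          have "y * L.p y \<le> S" using S 3 by auto
          moreover have "x / 2 * L.p y \<le> y * L.p y" using 3 L.p_nonneg[of y] by (intro mult_right_mono) auto
          ultimately have py: "L.p y \<le> 2 * S / x" using x by (simp add: field_simps)
          have "1 / x * (x - y) \<le> 1" using 3 x by (simp add: field_simps)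
          then have "exp (- 1) \<le> exp (- (1 / x * (x - y)))" by simp
          then have "(x - y) * \<nu> (x - y) * exp (- 1) \<le> (x - y) * \<nu> (x - y) * exp (- (1 / x * (x - y)))"
            using 3 nu_nonneg[of "x - y"] by (intro mult_left_mono) auto
          then have "(x - y) * \<nu> (x - y) * exp (- 1) \<le> h (x - y)"
            by (simp add: h_def mult_ac)
          then have "(x - y) * \<nu> (x - y) \<le> exp 1 * h (x - y)" by (simp add: exp_minus divide_simps mult_ac)
          then have "t * ((x - y) * \<nu> (x - y)) \<le> t * (exp 1 * h (x - y))"
            using L.t_pos by (intro mult_left_mono) auto
          then have "t * ((x - y) * \<nu> (x - y)) * L.p y \<le> t * (exp 1 * h (x - y)) * (2 * S / x)"
            by (rule mult_mono[OF _ py]) (use L.t_pos L.p_nonneg[of y] h in auto)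
          then have "t * ((x - y) * \<nu> (x - y)) * L.p y \<le> b * h (x - y)" by (simp add: b_def mult_ac)
          then have "ennreal (t * ((x - y) * \<nu> (x - y))) * ennreal (L.p y) \<le> ennreal b * ennreal (h (x - y))"
            using L.p_nonneg[of y] b h by (simp add: ennreal_mult'[symmetric] ennreal_mult''[symmetric] ennreal_leI)
          then show ?thesis by (rule order_trans) simp
        next
          case 4 then show ?thesis by (simp add: nu_eq_0)
        qed
      qed
      also have "\<dots> = ennreal a * (\<integral>\<^sup>+y. ennreal (L.p y) \<partial>lborel) + ennreal b * (\<integral>\<^sup>+y. ennreal (h (x - y)) \<partial>lborel)"
        by (subst nn_integral_add) (auto simp: nn_integral_cmult)
      also have "(\<integral>\<^sup>+y. ennreal (L.p y) \<partial>lborel) = emeasure \<mu> UNIV"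
        by (subst L.mu_eq_density) (simp add: emeasure_density)
      also have "\<dots> = 1" using L.emeasure_space_1 by simp
      also have "(\<integral>\<^sup>+y. ennreal (h (x - y)) \<partial>lborel) = (\<integral>\<^sup>+s. ennreal (h s) \<partial>lborel)"
        using nn_integral_real_affine[of "\<lambda>s. ennreal (h s)" "-1" x] by simp
      also have "\<dots> = ennreal (J 1 (1 / x))"
      proof -
        have "(\<integral>\<^sup>+s. ennreal (h s) \<partial>lborel) = (\<integral>\<^sup>+s. ennreal (s ^ 1 * exp (- (1 / x * s))) \<partial>\<Lambda>)"
          unfolding \<Lambda>_def by (subst nn_integral_density)
            (auto simp: h_def ennreal_mult''[symmetric] nu_nonneg mult.commute ennreal_mult'[symmetric])
        also have "\<dots> = ennreal (J 1 (1 / x))"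
          unfolding J_def using x AE_nonneg by (intro nn_integral_eq_integral integrable_power_exp) auto
        finally show ?thesis .
      qed
      also have "ennreal a * 1 + ennreal b * ennreal (J 1 (1 / x)) = ennreal (a + b * J 1 (1 / x))"
        using a b J_nonneg by (simp add: ennreal_mult)
      finally have 1: "x * L.p x \<le> a + b * J 1 (1 / x)"
        using a b J_nonneg[of 1 "1 / x"] by (subst (asm) ennreal_le_iff) auto
      have "J 1 (1 / x) \<le> x * \<phi> (1 / x)"
        using J_le_phi[of "1 / x" 1] x by (simp add: field_simps)
      then have "b * J 1 (1 / x) \<le> b * (x * \<phi> (1 / x))" using b by (intro mult_left_mono)
      also have "\<dots> = t * \<phi> (1 / x) * (2 * exp 1 * S)" using x by (simp add: b_def)
      also have "\<dots> \<le> t * \<phi> (1 / x) * (CU * S)"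
        using exp_le L.t_pos pz S by (intro mult_left_mono mult_right_mono) (auto simp: CU_def)
      finally have 2: "b * J 1 (1 / x) \<le> t * \<phi> (1 / x) * (CU * S)" .
      have "a = t * \<phi> (1 / x) * (6 * cm * (cu * 2 powr \<beta>))" by (simp add: a_def)
      also have "\<dots> \<le> t * \<phi> (1 / x) * CU"
        using L.t_pos pz by (intro mult_left_mono) (auto simp: CU_def)
      finally have "a \<le> t * \<phi> (1 / x) * CU" .
      with 1 2 show "x * L.p x \<le> t * \<phi> (1 / x) * (CU * (1 + S))" by (simp add: distrib_left)
    qed
  qed
qed

lemma CU_pos: "0 < CU" by (simp add: CU_def)

lemma jump_recursion_everywhere:
  assumes law: "is_law \<mu> t" and x: "0 < x" and S: "0 \<le> S" "\<forall>y\<in>{0..x}. y * law_density \<mu> t y \<le> S"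
  shows "x * law_density \<mu> t x \<le> t * \<phi> (1 / x) * (CU * (1 + S))"
proof -
  interpret L: subordinator_law \<phi> \<nu> \<alpha> \<beta> cl cu cm \<mu> t by fact
  have "AE z in lborel. z \<in> {0<..<x} \<longrightarrow> z * L.p z \<le> t * \<phi> (1 / z) * (CU * (1 + S))"
    using jump_recursion[OF law] by eventually_elim (use S in auto)
  then show ?thesis
  proof (rule AE_le_imp_le_closure[rotated 2])
    show "isCont (\<lambda>x. x * L.p x) x"
      using L.continuous_p by (intro continuous_intros) (simp add: continuous_on_eq_continuous_at)
    show "isCont (\<lambda>x. t * \<phi> (1 / x) * (CU * (1 + S))) x"
      using x by (intro continuous_intros isCont_phi_inverse) auto
  qed (use x in auto)
qed

text \<open>At the point \<open>y\<close> of \<open>[0, x]\<close> where \<open>y * p y\<close> is largest, either \<open>t * \<phi> (1 / y) \<ge> \<delta>\<close> and tilting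
  with \<open>1 / y\<close> gives the bound, or the recursion is a contraction.\<close>

lemma law_density_le_inverse: "\<exists>B>0. \<forall>\<mu> t x. is_law \<mu> t \<longrightarrow> 0 \<le> x \<longrightarrow> x * law_density \<mu> t x \<le> B"
proof -
  define \<delta> where "\<delta> = 1 / (2 * CU)"
  have \<delta>: "0 < \<delta>" using CU_pos by (simp add: \<delta>_def)
  obtain C where C: "C > 0" "\<And>\<mu> t w x. is_law \<mu> t \<Longrightarrow> 0 < w \<Longrightarrow> \<delta> \<le> t * \<phi> w \<Longrightarrow>
    law_density \<mu> t x \<le> C * (w / sqrt (t * \<phi> w) * exp (w * x - t * \<phi> w))"
    using law_density_le_tilt[OF \<delta>] by blast
  define B where "B = max 1 (C * (exp 1 / sqrt \<delta>))"
  have "x * law_density \<mu> t x \<le> B" if law: "is_law \<mu> t" and x: "0 \<le> x" for \<mu> t x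
  proof -
    interpret L: subordinator_law \<phi> \<nu> \<alpha> \<beta> cl cu cm \<mu> t by fact
    have "continuous_on {0..x} (\<lambda>y. y * L.p y)"
      using continuous_on_subset[OF L.continuous_p] by (intro continuous_intros) auto
    then obtain y where y: "y \<in> {0..x}" "\<And>z. z \<in> {0..x} \<Longrightarrow> z * L.p z \<le> y * L.p y"
      using continuous_attains_sup[of "{0..x}" "\<lambda>y. y * L.p y"] x by auto
    have "y * L.p y \<le> B"
    proof (cases "y = 0")
      case False
      then have y0: "0 < y" using y by auto
      show ?thesis
      proof (cases "\<delta> \<le> t * \<phi> (1 / y)")
        case True
        have "L.p y \<le> C * (1 / y / sqrt (t * \<phi> (1 / y)) * exp (1 / y * y - t * \<phi> (1 / y)))"
          using y0 True by (intro C(2)[OF law]) auto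
        also have "\<dots> \<le> C * (1 / y / sqrt \<delta> * exp 1)"
          using y0 True \<delta> C(1) by (intro mult_left_mono mult_mono divide_left_mono) auto
        finally have "y * L.p y \<le> y * (C * (1 / y / sqrt \<delta> * exp 1))"
          using y0 by (intro mult_left_mono) auto
        then show ?thesis using y0 by (simp add: B_def mult_ac)
      next
        case False
        have nn: "0 \<le> y * L.p y" using y0 L.p_nonneg[of y] by simp
        have "y * L.p y \<le> t * \<phi> (1 / y) * (CU * (1 + y * L.p y))"
          using y by (intro jump_recursion_everywhere[OF law y0 nn]) auto
        also have "\<dots> \<le> \<delta> * (CU * (1 + y * L.p y))"
          using False CU_pos nn by (intro mult_right_mono) auto
        also have "\<dots> = (1 + y * L.p y) / 2" using CU_pos by (simp add: \<delta>_def)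
        finally show ?thesis by (simp add: B_def)
      qed
    qed (simp add: B_def)
    then show ?thesis using y(2)[of x] x by auto
  qed
  moreover have "0 < B" by (simp add: B_def)
  ultimately show ?thesis by blast
qed

lemma law_density_le_jump:
  "\<exists>C>0. \<forall>\<mu> t x. is_law \<mu> t \<longrightarrow> 0 < x \<longrightarrow> law_density \<mu> t x \<le> C * (t / x * \<phi> (1 / x))"
proof -
  obtain B where B: "B > 0" "\<And>\<mu> t x. is_law \<mu> t \<Longrightarrow> 0 \<le> x \<Longrightarrow> x * law_density \<mu> t x \<le> B"
    using law_density_le_inverse by blast
  have "law_density \<mu> t x \<le> CU * (1 + B) * (t / x * \<phi> (1 / x))" if law: "is_law \<mu> t" and x: "0 < x" for \<mu> t x
    using jump_recursion_everywhere[OF law x, of B] B(1) B(2)[OF law] x by (simp add: field_simps)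
  moreover have "0 < CU * (1 + B)" using CU_pos B by simp
  ultimately show ?thesis by blast
qed

end

section \<open>Comparison with the profile\<close>

lemma powr_one_minus_powr_root:
  fixes r :: real assumes "0 \<le> r" "\<beta> < 1" "r powr (1 / (1 - \<beta>)) \<le> u"
  shows "r \<le> u powr (1 - \<beta>)"
proof -
  have "r = (r powr (1 / (1 - \<beta>))) powr (1 - \<beta>)" using assms by (simp add: powr_powr)
  also have "\<dots> \<le> u powr (1 - \<beta>)" using assms by (intro powr_mono2) auto
  finally show ?thesis .
qed

context scaling_exponent
begin

lemma J_pos: "0 < w \<Longrightarrow> 1 \<le> n \<Longrightarrow> 0 < J n w"
proof -
  assume w: "0 < w" and n: "1 \<le> n"
  obtain c where c: "c > 0" "\<And>w. w > 0 \<Longrightarrow> c * \<phi> w \<le> w ^ n * J n w"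
    using J_ge_phi[OF n] by blast
  have "0 < c * \<phi> w" using c(1) phi_pos[OF w] by simp
  also have "\<dots> \<le> w ^ n * J n w" by (rule c(2)[OF w])
  finally show ?thesis using w by (simp add: zero_less_mult_iff)
qed

lemma phi_less: "0 \<le> x \<Longrightarrow> x < y \<Longrightarrow> \<phi> x < \<phi> y"
proof (cases "x = 0")
  case False
  assume "0 \<le> x" "x < y"
  then show ?thesis
    using False J_pos by (intro DERIV_pos_imp_increasing[of x y \<phi>]) (auto intro!: exI[of _ "J 1 _"] DERIV_phi)
qed (use phi_pos in auto)

lemma phi_surj:
  assumes y: "0 < y" shows "\<exists>r>0. \<phi> r = y"
proof -
  \<comment> \<open>By the lower scaling from \<open>a\<close> to \<open>1\<close> and from \<open>1\<close> to \<open>b\<close>, these points satisfy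
    \<open>\<phi> a \<le> y \<le> \<phi> b\<close>.\<close>
  define a where "a = min 1 ((cl * y / \<phi> 1) powr (1 / \<alpha>))"
  define b where "b = max 1 ((y / (cl * \<phi> 1)) powr (1 / \<alpha>))"
  have p1: "0 < \<phi> 1" by (rule phi_pos) simp
  have a: "0 < a" "a \<le> 1" using constants y p1 by (auto simp: a_def)
  have b: "1 \<le> b" by (simp add: b_def)
  have "\<phi> a \<le> y"
  proof -
    have "a powr \<alpha> \<le> ((cl * y / \<phi> 1) powr (1 / \<alpha>)) powr \<alpha>"
      using a exponents by (intro powr_mono2) (auto simp: a_def)
    also have "\<dots> = cl * y / \<phi> 1" using constants y p1 exponents by (simp add: powr_powr)
    finally have 1: "a powr \<alpha> * \<phi> 1 \<le> cl * y" using p1 by (simp add: field_simps)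
    have "cl * (1 / a) powr \<alpha> * \<phi> a \<le> \<phi> 1" using lower_scaling[of a 1] a by simp
    then have "cl * \<phi> a \<le> a powr \<alpha> * \<phi> 1" using a by (simp add: powr_divide field_simps)
    with 1 have "cl * \<phi> a \<le> cl * y" by simp
    then show ?thesis using constants by simp
  qed
  moreover have "y \<le> \<phi> b"
  proof -
    have "y / (cl * \<phi> 1) = ((y / (cl * \<phi> 1)) powr (1 / \<alpha>)) powr \<alpha>"
      using constants y p1 exponents by (simp add: powr_powr)
    also have "\<dots> \<le> b powr \<alpha>" using exponents by (intro powr_mono2) (auto simp: b_def)
    finally have "y \<le> cl * b powr \<alpha> * \<phi> 1" using constants p1 by (simp add: field_simps)
    then show ?thesis using lower_scaling[of 1 b] b by simp
  qed
  moreover have "\<forall>x. a \<le> x \<and> x \<le> b \<longrightarrow> isCont \<phi> x" using a isCont_phi by auto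
  ultimately obtain r where "a \<le> r" "r \<le> b" "\<phi> r = y"
    using IVT[of \<phi> a y b] a b by auto
  then show ?thesis using a by (intro exI[of _ r]) auto
qed

lemma phi_inv_eq: "0 \<le> r \<Longrightarrow> \<phi> r = y \<Longrightarrow> phi_inv \<phi> y = r"
  unfolding phi_inv_def
proof (rule the_inv_into_f_eq)
  show "inj_on \<phi> {0..}"
  proof (rule linorder_inj_onI)
    fix x y :: real assume "x < y" "x \<in> {0..}" "y \<in> {0..}"
    then show "\<phi> x \<noteq> \<phi> y" using phi_less[of x y] by auto
  qed auto
qed auto

lemma phi_inv_le_one_iff:
  assumes t: "0 < t" and x: "0 < x"
  shows "0 < x * phi_inv \<phi> (1 / t) \<and> x * phi_inv \<phi> (1 / t) \<le> 1 \<longleftrightarrow> 1 \<le> t * \<phi> (1 / x)"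
proof -
  obtain r where r: "0 < r" "\<phi> r = 1 / t" using phi_surj[of "1 / t"] t by auto
  then have inv: "phi_inv \<phi> (1 / t) = r" by (intro phi_inv_eq) auto
  have "x * r \<le> 1 \<longleftrightarrow> r \<le> 1 / x" using x by (simp add: field_simps)
  also have "\<dots> \<longleftrightarrow> \<phi> r \<le> \<phi> (1 / x)"
    using phi_mono[of r "1 / x"] phi_less[of "1 / x" r] r x by (auto simp: not_le[symmetric] dest: leD)
  also have "\<dots> \<longleftrightarrow> 1 \<le> t * \<phi> (1 / x)" unfolding r(2) using t by (simp add: divide_le_eq mult.commute)
  finally show ?thesis using r(1) x by (simp add: inv)
qed

lemma J1_less:
  assumes "0 < x" "x < y" shows "J 1 y < J 1 x"
proof (rule DERIV_neg_imp_decreasing[OF assms(2)])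
  fix u assume "x \<le> u"
  then have "0 < u" using assms by simp
  then show "\<exists>d. (J 1 has_real_derivative d) (at u) \<and> d < 0"
    using DERIV_J[of u 1] J_pos[of u "Suc 1"] by (intro exI[of _ "- J (Suc 1) u"]) simp
qed

lemma J1_surj:
  assumes y: "0 < y" shows "\<exists>w>0. J 1 w = y"
proof -
  obtain c where c: "c > 0" "\<And>w. w > 0 \<Longrightarrow> c * \<phi> w \<le> w ^ 1 * J 1 w"
    using J_ge_phi[of 1] by blast
  have p1: "0 < \<phi> 1" by (rule phi_pos) simp
  \<comment> \<open>By the upper scaling with \<open>\<beta> < 1\<close>, and since \<open>w * J 1 w\<close> is comparable with \<open>\<phi> w\<close>, these
    points satisfy \<open>J 1 b \<le> y \<le> J 1 a\<close>.\<close>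
  define b where "b = max 1 ((cu * \<phi> 1 / y) powr (1 / (1 - \<beta>)))"
  define a where "a = 1 / max 1 ((cu * y / (c * \<phi> 1)) powr (1 / (1 - \<beta>)))"
  have a: "0 < a" "a \<le> 1" by (auto simp: a_def divide_le_eq_1)
  have b: "1 \<le> b" by (simp add: b_def)
  have "J 1 b \<le> y"
  proof -
    have "cu * \<phi> 1 / y \<le> b powr (1 - \<beta>)"
      using constants p1 y exponents by (intro powr_one_minus_powr_root) (auto simp: b_def)
    then have "cu * \<phi> 1 * b powr \<beta> \<le> y * b powr (1 - \<beta>) * b powr \<beta>" using y b by (simp add: field_simps)
    also have "\<dots> = y * b" using b by (simp add: powr_add[symmetric] mult.assoc)
    finally have "cu * b powr \<beta> * \<phi> 1 \<le> y * b" by (simp add: mult_ac)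
    moreover have "b * J 1 b \<le> \<phi> b" using J_le_phi[of b 1] b by simp
    moreover have "\<phi> b \<le> cu * b powr \<beta> * \<phi> 1" using upper_scaling[of 1 b] b by simp
    ultimately have "b * J 1 b \<le> b * y" by (simp add: mult_ac)
    then show ?thesis using b by simp
  qed
  moreover have "y \<le> J 1 a"
  proof -
    have "cu * y / (c * \<phi> 1) \<le> (1 / a) powr (1 - \<beta>)"
      using constants p1 y c exponents by (intro powr_one_minus_powr_root) (auto simp: a_def)
    then have "cu * y \<le> (1 / a) powr (1 - \<beta>) * (c * \<phi> 1)"
      using c p1 by (subst (asm) pos_divide_le_eq) auto
    then have "cu * y * (1 / a) powr \<beta> \<le> (1 / a) powr (1 - \<beta>) * (c * \<phi> 1) * (1 / a) powr \<beta>"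
      by (intro mult_right_mono) auto
    also have "\<dots> = c * \<phi> 1 * ((1 / a) powr (1 - \<beta>) * (1 / a) powr \<beta>)" by simp
    also have "(1 / a) powr (1 - \<beta>) * (1 / a) powr \<beta> = 1 / a" using a by (simp add: powr_add[symmetric])
    finally have 1: "cu * y * (1 / a) powr \<beta> \<le> c * \<phi> 1 / a" by simp
    have "c * \<phi> 1 \<le> c * (cu * (1 / a) powr \<beta> * \<phi> a)"
      using upper_scaling[of a 1] a c by simp
    also have "\<dots> = cu * (1 / a) powr \<beta> * (c * \<phi> a)" by simp
    also have "\<dots> \<le> cu * (1 / a) powr \<beta> * (a * J 1 a)" using c(2)[of a] a constants by (intro mult_left_mono) auto
    finally have "c * \<phi> 1 / a \<le> cu * (1 / a) powr \<beta> * J 1 a" using a by (simp add: field_simps)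
    with 1 have "cu * (1 / a) powr \<beta> * y \<le> cu * (1 / a) powr \<beta> * J 1 a" by (simp add: mult_ac)
    then show ?thesis using constants a by simp
  qed
  moreover have "\<forall>x. a \<le> x \<and> x \<le> b \<longrightarrow> isCont (J 1) x"
    using a DERIV_J[of _ 1] DERIV_isCont by (metis less_le_trans order_refl)
  ultimately obtain w where "a \<le> w" "w \<le> b" "J 1 w = y"
    using IVT2[of "J 1" b y a] a b by auto
  then show ?thesis using a by (intro exI[of _ w]) auto
qed

lemma dphi_inv_eq: "0 < w \<Longrightarrow> J 1 w = y \<Longrightarrow> dphi_inv \<phi> y = w"
  unfolding dphi_inv_def
proof (rule the_inv_into_f_eq)
  show "inj_on (deriv \<phi>) {0<..}"
  proof (rule linorder_inj_onI)
    fix x y :: real assume "x < y" "x \<in> {0<..}" "y \<in> {0<..}"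
    then show "deriv \<phi> x \<noteq> deriv \<phi> y" using J1_less[of x y] by (auto simp: deriv_phi)
  qed auto
qed (auto simp: deriv_phi)

lemma density_profile_saddle:
  assumes t: "0 < t" and w: "0 < w" and x: "0 < x" "x = t * J 1 w" and k: "1 \<le> t * \<phi> (1 / x)"
  shows "density_profile \<phi> t x = exp (w * x - t * \<phi> w) / sqrt (t * J 2 w)"
proof -
  have "dphi_inv \<phi> (x / t) = w" using t x by (intro dphi_inv_eq w) simp
  moreover have "(t * J 2 w) powr (- 1 / 2) = 1 / sqrt (t * J 2 w)"
    using t J_nonneg[of 2 w] by (simp add: powr_minus_divide powr_half_sqrt)
  moreover have "- t * (\<phi> w - w * J 1 w) = w * x - t * \<phi> w" using x by (simp add: algebra_simps)
  ultimately show ?thesis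
    using phi_inv_le_one_iff[OF t x(1)] k w by (simp add: density_profile_def deriv_phi deriv_deriv_phi)
qed

lemma density_profile_jump:
  assumes "0 < t" "0 < x" "\<not> 1 \<le> t * \<phi> (1 / x)"
  shows "density_profile \<phi> t x = t / x * \<phi> (1 / x)"
  unfolding density_profile_def using phi_inv_le_one_iff[OF assms(1,2)] assms(3) by (intro if_not_P) simp

lemma standard_deviation_bounds:
  "\<exists>c>0. \<forall>t>0. \<forall>w>0. c * (w / sqrt (t * \<phi> w)) \<le> 1 / sqrt (t * J 2 w) \<and>
     1 / sqrt (t * J 2 w) \<le> w / sqrt (t * \<phi> w) / c"
proof -
  obtain d where d: "d > 0" "\<And>w. w > 0 \<Longrightarrow> d * \<phi> w \<le> w ^ 2 * J 2 w"
    using J_ge_phi[of 2] by auto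
  define c where "c = min (1 / sqrt 2) (sqrt d)"
  have c: "0 < c" "c \<le> 1 / sqrt 2" "c \<le> sqrt d" using d by (auto simp: c_def)
  have "c * (w / sqrt (t * \<phi> w)) \<le> 1 / sqrt (t * J 2 w) \<and> 1 / sqrt (t * J 2 w) \<le> w / sqrt (t * \<phi> w) / c"
    if t: "0 < t" and w: "0 < w" for t w
  proof -
    define k where "k = sqrt (t * \<phi> w)"
    define s where "s = w * sqrt (t * J 2 w)"
    have k: "0 < k" using t phi_pos[OF w] by (simp add: k_def)
    have s: "0 < s" using t w J_pos[OF w, of 2] by (simp add: s_def)
    have s2: "s = sqrt (t * (w ^ 2 * J 2 w))" using w by (simp add: s_def real_sqrt_mult)
    have "s \<le> sqrt (t * (2 * \<phi> w))"
      unfolding s2 using J_le_phi[OF w, of 2] t by (intro real_sqrt_le_mono mult_left_mono) auto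
    also have "\<dots> = sqrt 2 * k" by (simp add: k_def real_sqrt_mult)
    finally have 1: "s \<le> sqrt 2 * k" .
    have "sqrt d * k = sqrt (t * (d * \<phi> w))" by (simp add: k_def real_sqrt_mult)
    also have "\<dots> \<le> s"
      unfolding s2 using d(2)[OF w] t by (intro real_sqrt_le_mono mult_left_mono) auto
    finally have 2: "sqrt d * k \<le> s" .
    have "c * s \<le> 1 / sqrt 2 * (sqrt 2 * k)" using c 1 s by (intro mult_mono) auto
    then have 3: "c * s \<le> k" by simp
    have "c * k \<le> sqrt d * k" using c k by (intro mult_right_mono) auto
    then have 4: "c * k \<le> s" using 2 by simp
    have eq: "1 / sqrt (t * J 2 w) = w / s" using w by (simp add: s_def)
    have "w * (c * s) \<le> w * k" "w * (c * k) \<le> w * s"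
      using 3 4 w by (auto intro: mult_left_mono)
    then show ?thesis
      unfolding k_def[symmetric] eq using k s c(1) by (simp add: field_simps)
  qed
  then show ?thesis using c by blast
qed

text \<open>If \<open>x = t * J 1 w\<close> and \<open>t * \<phi> (1 / x) \<ge> 1\<close>, then \<open>k = t * \<phi> w\<close> is bounded away from \<open>0\<close>.  The
  point is that \<open>w * x\<close> is comparable with \<open>k\<close>, while \<open>1 \<le> t * \<phi> (1 / x) \<le> cu * (w * x) powr (- \<beta>) * k\<close>
  if \<open>w * x < 1\<close>; since \<open>\<beta> < 1\<close>, this bounds \<open>w * x\<close> from below.\<close>

lemma saddle_regime:
  "\<exists>\<kappa>>0. \<exists>a\<ge>1. \<forall>t>0. \<forall>w>0. 1 \<le> t * \<phi> (1 / (t * J 1 w)) \<longrightarrow>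
     \<kappa> \<le> t * \<phi> w \<and> w * (t * J 1 w) \<le> t * \<phi> w \<and> t * \<phi> (1 / (t * J 1 w)) \<le> a * (t * \<phi> w)"
proof -
  obtain d where d: "d > 0" "\<And>w. w > 0 \<Longrightarrow> d * \<phi> w \<le> w ^ 1 * J 1 w"
    using J_ge_phi[of 1] by blast
  define \<kappa> where "\<kappa> = min 1 ((d / cu) powr (1 / (1 - \<beta>)))"
  have \<kappa>: "0 < \<kappa>" using d constants by (simp add: \<kappa>_def)
  define a where "a = max 1 (cu * (1 / \<kappa>) powr \<beta>)"
  have "\<kappa> \<le> t * \<phi> w \<and> w * (t * J 1 w) \<le> t * \<phi> w \<and> t * \<phi> (1 / (t * J 1 w)) \<le> a * (t * \<phi> w)"
    if t: "0 < t" and w: "0 < w" and one: "1 \<le> t * \<phi> (1 / (t * J 1 w))" for t w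
  proof -
    define x where "x = t * J 1 w"
    have x: "0 < x" using t J_pos[OF w, of 1] by (simp add: x_def)
    have wx: "0 < w * x" using w x by simp
    have up: "w * x \<le> t * \<phi> w"
      using J_le_phi[OF w, of 1] t by (simp add: x_def mult.left_commute)
    have "t * (d * \<phi> w) \<le> t * (w ^ 1 * J 1 w)" using d(2)[OF w] t by (intro mult_left_mono) auto
    then have lo: "d * (t * \<phi> w) \<le> w * x" by (simp add: x_def mult_ac)
    have k0: "0 < t * \<phi> w" using t phi_pos[OF w] by simp
    have "\<kappa> \<le> w * x \<and> t * \<phi> (1 / x) \<le> a * (t * \<phi> w)"
    proof (cases "1 \<le> w * x")
      case True
      then have "\<phi> (1 / x) \<le> \<phi> w" using x by (intro phi_mono) (auto simp: field_simps)
      then have "t * \<phi> (1 / x) \<le> t * \<phi> w" using t by (intro mult_left_mono) auto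
      moreover have "1 * (t * \<phi> w) \<le> a * (t * \<phi> w)" using k0 by (intro mult_right_mono) (auto simp: a_def)
      ultimately show ?thesis using True by (auto simp: \<kappa>_def)
    next
      case False
      then have wle: "w \<le> 1 / x" using x by (simp add: field_simps)
      have "t * \<phi> (1 / x) \<le> t * (cu * (1 / x / w) powr \<beta> * \<phi> w)"
        using upper_scaling[OF w wle] t by (intro mult_left_mono) auto
      also have "\<dots> = cu * (1 / (w * x)) powr \<beta> * (t * \<phi> w)" by (simp add: mult_ac)
      finally have 1: "t * \<phi> (1 / x) \<le> cu * (1 / (w * x)) powr \<beta> * (t * \<phi> w)" .
      have "1 \<le> cu * (1 / (w * x)) powr \<beta> * (t * \<phi> w)" using 1 one by (simp add: x_def)
      also have "\<dots> \<le> cu * (1 / (w * x)) powr \<beta> * (w * x / d)"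
        using lo d constants by (intro mult_left_mono) (auto simp: field_simps)
      also have "\<dots> = cu / d * ((w * x) powr 1 / (w * x) powr \<beta>)" using wx by (simp add: powr_divide)
      also have "\<dots> = cu / d * (w * x) powr (1 - \<beta>)" by (simp add: powr_diff)
      finally have "d / cu \<le> (w * x) powr (1 - \<beta>)" using d constants by (simp add: field_simps)
      then have "(d / cu) powr (1 / (1 - \<beta>)) \<le> ((w * x) powr (1 - \<beta>)) powr (1 / (1 - \<beta>))"
        using d constants exponents by (intro powr_mono2) auto
      also have "\<dots> = w * x" using wx exponents by (simp add: powr_powr)
      finally have 2: "\<kappa> \<le> w * x" by (simp add: \<kappa>_def)
      have "(1 / (w * x)) powr \<beta> \<le> (1 / \<kappa>) powr \<beta>"
        using 2 \<kappa> wx exponents by (intro powr_mono2 divide_left_mono) auto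
      then have "cu * (1 / (w * x)) powr \<beta> * (t * \<phi> w) \<le> cu * (1 / \<kappa>) powr \<beta> * (t * \<phi> w)"
        using constants k0 by (intro mult_right_mono mult_left_mono) auto
      also have "\<dots> \<le> a * (t * \<phi> w)" using k0 by (intro mult_right_mono) (auto simp: a_def)
      finally show ?thesis using 1 2 by simp
    qed
    then show ?thesis using up by (simp add: x_def)
  qed
  moreover have "1 \<le> a" by (simp add: a_def)
  ultimately show ?thesis using \<kappa> by blast
qed

theorem law_density_comparable:
  "\<exists>C\<ge>1. \<forall>\<mu> t x. is_law \<mu> t \<longrightarrow> 0 < x \<longrightarrow>
    inverse C * law_density \<mu> t x \<le> density_profile \<phi> t x \<and> density_profile \<phi> t x \<le> C * law_density \<mu> t x"
proof -
  obtain \<kappa> a where \<kappa>: "0 < \<kappa>" and a: "1 \<le> a" and reg: "\<And>t w. 0 < t \<Longrightarrow> 0 < w \<Longrightarrow> 1 \<le> t * \<phi> (1 / (t * J 1 w)) \<Longrightarrow>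
     \<kappa> \<le> t * \<phi> w \<and> w * (t * J 1 w) \<le> t * \<phi> w \<and> t * \<phi> (1 / (t * J 1 w)) \<le> a * (t * \<phi> w)"
    using saddle_regime by blast
  obtain s where s: "0 < s" and sd: "\<And>t w. 0 < t \<Longrightarrow> 0 < w \<Longrightarrow> s * (w / sqrt (t * \<phi> w)) \<le> 1 / sqrt (t * J 2 w) \<and>
     1 / sqrt (t * J 2 w) \<le> w / sqrt (t * \<phi> w) / s"
    using standard_deviation_bounds by blast
  obtain C1 where C1: "0 < C1" "\<And>\<mu> t w x. is_law \<mu> t \<Longrightarrow> 0 < w \<Longrightarrow> \<kappa> \<le> t * \<phi> w \<Longrightarrow>
    law_density \<mu> t x \<le> C1 * (w / sqrt (t * \<phi> w) * exp (w * x - t * \<phi> w))"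
    using law_density_le_tilt[OF \<kappa>] by blast
  obtain c1 B where c1: "0 < c1" and B: "0 < B" and low: "\<And>\<mu> t w. is_law \<mu> t \<Longrightarrow> 0 < w \<Longrightarrow> B \<le> t * \<phi> w \<Longrightarrow>
    c1 * (w / sqrt (t * \<phi> w) * exp (w * (t * J 1 w) - t * \<phi> w)) \<le> law_density \<mu> t (t * J 1 w)"
    using law_density_ge_at_mean by blast
  obtain c2 where c2: "0 < c2" "\<And>\<mu> t x. is_law \<mu> t \<Longrightarrow> 0 < x \<Longrightarrow> t * \<phi> (1 / x) \<le> max 1 (a * B) \<Longrightarrow>
    c2 * (t / x * \<phi> (1 / x)) \<le> law_density \<mu> t x"
    using law_density_ge_jump[of "max 1 (a * B)"] less_le_trans[OF zero_less_one max.cobounded1] by blast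
  obtain C2 where C2: "0 < C2" "\<And>\<mu> t x. is_law \<mu> t \<Longrightarrow> 0 < x \<Longrightarrow> law_density \<mu> t x \<le> C2 * (t / x * \<phi> (1 / x))"
    using law_density_le_jump by blast
  define D where "D = B / sqrt \<kappa> / s / c2"
  have D: "0 < D" using B \<kappa> s c2 by (simp add: D_def)
  define C where "C = 1 + C1 / s + C2 + 1 / (s * c1) + D + 1 / c2"
  have terms: "0 \<le> C1 / s" "0 \<le> C2" "0 \<le> 1 / (s * c1)" "0 \<le> D" "0 \<le> 1 / c2"
    using C1 C2 c1 c2 s D by auto
  then have C: "1 \<le> C" "C1 / s \<le> C" "C2 \<le> C" "1 / (s * c1) \<le> C" "D \<le> C" "1 / c2 \<le> C"
    unfolding C_def by linarith+
  have main: "law_density \<mu> t x \<le> C * density_profile \<phi> t x \<and> density_profile \<phi> t x \<le> C * law_density \<mu> t x"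
    if law: "is_law \<mu> t" and x: "0 < x" for \<mu> t x
  proof -
    interpret L: subordinator_law \<phi> \<nu> \<alpha> \<beta> cl cu cm \<mu> t by fact
    note t = L.t_pos
    have pn: "0 \<le> L.p x" by (rule L.p_nonneg)
    have pz: "0 \<le> \<phi> (1 / x)" using phi_pos[of "1 / x"] x by simp
    show ?thesis
    proof (cases "1 \<le> t * \<phi> (1 / x)")
      case False
      have eq: "density_profile \<phi> t x = t / x * \<phi> (1 / x)" by (rule density_profile_jump[OF t x False])
      have nn: "0 \<le> density_profile \<phi> t x" unfolding eq using t x pz by simp
      have "L.p x \<le> C2 * density_profile \<phi> t x" unfolding eq by (rule C2(2)[OF law x])
      also have "\<dots> \<le> C * density_profile \<phi> t x" using C nn by (intro mult_right_mono)
      finally have 1: "L.p x \<le> C * density_profile \<phi> t x" .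
      have "c2 * density_profile \<phi> t x \<le> L.p x" unfolding eq using False by (intro c2(2)[OF law x]) auto
      then have "density_profile \<phi> t x \<le> 1 / c2 * L.p x" using c2 by (simp add: field_simps)
      also have "\<dots> \<le> C * L.p x" using C pn by (intro mult_right_mono)
      finally show ?thesis using 1 by simp
    next
      case True
      obtain w where w: "0 < w" "J 1 w = x / t" using J1_surj[of "x / t"] x t by auto
      have xw: "x = t * J 1 w" using w(2) t by simp
      define q where "q = w / sqrt (t * \<phi> w)"
      define e where "e = exp (w * x - t * \<phi> w)"
      have k: "\<kappa> \<le> t * \<phi> w" "w * x \<le> t * \<phi> w" "t * \<phi> (1 / x) \<le> a * (t * \<phi> w)"
        using reg[OF t w(1), folded xw] True by auto
      have q: "0 < q" using w k \<kappa> by (simp add: q_def)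
      have e: "0 < e" "e \<le> 1" using k by (auto simp: e_def)
      have eq: "density_profile \<phi> t x = e * (1 / sqrt (t * J 2 w))"
        using density_profile_saddle[OF t w(1) x xw True] by (simp add: e_def)
      have "e * (s * q) \<le> density_profile \<phi> t x" and "density_profile \<phi> t x \<le> e * (q / s)"
        unfolding eq using sd[OF t w(1)] e unfolding q_def[symmetric] by (intro mult_left_mono; simp)+
      then have lo: "q * e \<le> density_profile \<phi> t x / s" and up: "density_profile \<phi> t x \<le> q * e / s"
        using s by (auto simp: field_simps)
      have nn: "0 \<le> density_profile \<phi> t x" using lo q e s by (smt (verit) divide_neg_pos mult_pos_pos)
      have "L.p x \<le> C1 * (q * e)" unfolding q_def e_def by (rule C1(2)[OF law w(1) k(1)])
      also have "\<dots> \<le> C1 * (density_profile \<phi> t x / s)" using lo C1 by (intro mult_left_mono) auto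
      also have "\<dots> = C1 / s * density_profile \<phi> t x" by simp
      also have "\<dots> \<le> C * density_profile \<phi> t x" using C nn by (intro mult_right_mono)
      finally have 1: "L.p x \<le> C * density_profile \<phi> t x" .
      have "density_profile \<phi> t x \<le> C * L.p x"
      proof (cases "B \<le> t * \<phi> w")
        case True
        have "c1 * (q * e) \<le> L.p x"
          using low[OF law w(1) True] unfolding q_def e_def xw[symmetric] by simp
        then have "q * e / s \<le> 1 / (s * c1) * L.p x" using c1 s by (simp add: field_simps)
        also have "\<dots> \<le> C * L.p x" using C pn by (intro mult_right_mono)
        finally show ?thesis using up by simp
      next
        case False
        \<comment> \<open>Here \<open>k\<close> lies between \<open>\<kappa>\<close> and \<open>B\<close>: the profile is at most of order \<open>1 / x\<close>, and the bound
          for one big jump supplies a density of that order.\<close>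
        have "w \<le> B / x" using k(2) False x by (simp add: field_simps)
        have "q \<le> B / x / sqrt \<kappa>"
          unfolding q_def using \<open>w \<le> B / x\<close> k \<kappa> w B x by (intro frac_le) auto
        then have "q * e \<le> B / x / sqrt \<kappa> * 1" using e q B x \<kappa> by (intro mult_mono) auto
        then have "q * e / s \<le> B / x / sqrt \<kappa> / s" using s by (intro divide_right_mono) simp_all
        also have "\<dots> = D * (c2 * (1 / x))" using c2 by (simp add: D_def)
        also have "\<dots> \<le> D * (c2 * (t / x * \<phi> (1 / x)))"
          using D c2 True x by (intro mult_left_mono) (auto simp: field_simps)
        also have "\<dots> \<le> D * L.p x"
        proof (intro mult_left_mono c2(2)[OF law x])
          have "a * (t * \<phi> w) \<le> a * B" using False a by (intro mult_left_mono) auto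
          then show "t * \<phi> (1 / x) \<le> max 1 (a * B)" using k(3) by simp
        qed (use D in simp)
        also have "\<dots> \<le> C * L.p x" using C pn by (intro mult_right_mono)
        finally show ?thesis using up by simp
      qed
      with 1 show ?thesis by simp
    qed
  qed
  have "inverse C * law_density \<mu> t x \<le> density_profile \<phi> t x"
    if "is_law \<mu> t" "0 < x" for \<mu> t x
    using main[OF that] C(1) by (simp add: field_simps)
  with main C(1) show ?thesis by blast
qed

end

section \<open>Subordinators\<close>

text \<open>Otherwise the exponent would be linear on the half-line.\<close>

lemma levy_measure_nonzero:
  assumes lk: "levy_khintchine \<phi> b N" and nondeg: "\<exists>u>0. deriv (deriv \<phi>) u \<noteq> 0"
  shows "\<not> (AE s in N. False)"
proof
  assume ae: "AE s in N. False"
  have lin: "\<phi> u = b * u" if "0 \<le> u" for u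
  proof -
    have "(LINT s:{0<..}|N. 1 - exp (- u * s)) = 0"
      unfolding set_lebesgue_integral_def by (rule integral_eq_zero_AE) (use ae in eventually_elim, simp)
    then show ?thesis using lk that by (simp add: levy_khintchine_def)
  qed
  have d1: "deriv \<phi> u = b" if "0 < u" for u
  proof -
    have "\<forall>\<^sub>F v in nhds u. \<phi> v = b * v"
      using eventually_nhds_in_open[of "{0<..}" u] that by (auto elim!: eventually_mono simp: lin)
    then have "deriv \<phi> u = deriv (\<lambda>v. b * v) u" by (rule deriv_cong_ev) simp
    also have "\<dots> = b" by (rule DERIV_imp_deriv) (auto intro!: derivative_eq_intros)
    finally show ?thesis .
  qed
  have "deriv (deriv \<phi>) u = 0" if "0 < u" for u
  proof -
    have "\<forall>\<^sub>F v in nhds u. deriv \<phi> v = b"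
      using eventually_nhds_in_open[of "{0<..}" u] that by (auto elim!: eventually_mono simp: d1)
    then have "deriv (deriv \<phi>) u = deriv (\<lambda>v. b) u" by (rule deriv_cong_ev) simp
    then show ?thesis by simp
  qed
  with nondeg show False by auto
qed

lemma not_almost_increasing_levy_density:
  assumes levy: "levy_measure N" and dens: "has_levy_density N \<nu>"
    and inc: "almost_increasing 0 \<nu>" and nz: "\<not> (AE s in N. False)"
  shows False
proof -
  define \<nu>' where "\<nu>' s = indicator {0<..} s * \<nu> s" for s :: real
  have [measurable]: "\<nu>' \<in> borel_measurable borel"
    using dens by (simp add: has_levy_density_def set_borel_measurable_def \<nu>'_def[abs_def])
  have N: "N = density lborel (\<lambda>s. ennreal (\<nu>' s))" using dens by (simp add: has_levy_density_def \<nu>'_def)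
  obtain c where c: "0 < c" "\<And>x y. 0 < x \<Longrightarrow> x \<le> y \<Longrightarrow> c * \<nu> x \<le> \<nu> y"
    using inc by (auto simp: almost_increasing_def)
  have "\<exists>x>0. 0 < \<nu> x"
  proof (rule ccontr)
    assume "\<not> (\<exists>x>0. 0 < \<nu> x)"
    then have "\<nu> s \<le> 0" if "0 < s" for s using that by (meson not_le)
    then have "\<nu>' s \<le> 0" for s by (simp add: \<nu>'_def indicator_def)
    then have "AE s in N. False"
      unfolding N by (subst AE_density) (auto simp: ennreal_neg)
    with nz show False by simp
  qed
  then obtain x where x: "0 < x" "0 < \<nu> x" by blast
  define X where "X = max 1 x"
  define K where "K = c * \<nu> x"
  have K: "0 < K" using c x by (simp add: K_def)
  have "emeasure lborel {X..} = \<infinity>"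
  proof (rule ccontr)
    assume "emeasure lborel {X..} \<noteq> \<infinity>"
    then obtain r where r: "0 \<le> r" "emeasure lborel {X..} = ennreal r"
      by (cases "emeasure lborel {X..}") auto
    have "ennreal (r + 1) = emeasure lborel {X..X + (r + 1)}" using r by simp
    also have "\<dots> \<le> ennreal r" unfolding r(2)[symmetric] by (intro emeasure_mono) auto
    finally show False using r by simp
  qed
  then have "\<infinity> = (\<integral>\<^sup>+s. ennreal K * indicator {X..} s \<partial>lborel)"
    using K by (simp add: nn_integral_cmult_indicator ennreal_mult_top)
  also have "\<dots> \<le> (\<integral>\<^sup>+s. ennreal (\<nu>' s) * (ennreal (min 1 s) * indicator {0<..} s) \<partial>lborel)"
  proof (rule nn_integral_mono)
    fix s :: real
    show "ennreal K * indicator {X..} s \<le> ennreal (\<nu>' s) * (ennreal (min 1 s) * indicator {0<..} s)"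
    proof (cases "X \<le> s")
      case True
      then have "K \<le> \<nu>' s" "0 < s" "1 \<le> s"
        using c(2)[of x s] x by (auto simp: X_def \<nu>'_def K_def)
      then show ?thesis using True by (simp add: ennreal_leI min_def)
    qed simp
  qed
  also have "\<dots> = (\<integral>\<^sup>+ s \<in> {0<..}. ennreal (min 1 s) \<partial>N)"
    unfolding N by (rule nn_integral_density[symmetric]) auto
  also have "\<dots> < \<infinity>" using levy by (simp add: levy_measure_def)
  finally show False by simp
qed

text \<open>The hypotheses on the subordinator imply those of \<open>scaling_exponent\<close>: the exponent is positive,
  has no drift, since \<open>b u \<le> \<phi> u \<le> C u powr \<beta> \<phi> 1\<close> for \<open>u \<ge> 1\<close>, and its Levy density is almost
  decreasing.\<close>

lemma scaling_exponentI:
  assumes lk: "levy_khintchine \<phi> b N" and nondeg: "\<exists>u>0. deriv (deriv \<phi>) u \<noteq> 0"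
    and exps: "0 < \<alpha>" "\<alpha> \<le> \<beta>" "\<beta> < 1"
    and inc: "almost_increasing 0 (\<lambda>x. x powr (- \<alpha>) * \<phi> x)"
    and dec: "almost_decreasing 0 (\<lambda>x. x powr (- \<beta>) * \<phi> x)"
    and dens: "has_levy_density N \<nu>" and mono: "almost_monotone \<nu>"
  obtains cl cu cm where "scaling_exponent \<phi> (\<lambda>s. indicator {0<..} s * \<nu> s) \<alpha> \<beta> cl cu cm"
proof -
  have nz: "\<not> (AE s in N. False)" by (rule levy_measure_nonzero[OF lk nondeg])
  have levy: "levy_measure N" and b0: "0 \<le> b" using lk by (auto simp: levy_khintchine_def)
  have setsN [measurable_cong, simp]: "sets N = sets borel" using levy by (simp add: levy_measure_def)
  define \<nu>' where "\<nu>' s = indicator {0<..} s * \<nu> s" for s :: real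
  have [measurable]: "\<nu>' \<in> borel_measurable borel"
    using dens by (simp add: has_levy_density_def set_borel_measurable_def \<nu>'_def[abs_def])
  have \<nu>'0: "0 \<le> \<nu>' s" for s using dens by (auto simp: has_levy_density_def \<nu>'_def indicator_def)
  have N: "N = density lborel (\<lambda>s. ennreal (\<nu>' s))" using dens by (simp add: has_levy_density_def \<nu>'_def)
  have AEpos: "AE s in N. 0 < s"
    unfolding N by (subst AE_density, simp, intro AE_I2 impI, rule ccontr) (simp add: \<nu>'_def)
  have int_min: "integrable N (\<lambda>s. min 1 s)"
  proof (rule integrableI_bounded)
    have "(\<integral>\<^sup>+s. ennreal (norm (min 1 s)) \<partial>N) = (\<integral>\<^sup>+ s \<in> {0<..}. ennreal (min 1 s) \<partial>N)"
      using AEpos by (intro nn_integral_cong_AE, eventually_elim) auto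
    also have "\<dots> < \<infinity>" using levy by (simp add: levy_measure_def)
    finally show "(\<integral>\<^sup>+s. ennreal (norm (min 1 s)) \<partial>N) < \<infinity>" .
  qed simp
  interpret H: halfline_measure N
    using AEpos int_min by unfold_locales (auto elim: eventually_mono)
  have phi_b: "\<phi> u = b * u + (LINT s|N. 1 - exp (- (u * s)))" if "0 \<le> u" for u
  proof -
    have "(LINT s:{0<..}|N. 1 - exp (- u * s)) = (LINT s|N. 1 - exp (- (u * s)))"
      unfolding set_lebesgue_integral_def
      by (rule integral_cong_AE, measurable) (use AEpos in eventually_elim, simp)
    then show ?thesis using lk that by (simp add: levy_khintchine_def)
  qed
  have int_nonneg: "0 \<le> (LINT s|N. 1 - exp (- (u * s)))" if "0 \<le> u" for u
    by (rule integral_nonneg_AE) (use AEpos in eventually_elim, use that in simp)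
  have phi_pos: "0 < \<phi> u" if u: "0 < u" for u
  proof (rule ccontr)
    assume "\<not> 0 < \<phi> u"
    moreover have "0 \<le> b * u" using b0 u by simp
    ultimately have "(LINT s|N. 1 - exp (- (u * s))) = 0"
      using phi_b[of u] int_nonneg[of u] u by linarith
    moreover have "AE s in N. 0 \<le> 1 - exp (- (u * s))"
      using AEpos by eventually_elim (use u in simp)
    ultimately have "AE s in N. 1 - exp (- (u * s)) = 0"
      using integral_nonneg_eq_0_iff_AE[OF H.integrable_one_minus_exp[of u]] u by simp
    then have "AE s in N. False" using AEpos by eventually_elim (use u in auto)
    with nz show False by simp
  qed
  obtain C where C: "1 \<le> C" "\<And>x y. 0 < x \<Longrightarrow> x \<le> y \<Longrightarrow> C * (x powr (- \<beta>) * \<phi> x) \<ge> y powr (- \<beta>) * \<phi> y"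
    using dec by (auto simp: almost_decreasing_def)
  have upper: "\<phi> y \<le> C * (y / x) powr \<beta> * \<phi> x" if "0 < x" "x \<le> y" for x y
    using C(2)[OF that] that by (simp add: powr_minus powr_divide field_simps)
  obtain c where c: "0 < c" "\<And>x y. 0 < x \<Longrightarrow> x \<le> y \<Longrightarrow> c * (x powr (- \<alpha>) * \<phi> x) \<le> y powr (- \<alpha>) * \<phi> y"
    using inc by (auto simp: almost_increasing_def)
  have lower: "c * (y / x) powr \<alpha> * \<phi> x \<le> \<phi> y" if "0 < x" "x \<le> y" for x y
    using c(2)[OF that] that by (simp add: powr_minus powr_divide field_simps)
  have "b = 0"
  proof (rule ccontr)
    assume "b \<noteq> 0"
    then have b: "0 < b" using b0 by simp
    have p1: "0 < \<phi> 1" by (rule phi_pos) simp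
    define u where "u = max 1 ((2 * C * \<phi> 1 / b) powr (1 / (1 - \<beta>)))"
    have u: "1 \<le> u" by (simp add: u_def)
    have "2 * C * \<phi> 1 / b \<le> u powr (1 - \<beta>)"
      using C p1 b exps by (intro powr_one_minus_powr_root) (auto simp: u_def)
    then have "2 * C * \<phi> 1 \<le> u powr (1 - \<beta>) * b" using b by (subst (asm) pos_divide_le_eq) auto
    then have "2 * C * \<phi> 1 * u powr \<beta> \<le> u powr (1 - \<beta>) * b * u powr \<beta>" by (intro mult_right_mono) auto
    also have "\<dots> = b * u" using u by (simp add: powr_add[symmetric] mult_ac)
    also have "\<dots> \<le> \<phi> u" using phi_b[of u] int_nonneg[of u] u by simp
    also have "\<dots> \<le> C * u powr \<beta> * \<phi> 1" using upper[of 1 u] u by simp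
    finally have "C * u powr \<beta> * \<phi> 1 \<le> 0" by (simp add: mult_ac)
    moreover have "0 < C * u powr \<beta> * \<phi> 1" using C p1 u by simp
    ultimately show False by simp
  qed
  have "almost_decreasing 0 \<nu>"
    using mono not_almost_increasing_levy_density[OF levy dens _ nz] by (auto simp: almost_monotone_def)
  then obtain D where D: "1 \<le> D" "\<And>x y. 0 < x \<Longrightarrow> x \<le> y \<Longrightarrow> \<nu> y \<le> D * \<nu> x"
    by (auto simp: almost_decreasing_def)
  have "scaling_exponent \<phi> \<nu>' \<alpha> \<beta> c C D"
  proof
    show "integrable (density lborel (\<lambda>x. ennreal (\<nu>' x))) (min 1)" using int_min by (simp add: N)
    show "\<phi> u = (LINT s|density lborel (\<lambda>x. ennreal (\<nu>' x)). 1 - exp (- (u * s)))" if "0 \<le> u" for u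
      using phi_b[OF that] \<open>b = 0\<close> by (simp add: N)
    show "\<nu>' s = 0" if "s \<le> 0" for s using that by (simp add: \<nu>'_def)
    show "\<nu>' y \<le> D * \<nu>' x" if "0 < x" "x \<le> y" for x y using D(2)[OF that] that by (simp add: \<nu>'_def)
  qed (use phi_pos exps c C D lower upper \<nu>'0 in auto)
  then show thesis using that unfolding \<nu>'_def[abs_def] by blast
qed

theorem theorem1:
  fixes M :: "'a measure" and T :: "real \<Rightarrow> 'a \<Rightarrow> real"
    and \<phi> \<nu> :: "real \<Rightarrow> real" and N :: "real measure" and b \<alpha> \<beta> :: real
  assumes "subordinator M T"
    and "laplace_exponent M T \<phi>"
    and "levy_khintchine \<phi> b N"
    and "\<exists>u>0. deriv (deriv \<phi>) u \<noteq> 0"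
    and "0 < \<alpha>" and "\<alpha> \<le> \<beta>" and "\<beta> < 1"
    and "almost_increasing 0 (\<lambda>x. x powr (- \<alpha>) * \<phi> x)"
    and "almost_decreasing 0 (\<lambda>x. x powr (- \<beta>) * \<phi> x)"
    and "has_levy_density N \<nu>" and "almost_monotone \<nu>"
  shows "\<exists>p :: real \<Rightarrow> real \<Rightarrow> real.
    (\<forall>t>0. (\<forall>x. p t x \<ge> 0) \<and> continuous_on UNIV (p t) \<and> distributed M lborel (T t) (p t)) \<and>
    (\<exists>C\<ge>1. \<forall>t>0. \<forall>x>0.
      inverse C * p t x \<le> density_profile \<phi> t x \<and> density_profile \<phi> t x \<le> C * p t x)"
proof -
  interpret subordinator M T by fact
  obtain cl cu cm where "scaling_exponent \<phi> (\<lambda>s. indicator {0<..} s * \<nu> s) \<alpha> \<beta> cl cu cm"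
    by (rule scaling_exponentI[OF assms(3-11)])
  then interpret S: scaling_exponent \<phi> "\<lambda>s. indicator {0<..} s * \<nu> s" \<alpha> \<beta> cl cu cm .
  define \<mu> where "\<mu> t = distr M borel (T t)" for t
  have law: "S.is_law (\<mu> t) t" if t: "0 < t" for t
  proof -
    have [measurable]: "T t \<in> borel_measurable M" using rv[of t] t by simp
    interpret P: prob_space "\<mu> t" unfolding \<mu>_def by (rule prob_space_distr) simp
    show ?thesis
    proof
      show "sets (\<mu> t) = sets borel" by (simp add: \<mu>_def)
      have "AE \<omega> in M. 0 \<le> T t \<omega>"
        using nondecreasing_paths start
      proof eventually_elim
        case (elim \<omega>)
        then show ?case using t mono_onD[OF elim(1), of 0 t] by simp
      qed
      then show "AE x in \<mu> t. 0 \<le> x" unfolding \<mu>_def by (subst AE_distr_iff) auto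
      show "(LINT x|\<mu> t. exp (- (u * x))) = exp (- (t * \<phi> u))" if "0 \<le> u" for u
        using assms(2) that t unfolding \<mu>_def laplace_exponent_def
        by (subst integral_distr) auto
    qed fact
  qed
  define p where "p t = S.law_density (\<mu> t) t" for t
  have "(\<forall>x. p t x \<ge> 0) \<and> continuous_on UNIV (p t) \<and> distributed M lborel (T t) (p t)" if t: "0 < t" for t
  proof -
    interpret L: subordinator_law \<phi> "\<lambda>s. indicator {0<..} s * \<nu> s" \<alpha> \<beta> cl cu cm "\<mu> t" t by (rule law[OF t])
    have [measurable]: "T t \<in> borel_measurable M" using rv[of t] t by simp
    have "distr M lborel (T t) = density lborel L.p"
      using L.mu_eq_density unfolding \<mu>_def by (simp cong: distr_cong)
    then show ?thesis
      using L.p_nonneg L.continuous_p by (auto simp: p_def distributed_def)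
  qed
  moreover have "\<exists>C\<ge>1. \<forall>t>0. \<forall>x>0.
      inverse C * p t x \<le> density_profile \<phi> t x \<and> density_profile \<phi> t x \<le> C * p t x"
    using S.law_density_comparable law unfolding p_def by blast
  ultimately show ?thesis by blast
qed

end
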